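(* Let $\eta$ be a real-valued Lévy process with characteristic triplet $(\sigma_\eta^2,\nu_\eta,\gamma_\eta)$ and characteristic exponent $\Psi_\eta$. Let $f:[0,\infty)\to\mathbb R$ be a deterministic Borel measurable function such that the improper integral $\int_0^\infty f(s)\,d\eta_s$ exists. Assume that $f\ne0$ on a set of positive Lebesgue measure, and let $\lambda^1$ denote Lebesgue measure. Then each of the following conditions implies that $\int_0^\infty f(s)\,d\eta_s$ is absolutely continuous with respect to Lebesgue measure: (i) The characteristic triplet of $\eta$ satisfies $$\lambda^1(\{s\in[0,\infty):f(s)\ne0\})\cdot\liminf_{\varepsilon\downarrow0}\varepsilon^{-2}|\ln\varepsilon|^{-1}\left(\sigma_\eta^2+\int_{-\varepsilon}^\varepsilon x^2\,\nu_\eta(dx)\right)>\frac14,$$ or more generally $$\lambda^1(\{s\in[0,\infty):f(s)\neq0\})\cdot\liminf_{|z|\to\infty}\frac{-\Re(\Psi_\eta(z))}{\ln(1+|z|)}>\frac12.$$ (ii) The absolutely continuous part $\nu_{\eta,\mathrm{ac}}$ of $\nu_\eta$ satisfies $\lambda^1(\{s\in[0,\infty):f(s)\ne0\})\cdot\nu_{\eta,\mathrm{ac}}(\mathbb R)=\infty$. (iii) $\lambda^1(f^{-1}(B))=0$ for every Borel set $B\subseteq\mathbb R\setminus\{0\}$ with $\lambda^1(B)=0$, and $\lambda^1(\{s\in[0,\infty):f(s)\ne0\})\cdot\nu_\eta(\mathbb R)=\infty$. (iv) There is $b>0$ such that $\eta_b$ is absolutely continuous and the function $f$ is constant and different from zero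 on an interval of length $b$.
   Context: The characteristic exponent is defined by $E e^{iz\eta_t}=e^{t\Psi_\eta(z)}$, with $\Psi_\eta(z)=i\gamma_\eta z-\sigma_\eta^2z^2/2+\int_{\mathbb R}(e^{izx}-1-izx\mathbf 1_{[-1,1]}(x))\nu_\eta(dx)$, $\nu_\eta(\{0\})=0$. A Borel function $f:[0,\infty)\to\mathbb R$ is locally integrable with respect to $\eta$ if for every $t>0$ the function $f\mathbf 1_{[0,t]}$ is integrable with respect to the independently scattered random measure induced by $\eta$ in the sense of Rajput and Rosinski: there are simple functions $f_n$ on $[0,t]$ converging to $f$ Lebesgue-a.e. such that $\int_Af_n\,d\eta$ converges in probability for every Borel $A\subseteq[0,t]$; then $\int_0^tf(s)\,d\eta_s$ is the limit for $A=[0,t]$ (a càdlàg version in $t$ is chosen). The improper integral $\int_0^\infty f(s)\,d\eta_s$ exists if $f$ is locally integrable and $\int_0^tf(s)\,d\eta_s$ converges in probability (equivalently a.s.) to a finite random variable as $t\to\infty$, and it denotes this limit. $\nu_\eta=\nu_{\eta,\mathrm{ac}}+\nu_{\eta,\mathrm{sing}}$ is the Lebesgue decomposition with respect to $\lambda^1$. Convention: $0\cdot\infty=0$. A random variable is absolutely continuous if its law is. *)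

theory Defs
  imports "HOL-Probability.Probability"
begin

(* Measurability is required because measure assigns 0 to non-measurable sets. *)
definition tendsto_in_prob ::
  "'a measure \<Rightarrow> ('i \<Rightarrow> 'a \<Rightarrow> real) \<Rightarrow> ('a \<Rightarrow> real) \<Rightarrow> 'i filter \<Rightarrow> bool" where
  "tendsto_in_prob M X Y F \<longleftrightarrow>
     (\<forall>\<^sub>F i in F. X i \<in> borel_measurable M) \<and> Y \<in> borel_measurable M \<and>
     (\<forall>\<epsilon>>0. ((\<lambda>i. measure M {\<omega> \<in> space M. \<bar>X i \<omega> - Y \<omega>\<bar> > \<epsilon>}) \<longlongrightarrow> 0) F)"

(* The time index is real; only the values at times t >= 0 are constrained. *)
locale levy_process = prob_space M for M :: "'a measure" +
  fixes \<eta> :: "real \<Rightarrow> 'a \<Rightarrow> real"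
  assumes rv: "\<And>t. 0 \<le> t \<Longrightarrow> \<eta> t \<in> borel_measurable M"
    and start: "AE \<omega> in M. \<eta> 0 \<omega> = 0"
    and indep_increments: "\<And>(\<tau> :: nat \<Rightarrow> real) n.
      0 \<le> \<tau> 0 \<Longrightarrow> (\<And>i. i < n \<Longrightarrow> \<tau> i \<le> \<tau> (Suc i)) \<Longrightarrow>
      indep_vars (\<lambda>_. borel) (\<lambda>i \<omega>. \<eta> (\<tau> (Suc i)) \<omega> - \<eta> (\<tau> i) \<omega>) {..<n}"
    and stationary_increments: "\<And>s t. 0 \<le> s \<Longrightarrow> 0 \<le> t \<Longrightarrow>
      distr M borel (\<lambda>\<omega>. \<eta> (s + t) \<omega> - \<eta> s \<omega>) = distr M borel (\<eta> t)"
    and stochastically_continuous: "\<And>s. 0 \<le> s \<Longrightarrow>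
      tendsto_in_prob M \<eta> (\<eta> s) (at s within {0..})"
    and cadlag: "AE \<omega> in M. \<forall>t\<ge>0. continuous (at_right t) (\<lambda>s. \<eta> s \<omega>) \<and>
      (0 < t \<longrightarrow> (\<exists>l. ((\<lambda>s. \<eta> s \<omega>) \<longlongrightarrow> l) (at_left t)))"

definition levy_measure :: "real measure \<Rightarrow> bool" where
  "levy_measure \<nu> \<longleftrightarrow> sets \<nu> = sets borel \<and> emeasure \<nu> {0} = 0 \<and>
     (\<integral>\<^sup>+ x. ennreal (min 1 (x\<^sup>2)) \<partial>\<nu>) < \<infinity>"

definition levy_exponent :: "real \<Rightarrow> real measure \<Rightarrow> real \<Rightarrow> real \<Rightarrow> complex" where
  "levy_exponent \<sigma>2 \<nu> \<gamma> z =
     \<i> * of_real (\<gamma> * z) - of_real (\<sigma>2 * z\<^sup>2 / 2) +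
     (CLINT x|\<nu>. iexp (z * x) - 1 - \<i> * of_real (z * x * indicator {-1..1} x))"

(* The first entry of the triplet is the Gaussian variance (sigma squared). *)
definition has_char_triplet ::
  "'a measure \<Rightarrow> (real \<Rightarrow> 'a \<Rightarrow> real) \<Rightarrow> real \<Rightarrow> real measure \<Rightarrow> real \<Rightarrow> bool" where
  "has_char_triplet M \<eta> \<sigma>2 \<nu> \<gamma> \<longleftrightarrow> 0 \<le> \<sigma>2 \<and> levy_measure \<nu> \<and>
     (\<forall>t\<ge>0. \<forall>z. char (distr M borel (\<eta> t)) z = exp (of_real t * levy_exponent \<sigma>2 \<nu> \<gamma> z))"

definition bounded_borel :: "real set set" where
  "bounded_borel = {A \<in> sets borel. bounded A \<and> A \<subseteq> {0..}}"

(* Lam is an independently scattered random measure on the delta-ring of bounded Borel subsets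
   of the half-line. *)
definition indep_scattered :: "'a measure \<Rightarrow> (real set \<Rightarrow> 'a \<Rightarrow> real) \<Rightarrow> bool" where
  "indep_scattered M Lam \<longleftrightarrow>
     (\<forall>A\<in>bounded_borel. Lam A \<in> borel_measurable M) \<and>
     (\<forall>A :: nat \<Rightarrow> real set. range A \<subseteq> bounded_borel \<longrightarrow> disjoint_family A \<longrightarrow>
        prob_space.indep_vars M (\<lambda>_. borel) (\<lambda>n. Lam (A n)) UNIV \<and>
        ((\<Union>n. A n) \<in> bounded_borel \<longrightarrow>
           (AE \<omega> in M. (\<lambda>n. Lam (A n) \<omega>) sums Lam (\<Union>n. A n) \<omega>)))"

(* These values on intervals determine each Lam A up to a null set. The condition on {0} is needed
   because {0} is not covered by intervals of the form (a, b] with a >= 0. *)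
definition induced_random_measure ::
  "'a measure \<Rightarrow> (real \<Rightarrow> 'a \<Rightarrow> real) \<Rightarrow> (real set \<Rightarrow> 'a \<Rightarrow> real) \<Rightarrow> bool" where
  "induced_random_measure M \<eta> Lam \<longleftrightarrow> indep_scattered M Lam \<and>
     (AE \<omega> in M. Lam {0} \<omega> = 0) \<and>
     (\<forall>a b. 0 \<le> a \<longrightarrow> a \<le> b \<longrightarrow> (AE \<omega> in M. Lam {a<..b} \<omega> = \<eta> b \<omega> - \<eta> a \<omega>))"

(* Integral over A of the simple function g on [0,t]. *)
definition simple_random_integral ::
  "(real set \<Rightarrow> 'a \<Rightarrow> real) \<Rightarrow> real \<Rightarrow> (real \<Rightarrow> real) \<Rightarrow> real set \<Rightarrow> 'a \<Rightarrow> real" where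
  "simple_random_integral Lam t g A \<omega> =
     (\<Sum>y\<in>g ` {0..t}. y * Lam (A \<inter> {s \<in> {0..t}. g s = y}) \<omega>)"

(* Rajput-Rosinski: f is integrable over [0,t] with respect to Lam, and J is (a version of) the
   integral. *)
definition has_random_integral ::
  "'a measure \<Rightarrow> (real set \<Rightarrow> 'a \<Rightarrow> real) \<Rightarrow> (real \<Rightarrow> real) \<Rightarrow> real \<Rightarrow> ('a \<Rightarrow> real) \<Rightarrow> bool" where
  "has_random_integral M Lam f t J \<longleftrightarrow>
     (\<exists>g :: nat \<Rightarrow> real \<Rightarrow> real.
        (\<forall>n. simple_function (restrict_space borel {0..t}) (g n)) \<and>
        (AE s in lborel. s \<in> {0..t} \<longrightarrow> (\<lambda>n. g n s) \<longlonglongrightarrow> f s) \<and>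
        (\<forall>A\<in>sets borel. A \<subseteq> {0..t} \<longrightarrow>
           (\<exists>Y. tendsto_in_prob M (\<lambda>n. simple_random_integral Lam t (g n) A) Y sequentially)) \<and>
        tendsto_in_prob M (\<lambda>n. simple_random_integral Lam t (g n) {0..t}) J sequentially)"

(* The improper integral of f with respect to eta exists and X is a version of it. Local
   integrability is the existence of J t for every t > 0. Convergence in probability depends on
   each J t only up to null sets, so no cadlag version of J has to be selected. *)
definition has_improper_levy_integral ::
  "'a measure \<Rightarrow> (real \<Rightarrow> 'a \<Rightarrow> real) \<Rightarrow> (real \<Rightarrow> real) \<Rightarrow> ('a \<Rightarrow> real) \<Rightarrow> bool" where
  "has_improper_levy_integral M \<eta> f X \<longleftrightarrow>
     (\<exists>Lam J. induced_random_measure M \<eta> Lam \<and>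
        (\<forall>t>0. has_random_integral M Lam f t (J t)) \<and>
        tendsto_in_prob M J X at_top)"

definition lebesgue_decomposition :: "real measure \<Rightarrow> real measure \<Rightarrow> real measure \<Rightarrow> bool" where
  "lebesgue_decomposition \<nu> \<nu>ac \<nu>sing \<longleftrightarrow>
     sets \<nu>ac = sets borel \<and> sets \<nu>sing = sets borel \<and>
     (\<forall>A\<in>sets borel. emeasure \<nu> A = emeasure \<nu>ac A + emeasure \<nu>sing A) \<and>
     absolutely_continuous lborel \<nu>ac \<and>
     (\<exists>N\<in>null_sets lborel. emeasure \<nu>sing (- N) = 0)"

definition abs_cont_rv :: "'a measure \<Rightarrow> ('a \<Rightarrow> real) \<Rightarrow> bool" where
  "abs_cont_rv M X \<longleftrightarrow> absolutely_continuous lborel (distr M borel X)"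

end

theory Submission
  imports Defs
begin

text \<open>
  Write \<open>\<Psi>\<close> for the exponent of the Levy process and \<open>X\<close> for the integral of \<open>f\<close>. Formally the
  characteristic function of \<open>X\<close> is the exponential of the integral of \<open>\<Psi> (z * f s)\<close> over \<open>s\<close>.
  The proof only needs this for a bounded piece: if \<open>E\<close> is a bounded Borel set on which \<open>f\<close> is bounded, then
  \<open>char X z = exp (\<integral>\<^sub>E \<Psi> (z * f s) ds) * \<phi> z\<close> where \<open>\<phi>\<close> is again the characteristic function of a
  probability distribution (lemma \<open>char_fun_quotient_improper_integral\<close>). In other words, the law of \<open>X\<close>
  has a convolution factor which is the law of the integral of \<open>f\<close> over \<open>E\<close>. For step functions this is
  independence of the increments on \<open>E\<close> and off \<open>E\<close>; it survives the limits that define the integral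
  because pointwise limits of characteristic functions which are continuous at \<open>0\<close> are characteristic
  functions (\<open>char_fun_limit\<close>).

  Each condition is then read off from a suitable \<open>E\<close>.

  \<^item> If \<open>f\<close> is a constant \<open>c \<noteq> 0\<close> on an interval of length \<open>b\<close>, take this interval as \<open>E\<close>: the factor is
    the law of \<open>c * \<eta> b\<close>, and a convolution with an absolutely continuous factor is absolutely continuous
    (\<open>abs_cont_rv_constant_piece\<close>).

  \<^item> If \<open>S\<close> is a set of jump sizes bounded away from \<open>0\<close>, the jumps with size in \<open>S\<close> contribute to the factor a
    compound Poisson distribution of intensity \<open>c = \<lambda> E * \<nu> S\<close>, whose jumps are distributed as \<open>f s * x\<close>
    with \<open>s\<close> uniform on \<open>E\<close> and \<open>x\<close> drawn from \<open>\<nu>\<close> on \<open>S\<close>. If this jump law is absolutely continuous, a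
    null set can only be charged when there is no jump, so it has probability at most \<open>exp (- c)\<close>
    (\<open>abs_cont_rv_null_bound\<close>). The jump law is absolutely continuous if \<open>\<nu>\<close> is so on \<open>S\<close>, and also if null sets not
    containing \<open>0\<close> have null preimages under \<open>f\<close>; the mass conditions allow arbitrarily large \<open>c\<close>.

  \<^item> If \<open>- Re \<Psi>\<close> grows at least like \<open>\<kappa> * ln \<bar>z\<bar>\<close>, then \<open>\<bar>char X z\<bar>\<close> decays at least like
    \<open>\<bar>z\<bar> powr (- \<lambda> E * \<kappa>)\<close>, which is square integrable as soon as \<open>\<lambda> E * \<kappa> > 1 / 2\<close>; a distribution with
    square integrable characteristic function is absolutely continuous
    (\<open>absolutely_continuous_if_char_L2\<close>). The condition on the truncated second moments implies such a
    growth: \<open>1 - cos (z * x) \<ge> 2 * (z * x)\<^sup>2 / pi\<^sup>2\<close> for \<open>\<bar>z * x\<bar> \<le> pi\<close>, so \<open>\<epsilon> = pi / \<bar>z\<bar>\<close> turns the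
    constant \<open>1 / 4\<close> into \<open>1 / 2\<close>.
\<close>

section \<open>Characteristic functions and their limits\<close>

text \<open>
  This class is closed under products, rescaling of the argument and (by \<open>char_fun_limit\<close>) pointwise limits continuous
  at \<open>0\<close>. Convolution factors are found by manipulating functions in it, without constructing random variables.
\<close>

definition char_fun :: "(real \<Rightarrow> complex) \<Rightarrow> bool" where
  "char_fun \<phi> \<longleftrightarrow> (\<exists>\<mu>. real_distribution \<mu> \<and> char \<mu> = \<phi>)"

lemma char_funI: "real_distribution \<mu> \<Longrightarrow> (\<And>z. char \<mu> z = \<phi> z) \<Longrightarrow> char_fun \<phi>"
  unfolding char_fun_def by blast

lemma real_distribution_convolution:
  assumes "real_distribution \<mu>" "real_distribution \<kappa>"
  shows "real_distribution (\<mu> \<star> \<kappa>)"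
proof -
  interpret A: real_distribution \<mu> by fact
  interpret B: real_distribution \<kappa> by fact
  interpret P: pair_prob_space \<mu> \<kappa> ..
  show ?thesis
    unfolding convolution_def by (intro P.real_distribution_distr) measurable
qed

lemma char_convolution:
  assumes "real_distribution \<mu>" "real_distribution \<kappa>"
  shows "char (\<mu> \<star> \<kappa>) z = char \<mu> z * char \<kappa> z"
proof -
  interpret A: real_distribution \<mu> by fact
  interpret B: real_distribution \<kappa> by fact
  interpret P: pair_prob_space \<mu> \<kappa> ..
  have int: "integrable (\<mu> \<Otimes>\<^sub>M \<kappa>) (\<lambda>p. iexp (z * (fst p + snd p)))"
    by (rule P.integrable_const_bound[where B=1]) auto
  have "char (\<mu> \<star> \<kappa>) z = (CLINT p|\<mu> \<Otimes>\<^sub>M \<kappa>. iexp (z * (fst p + snd p)))"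
    unfolding convolution_def char_def by (subst integral_distr) (auto simp: split_beta')
  also have "\<dots> = (CLINT x|\<mu>. CLINT y|\<kappa>. iexp (z * (x + y)))"
    using P.integral_fst'[OF int] by simp
  also have "\<dots> = (CLINT x|\<mu>. CLINT y|\<kappa>. iexp (z * x) * iexp (z * y))"
    by (simp add: ring_distribs exp_add)
  also have "\<dots> = char \<mu> z * char \<kappa> z"
    unfolding char_def by simp
  finally show ?thesis .
qed

lemma char_fun_mult: "char_fun \<phi> \<Longrightarrow> char_fun \<psi> \<Longrightarrow> char_fun (\<lambda>z. \<phi> z * \<psi> z)"
  unfolding char_fun_def
  by (metis (no_types) char_convolution real_distribution_convolution)

lemma char_fun_shift: "char_fun (\<lambda>z. iexp (c * z))"
proof -
  interpret prob_space "return borel c" by (rule prob_space_return) auto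
  show ?thesis
    by (rule char_funI[of "return borel c"], unfold_locales)
       (auto simp: char_def integral_return mult.commute)
qed

lemma char_fun_one: "char_fun (\<lambda>z. 1)"
  using char_fun_shift[of 0] by simp

lemma char_fun_prod:
  "finite I \<Longrightarrow> (\<And>i. i \<in> I \<Longrightarrow> char_fun (\<phi> i)) \<Longrightarrow> char_fun (\<lambda>z. \<Prod>i\<in>I. \<phi> i z)"
  by (induction I rule: finite_induct) (auto intro: char_fun_one char_fun_mult)

lemma char_distr_times:
  assumes "real_distribution \<mu>"
  shows "char (distr \<mu> borel (\<lambda>x. c * x)) z = char \<mu> (z * c)"
proof -
  interpret A: real_distribution \<mu> by fact
  show ?thesis
    unfolding char_def by (subst integral_distr) (auto simp: mult.assoc)
qed

lemma char_fun_scale: "char_fun \<phi> \<Longrightarrow> char_fun (\<lambda>z. \<phi> (z * c))"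
  unfolding char_fun_def
proof safe
  fix \<mu> assume "real_distribution \<mu>"
  then interpret A: real_distribution \<mu> .
  have "real_distribution (distr \<mu> borel (\<lambda>x. c * x))" by auto
  then show "\<exists>\<mu>'. real_distribution \<mu>' \<and> char \<mu>' = (\<lambda>z. char \<mu> (z * c))"
    using char_distr_times[OF \<open>real_distribution \<mu>\<close>] by blast
qed

lemma char_fun_gauss:
  assumes "0 \<le> v" shows "char_fun (\<lambda>z. exp (of_real (- v * z\<^sup>2 / 2)))"
proof -
  have "char_fun (\<lambda>z. complex_of_real (exp (- z\<^sup>2 / 2)))"
    by (rule char_funI[OF real_dist_normal_dist]) (simp add: char_std_normal_distribution)
  from char_fun_scale[OF this, of "sqrt v"] show ?thesis
    using assms by (simp add: power_mult_distrib mult.commute exp_of_real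
      del: of_real_minus of_real_mult of_real_divide of_real_power)
qed

text \<open>
  Fubini for \<open>iexp (c * z * x)\<close>. With a normal distribution as one of the two it
  turns Gaussian averages of a characteristic function into Gaussian averages of the distribution itself, which is
  how both tails and densities are controlled below.
\<close>

lemma char_parseval:
  assumes "real_distribution \<mu>" "real_distribution \<kappa>"
  shows "(CLINT z|\<kappa>. char \<mu> (c * z)) = (CLINT x|\<mu>. char \<kappa> (c * x))"
proof -
  interpret A: real_distribution \<mu> by fact
  interpret B: real_distribution \<kappa> by fact
  interpret P: pair_prob_space \<mu> \<kappa> ..
  have int: "integrable (\<mu> \<Otimes>\<^sub>M \<kappa>) (\<lambda>(x, z). iexp (c * z * x))"
    by (rule P.integrable_const_bound[where B=1]) auto
  have "(CLINT z|\<kappa>. CLINT x|\<mu>. iexp (c * z * x)) = (CLINT x|\<mu>. CLINT z|\<kappa>. iexp (c * z * x))"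
    by (rule P.Fubini_integral[OF int])
  then show ?thesis
    unfolding char_def by (simp add: ac_simps)
qed

text \<open>
  The right-hand side is the integral of \<open>1 - exp (- (x / K)\<^sup>2 / 2)\<close> against \<open>\<mu>\<close> by
  \<open>char_parseval\<close>, and this function is at least \<open>1 - exp (- 1 / 2)\<close> for \<open>\<bar>x\<bar> \<ge> K\<close>.
\<close>

lemma tail_le_gauss_char:
  assumes "real_distribution \<mu>" "0 < K"
  shows "(1 - exp (- 1 / 2)) * measure \<mu> {x. K \<le> \<bar>x\<bar>}
     \<le> 1 - Re (CLINT z|std_normal_distribution. char \<mu> (z / K))"
proof -
  interpret A: real_distribution \<mu> by fact
  have "(CLINT z|std_normal_distribution. char \<mu> (z / K))
      = (CLINT x|\<mu>. of_real (exp (- (x / K)\<^sup>2 / 2)))"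
    using char_parseval[OF assms(1) real_dist_normal_dist, of "1 / K"]
    by (simp add: char_std_normal_distribution mult.commute)
  then have eq: "1 - Re (CLINT z|std_normal_distribution. char \<mu> (z / K))
      = 1 - (LINT x|\<mu>. exp (- (x / K)\<^sup>2 / 2))"
    by simp
  have int: "integrable \<mu> (\<lambda>x. exp (- (x / K)\<^sup>2 / 2))"
    by (rule A.integrable_const_bound[where B=1]) auto
  have "(1 - exp (- 1 / 2)) * measure \<mu> {x. K \<le> \<bar>x\<bar>}
      = (LINT x|\<mu>. (1 - exp (- 1 / 2)) * indicator {x. K \<le> \<bar>x\<bar>} x)"
    by simp
  also have "\<dots> \<le> (LINT x|\<mu>. 1 - exp (- (x / K)\<^sup>2 / 2))"
  proof (rule integral_mono)
    show "integrable \<mu> (\<lambda>x. (1 - exp (- 1 / 2)) * indicator {x. K \<le> \<bar>x\<bar>} x :: real)"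
      by (intro integrable_mult_right A.integrable_const_bound[where B=1])
         (auto split: split_indicator)
    show "integrable \<mu> (\<lambda>x. 1 - exp (- (x / K)\<^sup>2 / 2))"
      using int by simp
    fix x
    have "1 \<le> (x / K)\<^sup>2" if "K \<le> \<bar>x\<bar>"
    proof -
      have "1 \<le> \<bar>x / K\<bar>" using that assms(2) by simp
      then show ?thesis using one_le_power[of "\<bar>x/K\<bar>" 2] by (simp only: power2_abs)
    qed
    then show "(1 - exp (- 1 / 2)) * indicator {x. K \<le> \<bar>x\<bar>} x \<le> 1 - exp (- (x / K)\<^sup>2 / 2)"
      by (auto split: split_indicator)
  qed
  also have "\<dots> = 1 - (LINT x|\<mu>. exp (- (x / K)\<^sup>2 / 2))"
    using int A.prob_space by (subst Bochner_Integration.integral_diff) auto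
  finally show ?thesis using eq by simp
qed

lemma tail_tendsto_0:
  assumes "real_distribution \<mu>" "0 < e"
  shows "\<exists>K::nat. 0 < K \<and> measure \<mu> {x. real K \<le> \<bar>x\<bar>} < e"
proof -
  interpret A: real_distribution \<mu> by fact
  have "(\<lambda>k. measure \<mu> {x. real k \<le> \<bar>x\<bar>}) \<longlonglongrightarrow> measure \<mu> (\<Inter>k. {x. real k \<le> \<bar>x\<bar>})"
    by (rule A.finite_Lim_measure_decseq) (auto simp: decseq_def)
  also have "(\<Inter>k. {x. real k \<le> \<bar>x\<bar>}) = {}"
  proof (safe, simp)
    fix x :: real assume "\<forall>k. real k \<le> \<bar>x\<bar>"
    then show False using reals_Archimedean2[of "\<bar>x\<bar>"] by (auto simp: not_less[symmetric])
  qed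
  finally have "\<forall>\<^sub>F k in sequentially. measure \<mu> {x. real k \<le> \<bar>x\<bar>} < e"
    using assms(2) by (intro order_tendstoD(2)) auto
  then have "\<forall>\<^sub>F k in sequentially. 0 < k \<and> measure \<mu> {x. real k \<le> \<bar>x\<bar>} < e"
    using eventually_gt_at_top[of 0] by eventually_elim auto
  then show ?thesis by (rule eventually_happens'[rotated]) simp
qed

text \<open>
  By \<open>tail_le_gauss_char\<close> the tail of \<open>\<mu> n\<close> beyond \<open>K\<close> is bounded by a Gaussian average of
  \<open>1 - char (\<mu> n)\<close> at scale \<open>1 / K\<close>. For large \<open>n\<close> it is close to the same average of \<open>1 - \<phi>\<close>, which is small
  for large \<open>K\<close> by continuity at \<open>0\<close>; the finitely many remaining \<open>n\<close> are treated one by one.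
\<close>

lemma tight_if_char_converges:
  assumes \<mu>: "\<And>n. real_distribution (\<mu> n)"
    and lim: "\<And>z. (\<lambda>n. char (\<mu> n) z) \<longlonglongrightarrow> \<phi> z"
    and cont: "isCont \<phi> 0"
  shows "tight \<mu>"
proof -
  interpret N: real_distribution std_normal_distribution by (rule real_dist_normal_dist)
  interpret D: real_distribution "\<mu> n" for n by (rule \<mu>)
  have meas[measurable]: "\<phi> \<in> borel_measurable borel"
    by (rule borel_measurable_LIMSEQ_metric[OF _ lim]) auto
  have bound: "norm (\<phi> z) \<le> 1" for z
    by (rule LIMSEQ_le_const2[OF tendsto_norm[OF lim]]) (auto intro: D.cmod_char_le_1)
  have \<phi>0: "\<phi> 0 = 1"
    using LIMSEQ_unique[OF lim[of 0]] by (simp add: D.char_zero)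
  define G where "G \<kappa> K = 1 - Re (CLINT z|std_normal_distribution. \<kappa> (z / K))" for \<kappa> :: "real \<Rightarrow> complex" and K :: real
  have limK: "(\<lambda>k. G \<phi> (real k)) \<longlonglongrightarrow> 0"
  proof -
    have "(\<lambda>k. CLINT z|std_normal_distribution. \<phi> (z / real k)) \<longlonglongrightarrow> (CLINT z|std_normal_distribution. 1)"
    proof (rule integral_dominated_convergence[where w="\<lambda>_. 1"])
      show "AE z in std_normal_distribution. (\<lambda>k. \<phi> (z / real k)) \<longlonglongrightarrow> 1"
      proof (rule AE_I2)
        fix z
        have "(\<lambda>k. z / real k) \<longlonglongrightarrow> 0" by (rule lim_const_over_n)
        then show "(\<lambda>k. \<phi> (z / real k)) \<longlonglongrightarrow> 1"
          using isCont_tendsto_compose[OF cont] \<phi>0 by auto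
      qed
    qed (auto simp: bound)
    then have "(\<lambda>k. 1 - Re (CLINT z|std_normal_distribution. \<phi> (z / real k))) \<longlonglongrightarrow> 1 - Re (CLINT z|std_normal_distribution. 1)"
      by (intro tendsto_intros)
    then show ?thesis unfolding G_def using N.prob_space by simp
  qed
  have limn: "(\<lambda>n. G (char (\<mu> n)) K) \<longlonglongrightarrow> G \<phi> K" for K
    unfolding G_def
    by (intro tendsto_intros integral_dominated_convergence[where w="\<lambda>_. 1"])
       (auto intro: lim D.cmod_char_le_1)
  show ?thesis
    unfolding tight_def
  proof (intro conjI allI impI \<mu>)
    fix e :: real assume "0 < e"
    define e' where "e' = (1 - exp (- 1 / 2)) * e"
    have a: "0 < 1 - exp (- 1 / 2 :: real)" by simp
    have "0 < e'" using \<open>0 < e\<close> a unfolding e'_def by simp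
    have "\<forall>\<^sub>F k in sequentially. G \<phi> (real k) < e'"
      using limK \<open>0 < e'\<close> by (rule order_tendstoD(2))
    then have "\<forall>\<^sub>F k in sequentially. 0 < k \<and> G \<phi> (real k) < e'"
      using eventually_gt_at_top[of 0] by eventually_elim auto
    then obtain k where k: "0 < k" "G \<phi> (real k) < e'"
      by (metis (mono_tags, lifting) eventually_happens' sequentially_bot)
    have "\<forall>\<^sub>F n in sequentially. G (char (\<mu> n)) (real k) < e'"
      using limn k(2) by (rule order_tendstoD(2))
    then obtain n0 where n0: "\<And>n. n0 \<le> n \<Longrightarrow> G (char (\<mu> n)) (real k) < e'"
      unfolding eventually_sequentially by auto
    have late: "measure (\<mu> n) {x. real k \<le> \<bar>x\<bar>} < e" if "n0 \<le> n" for n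
    proof -
      have "(1 - exp (- 1 / 2)) * measure (\<mu> n) {x. real k \<le> \<bar>x\<bar>} < (1 - exp (- 1 / 2)) * e"
        using tail_le_gauss_char[OF \<mu>, of "real k" n] n0[OF that] k(1)[folded of_nat_0_less_iff[where 'a=real]]
        unfolding G_def e'_def by linarith
      then show ?thesis using a by (simp only: mult_less_cancel_left_pos)
    qed
    obtain K where K: "\<And>n. measure (\<mu> n) {x. real (K n) \<le> \<bar>x\<bar>} < e"
      using tail_tendsto_0[OF \<mu> \<open>0 < e\<close>] by metis
    define L where "L = Max (insert k (K ` {..<n0}))"
    have kL: "k \<le> L" and KL: "\<And>n. n < n0 \<Longrightarrow> K n \<le> L"
      unfolding L_def by auto
    have all: "measure (\<mu> n) {x. real L \<le> \<bar>x\<bar>} < e" for n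
    proof (cases "n0 \<le> n")
      case True
      have "measure (\<mu> n) {x. real L \<le> \<bar>x\<bar>} \<le> measure (\<mu> n) {x. real k \<le> \<bar>x\<bar>}"
        using kL by (intro D.finite_measure_mono) auto
      with late[OF True] show ?thesis by simp
    next
      case False
      then have "K n \<le> L" by (intro KL) simp
      then have "measure (\<mu> n) {x. real L \<le> \<bar>x\<bar>} \<le> measure (\<mu> n) {x. real (K n) \<le> \<bar>x\<bar>}"
        by (intro D.finite_measure_mono) auto
      with K[of n] show ?thesis by simp
    qed
    have "1 - e < measure (\<mu> n) {- real L<..real L}" for n
    proof -
      have "1 - measure (\<mu> n) {x. real L \<le> \<bar>x\<bar>} = measure (\<mu> n) (UNIV - {x. real L \<le> \<bar>x\<bar>})"
        using D.prob_compl[of "{x. real L \<le> \<bar>x\<bar>}"] by simp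
      also have "\<dots> \<le> measure (\<mu> n) {- real L<..real L}"
        by (intro D.finite_measure_mono) auto
      finally show ?thesis using all[of n] by simp
    qed
    moreover have "- real L < real L" using k(1) kL by simp
    ultimately show "\<exists>a b. a < b \<and> (\<forall>n. 1 - e < measure (\<mu> n) {a<..b})" by blast
  qed
qed

text \<open>
  The existence half of Levy's continuity theorem: tightness yields a weakly convergent
  subsequence, and its limit has characteristic function \<open>\<phi>\<close>.
\<close>

lemma char_fun_limit:
  assumes "\<And>n. char_fun (\<psi> n)"
    and lim: "\<And>z. (\<lambda>n. \<psi> n z) \<longlonglongrightarrow> \<phi> z"
    and cont: "isCont \<phi> 0"
  shows "char_fun \<phi>"
proof -
  obtain \<mu> where \<mu>: "\<And>n. real_distribution (\<mu> n)" and ch: "\<And>n. char (\<mu> n) = \<psi> n"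
    using assms(1) unfolding char_fun_def by metis
  have lim': "(\<lambda>n. char (\<mu> n) z) \<longlonglongrightarrow> \<phi> z" for z
    using lim by (simp add: ch)
  have "tight \<mu>" by (rule tight_if_char_converges[OF \<mu> lim' cont])
  from tight_imp_convergent_subsubsequence[OF this, of id]
  obtain r M where r: "strict_mono (r :: nat \<Rightarrow> nat)" and M: "real_distribution M"
    and conv: "weak_conv_m (\<mu> \<circ> r) M"
    by (auto simp: strict_mono_def)
  have "(\<lambda>n. char ((\<mu> \<circ> r) n) z) \<longlonglongrightarrow> char M z" for z
    by (rule levy_continuity1[OF _ M conv]) (simp add: \<mu>)
  moreover have "(\<lambda>n. char ((\<mu> \<circ> r) n) z) \<longlonglongrightarrow> \<phi> z" for z
    using LIMSEQ_subseq_LIMSEQ[OF lim' r] by (simp add: o_def)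
  ultimately have "char M z = \<phi> z" for z
    using LIMSEQ_unique by blast
  then show ?thesis using M by (intro char_funI)
qed

section \<open>Compound Poisson distributions\<close>

primrec conv_power :: "real measure \<Rightarrow> nat \<Rightarrow> real measure" where
  "conv_power \<rho> 0 = return borel 0"
| "conv_power \<rho> (Suc n) = (conv_power \<rho> n \<star> \<rho>)"

lemma real_distribution_return: "real_distribution (return borel (c :: real))"
proof -
  interpret prob_space "return borel c" by (rule prob_space_return) auto
  show ?thesis by unfold_locales auto
qed

lemma char_return: "char (return borel c) z = iexp (z * c)"
  by (simp add: char_def integral_return)

lemma real_distribution_conv_power:
  "real_distribution \<rho> \<Longrightarrow> real_distribution (conv_power \<rho> n)"
  by (induction n) (auto intro: real_distribution_return real_distribution_convolution)

lemma char_conv_power: "real_distribution \<rho> \<Longrightarrow> char (conv_power \<rho> n) z = char \<rho> z ^ n"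
  by (induction n)
     (auto simp: char_return char_convolution real_distribution_conv_power mult.commute)

text \<open>
  Translates of Lebesgue null sets are null sets, so a bound on the mass of null sets passes from one factor to
  the convolution. The bound \<open>\<theta> = 0\<close> expresses absolute continuity.
\<close>

lemma null_mass_convolution:
  assumes \<kappa>: "real_distribution \<kappa>" and \<rho>: "real_distribution \<rho>"
    and le: "\<And>B. B \<in> null_sets lborel \<Longrightarrow> emeasure \<rho> B \<le> \<theta>"
    and B: "B \<in> null_sets lborel"
  shows "emeasure (\<kappa> \<star> \<rho>) B \<le> \<theta>"
proof -
  interpret K: real_distribution \<kappa> by fact
  interpret R: real_distribution \<rho> by fact
  have "emeasure (\<kappa> \<star> \<rho>) B = (\<integral>\<^sup>+x. emeasure \<rho> {a. a + x \<in> B} \<partial>\<kappa>)"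
    using B by (intro convolution_emeasure) (auto intro: K.finite_measure_axioms R.finite_measure_axioms)
  also have "\<dots> \<le> (\<integral>\<^sup>+x. \<theta> \<partial>\<kappa>)"
  proof (intro nn_integral_mono le)
    fix x
    show "{a. a + x \<in> B} \<in> null_sets lborel"
      using null_sets_translation[OF B, of "- x"] by simp
  qed
  also have "\<dots> = \<theta>" by (simp add: K.emeasure_space_1 del: K.space_eq_univ)
  finally show ?thesis .
qed

definition compound_poisson :: "real \<Rightarrow> real measure \<Rightarrow> real measure" where
  "compound_poisson c \<rho> = measure_pmf (poisson_pmf c) \<bind> conv_power \<rho>"

lemma conv_power_measurable:
  assumes "real_distribution \<rho>"
  shows "conv_power \<rho> \<in> measurable (measure_pmf p) (prob_algebra borel)"
proof -
  interpret C: real_distribution "conv_power \<rho> n" for n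
    by (rule real_distribution_conv_power[OF assms])
  have "conv_power \<rho> n \<in> space (prob_algebra borel)" for n
    unfolding space_prob_algebra by (auto intro: C.prob_space_axioms)
  then show ?thesis by simp
qed

lemma real_distribution_compound_poisson:
  assumes "real_distribution \<rho>"
  shows "real_distribution (compound_poisson c \<rho>)"
proof -
  note m = conv_power_measurable[OF assms, of "poisson_pmf c"]
  interpret prob_space "compound_poisson c \<rho>"
    unfolding compound_poisson_def
    by (rule prob_space_bind'[OF _ m]) (auto simp: space_prob_algebra measure_pmf.prob_space_axioms)
  have "sets (compound_poisson c \<rho>) = sets borel"
    unfolding compound_poisson_def
    using m by (intro sets_bind'[where M="measure_pmf (poisson_pmf c)"]) (auto simp: space_prob_algebra measure_pmf.prob_space_axioms)
  then show ?thesis by unfold_locales auto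
qed

lemma Re_char: "real_distribution \<mu> \<Longrightarrow> Re (char \<mu> z) = (LINT x|\<mu>. cos (z * x))"
  and Im_char: "real_distribution \<mu> \<Longrightarrow> Im (char \<mu> z) = (LINT x|\<mu>. sin (z * x))"
proof -
  assume "real_distribution \<mu>"
  then interpret real_distribution \<mu> .
  have int: "complex_integrable \<mu> (\<lambda>x. iexp (z * x))"
    by (rule integrable_const_bound[where B=1]) auto
  show "Re (char \<mu> z) = (LINT x|\<mu>. cos (z * x))" "Im (char \<mu> z) = (LINT x|\<mu>. sin (z * x))"
    unfolding char_def using integral_Re[OF int] integral_Im[OF int]
    by (simp_all add: Re_exp Im_exp)
qed

text \<open>
  Conditioning on the Poisson number \<open>n\<close> of jumps gives the power \<open>char \<rho> z ^ n\<close>, and the Poisson weights sum these powers to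
  an exponential series.
\<close>

lemma char_compound_poisson:
  assumes "0 < c" and \<rho>: "real_distribution \<rho>"
  shows "char (compound_poisson c \<rho>) z = exp (of_real c * (char \<rho> z - 1))"
proof -
  interpret R: real_distribution \<rho> by fact
  interpret C: real_distribution "conv_power \<rho> n" for n
    by (rule real_distribution_conv_power[OF \<rho>])
  note CP = real_distribution_compound_poisson[OF \<rho>, of c]
  note m = measurable_prob_algebraD[OF conv_power_measurable[OF \<rho>, of "poisson_pmf c"]]
  \<comment> \<open>The law of total expectation for a monadic bind concerns real integrands, hence the detour through real and
     imaginary parts.\<close>
  have bind: "integral\<^sup>L (compound_poisson c \<rho>) h
      = (LINT n|measure_pmf (poisson_pmf c). integral\<^sup>L (conv_power \<rho> n) h)"
    if "h \<in> borel_measurable borel" "\<And>x. \<bar>h x\<bar> \<le> 1" for h :: "real \<Rightarrow> real"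
    unfolding compound_poisson_def
    by (rule integral_bind[where B=1 and B'=1 and K=borel, OF that(1) _ m])
       (auto simp: that(2) C.emeasure_space_1[simplified] intro: measure_pmf.finite_measure_axioms)
  let ?\<phi> = "char \<rho> z"
  have le1: "norm (?\<phi> ^ n) \<le> 1" for n
    by (simp add: norm_power power_le_one R.cmod_char_le_1)
  have int: "integrable (measure_pmf (poisson_pmf c)) (\<lambda>n. ?\<phi> ^ n)"
    by (rule measure_pmf.integrable_const_bound[where B=1]) (auto simp: le1)
  have "Re (char (compound_poisson c \<rho>) z) = (LINT n|measure_pmf (poisson_pmf c). Re (?\<phi> ^ n))"
    by (simp add: Re_char[OF CP] bind Re_char[OF C.real_distribution_axioms, symmetric] char_conv_power[OF \<rho>])
  moreover have "Im (char (compound_poisson c \<rho>) z) = (LINT n|measure_pmf (poisson_pmf c). Im (?\<phi> ^ n))"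
    by (simp add: Im_char[OF CP] bind Im_char[OF C.real_distribution_axioms, symmetric] char_conv_power[OF \<rho>])
  ultimately have eq: "char (compound_poisson c \<rho>) z = (CLINT n|measure_pmf (poisson_pmf c). ?\<phi> ^ n)"
    using integral_Re[OF int] integral_Im[OF int] by (simp add: complex_eq_iff)
  have eq2: "(CLINT n|measure_pmf (poisson_pmf c). ?\<phi> ^ n)
      = (CLINT n|count_space UNIV. pmf (poisson_pmf c) n *\<^sub>R ?\<phi> ^ n)"
    by (subst measure_pmf_eq_density, subst integral_density) auto
  have int2: "integrable (count_space UNIV) (\<lambda>n. pmf (poisson_pmf c) n *\<^sub>R ?\<phi> ^ n)"
    using int by (subst (asm) measure_pmf_eq_density, subst (asm) integrable_density) auto
  have "(\<lambda>n. pmf (poisson_pmf c) n *\<^sub>R ?\<phi> ^ n) sums char (compound_poisson c \<rho>) z"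
    using sums_integral_count_space_nat[OF int2] by (simp add: eq eq2)
  moreover have "(\<lambda>n. pmf (poisson_pmf c) n *\<^sub>R ?\<phi> ^ n)
      = (\<lambda>n. exp (- of_real c) * ((of_real c * ?\<phi>) ^ n /\<^sub>R fact n))"
    using \<open>0 < c\<close>
    by (auto simp: scaleR_conv_of_real power_mult_distrib field_simps exp_minus simp flip: exp_of_real)
  moreover have "(\<lambda>n. exp (- of_real c) * ((of_real c * ?\<phi>) ^ n /\<^sub>R fact n)) sums
      (exp (- of_real c) * exp (of_real c * ?\<phi>))"
    by (intro sums_mult exp_converges)
  ultimately have "char (compound_poisson c \<rho>) z = exp (- of_real c) * exp (of_real c * ?\<phi>)"
    using sums_unique2 by metis
  then show ?thesis by (simp add: ring_distribs flip: exp_add)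
qed

text \<open>
  Given at least one jump the distribution has the absolutely continuous factor \<open>\<rho>\<close>, so a null set
  is charged only by the event of no jump, which has probability \<open>exp (- c)\<close>.
\<close>

lemma compound_poisson_null_mass:
  assumes "0 < c" and \<rho>: "real_distribution \<rho>"
    and ac: "absolutely_continuous lborel \<rho>" and B: "B \<in> null_sets lborel"
  shows "emeasure (compound_poisson c \<rho>) B \<le> ennreal (exp (- c))"
proof -
  note C = real_distribution_conv_power[OF \<rho>]
  interpret C: real_distribution "conv_power \<rho> n" for n by (rule C)
  note m = measurable_prob_algebraD[OF conv_power_measurable[OF \<rho>, of "poisson_pmf c"]]
  have pos: "emeasure (conv_power \<rho> n) B \<le> indicator {0} n" for n
  proof (cases n)
    case 0
    then show ?thesis using C.emeasure_le_1[of 0 B] by (auto simp del: conv_power.simps)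
  next
    case (Suc k)
    have "emeasure (conv_power \<rho> k \<star> \<rho>) B \<le> 0"
      using ac by (intro null_mass_convolution[OF C \<rho> _ B]) (auto simp: absolutely_continuous_def)
    with Suc show ?thesis by simp
  qed
  have "emeasure (compound_poisson c \<rho>) B
      = (\<integral>\<^sup>+n. emeasure (conv_power \<rho> n) B \<partial>measure_pmf (poisson_pmf c))"
    unfolding compound_poisson_def using B by (intro emeasure_bind[OF _ m]) auto
  also have "\<dots> \<le> (\<integral>\<^sup>+n. indicator {0} n \<partial>measure_pmf (poisson_pmf c))"
    by (intro nn_integral_mono pos)
  also have "\<dots> = ennreal (exp (- c))"
    using \<open>0 < c\<close> by (simp add: emeasure_pmf_single)
  finally show ?thesis .
qed

text \<open>
  Up to normalisation of \<open>\<rho>\<close> this is the compound Poisson characteristic function; a measure of total mass \<open>0\<close> cannot be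
  normalised and gives the constant \<open>1\<close>.
\<close>

lemma char_fun_exp_finite_measure:
  assumes "finite_measure \<rho>" and sets[simp, measurable_cong]: "sets \<rho> = sets borel" and "0 \<le> t"
  shows "char_fun (\<lambda>z. exp (of_real t * (CLINT x|\<rho>. iexp (z * x) - 1)))"
proof -
  interpret F: finite_measure \<rho> by fact
  have [simp]: "space \<rho> = UNIV" using sets_eq_imp_space_eq[OF sets] by simp
  define m where "m = measure \<rho> UNIV"
  show ?thesis
  proof (cases "m = 0 \<or> t = 0")
    case True
    have "of_real t * (CLINT x|\<rho>. iexp (z * x) - 1) = 0" for z
    proof (cases "t = 0")
      case False
      with True have "emeasure \<rho> (space \<rho>) = 0"
        by (simp add: m_def F.emeasure_eq_measure)
      then have "(CLINT x|\<rho>. iexp (z * x) - 1) = (CLINT x|\<rho>. 0)"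
        by (intro integral_cong_AE) (auto simp: AE_iff_null null_sets_def intro: emeasure_eq_0)
      then show ?thesis by simp
    qed auto
    then show ?thesis using char_fun_one by (simp only: exp_zero)
  next
    case False
    then have m: "0 < m" and t: "0 < t" using \<open>0 \<le> t\<close> by (auto simp: m_def less_le)
    define \<rho>' where "\<rho>' = density \<rho> (\<lambda>_. ennreal (1 / m))"
    have "emeasure \<rho>' UNIV = 1"
      unfolding \<rho>'_def using m
      by (simp add: emeasure_density F.emeasure_eq_measure m_def[symmetric] ennreal_mult'[symmetric])
    then interpret R: prob_space \<rho>'
      by (intro prob_spaceI) (simp add: \<rho>'_def)
    have R: "real_distribution \<rho>'"
      by unfold_locales (simp add: \<rho>'_def)
    have int: "integrable \<rho> (\<lambda>x. iexp (z * x))" for z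
      by (rule F.integrable_const_bound[where B=1]) auto
    have "of_real t * (CLINT x|\<rho>. iexp (z * x) - 1) = of_real (t * m) * (char \<rho>' z - 1)" for z
    proof -
      have "char \<rho>' z = (CLINT x|\<rho>. (1 / m) *\<^sub>R iexp (z * x))"
        unfolding char_def \<rho>'_def by (rule integral_density) (use m in auto)
      then have "char \<rho>' z = of_real (1 / m) * (CLINT x|\<rho>. iexp (z * x))"
        by (simp add: scaleR_conv_of_real)
      moreover have "(CLINT x|\<rho>. iexp (z * x) - 1) = (CLINT x|\<rho>. iexp (z * x)) - of_real m"
        using int by (subst Bochner_Integration.integral_diff) (auto simp: m_def scaleR_conv_of_real)
      ultimately have "of_real m * (char \<rho>' z - 1) = (CLINT x|\<rho>. iexp (z * x) - 1)"
        using m by (simp add: right_diff_distrib)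
      then show ?thesis by (simp only: of_real_mult mult.assoc)
    qed
    then show ?thesis
      using char_compound_poisson[OF mult_pos_pos[OF t m] R]
      by (intro char_funI[OF real_distribution_compound_poisson[OF R, of "t * m"]]) metis
  qed
qed

section \<open>Levy exponents\<close>

definition levy_kernel :: "real \<Rightarrow> real \<Rightarrow> complex" where
  "levy_kernel z x = iexp (z * x) - 1 - \<i> * of_real (z * x * indicator {-1..1} x)"

lemma levy_exponent_kernel:
  "levy_exponent \<sigma>2 \<nu> \<gamma> z =
     \<i> * of_real (\<gamma> * z) - of_real (\<sigma>2 * z\<^sup>2 / 2) + (CLINT x|\<nu>. levy_kernel z x)"
  by (simp add: levy_exponent_def levy_kernel_def)

lemma levy_kernel_measurable[measurable]: "levy_kernel z \<in> borel_measurable borel"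
  unfolding levy_kernel_def by measurable

text \<open>
  The truncation function removes the linear term for \<open>\<bar>x\<bar> \<le> 1\<close>, which leaves a quadratic remainder.
\<close>

lemma levy_kernel_bound: "norm (levy_kernel z x) \<le> (z\<^sup>2 / 2 + 2) * min 1 (x\<^sup>2)"
proof (cases "x \<in> {-1..1}")
  case True
  then have "x\<^sup>2 \<le> 1" by (simp add: abs_square_le_1 abs_le_iff)
  then have min: "min 1 (x\<^sup>2) = x\<^sup>2" by simp
  have "norm (levy_kernel z x) \<le> \<bar>z * x\<bar>\<^sup>2 / 2"
    using iexp_approx1[of "z * x" 1] True
    by (simp add: levy_kernel_def numeral_2_eq_2 diff_diff_eq algebra_simps)
  also have "\<dots> = (z\<^sup>2 / 2) * x\<^sup>2"
    by (simp add: power_mult_distrib)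
  also have "\<dots> \<le> (z\<^sup>2 / 2 + 2) * x\<^sup>2"
    by (intro mult_right_mono) auto
  finally show ?thesis by (simp add: min)
next
  case False
  then have "1 \<le> \<bar>x\<bar>" by auto
  then have min: "min 1 (x\<^sup>2) = 1"
    using one_le_power[of "\<bar>x\<bar>" 2] by (simp add: min_def)
  have "norm (levy_kernel z x) \<le> norm (iexp (z * x)) + norm (1 :: complex)"
    using False norm_triangle_ineq4[of "iexp (z * x)" 1] by (simp add: levy_kernel_def)
  also have "\<dots> \<le> (z\<^sup>2 / 2 + 2) * 1" by simp
  finally show ?thesis by (simp only: min)
qed

lemma levy_measure_sets: "levy_measure \<nu> \<Longrightarrow> sets \<nu> = sets borel"
  by (simp add: levy_measure_def)

lemma integrable_min_levy_measure:
  assumes \<nu>: "levy_measure \<nu>" shows "integrable \<nu> (\<lambda>x. min 1 (x\<^sup>2))"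
proof -
  note [measurable_cong] = levy_measure_sets[OF \<nu>]
  show ?thesis
    using \<nu> unfolding levy_measure_def integrable_iff_bounded by (simp add: abs_of_nonneg)
qed

lemma integrable_levy_kernel:
  assumes "levy_measure \<nu>" shows "integrable \<nu> (levy_kernel z)"
proof (rule Bochner_Integration.integrable_bound)
  show "integrable \<nu> (\<lambda>x. (z\<^sup>2 / 2 + 2) * min 1 (x\<^sup>2))"
    by (intro integrable_mult_right integrable_min_levy_measure assms)
  show "levy_kernel z \<in> borel_measurable \<nu>"
    using levy_measure_sets[OF assms, measurable_cong] by measurable
  show "AE x in \<nu>. norm (levy_kernel z x) \<le> norm ((z\<^sup>2 / 2 + 2) * min 1 (x\<^sup>2))"
  proof (rule AE_I2)
    fix x
    have "0 \<le> (z\<^sup>2 / 2 + 2) * min 1 (x\<^sup>2)" by (intro mult_nonneg_nonneg) auto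
    with levy_kernel_bound[of z x] show "norm (levy_kernel z x) \<le> norm ((z\<^sup>2 / 2 + 2) * min 1 (x\<^sup>2))"
      by simp
  qed
qed

lemma isCont_levy_exponent:
  assumes \<nu>: "levy_measure \<nu>" shows "isCont (levy_exponent \<sigma>2 \<nu> \<gamma>) z"
proof -
  have "isCont (\<lambda>z. CLINT x|\<nu>. levy_kernel z x) z"
    unfolding continuous_at_sequentially
  proof safe
    fix Z assume Z: "Z \<longlonglongrightarrow> z"
    have "Bseq Z" by (rule convergent_imp_Bseq[OF convergentI[OF Z]])
    then obtain K where K: "0 < K" "\<And>n. norm (Z n) \<le> K"
      unfolding Bseq_def by blast
    have mz: "levy_kernel z \<in> borel_measurable \<nu>" for z
      using levy_measure_sets[OF \<nu>, measurable_cong] by measurable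
    have "(\<lambda>n. CLINT x|\<nu>. levy_kernel (Z n) x) \<longlonglongrightarrow> (CLINT x|\<nu>. levy_kernel z x)"
    proof (rule integral_dominated_convergence[where w="\<lambda>x. (K\<^sup>2 / 2 + 2) * min 1 (x\<^sup>2)"])
      show "integrable \<nu> (\<lambda>x. (K\<^sup>2 / 2 + 2) * min 1 (x\<^sup>2))"
        by (intro integrable_mult_right integrable_min_levy_measure \<nu>)
      show "AE x in \<nu>. (\<lambda>n. levy_kernel (Z n) x) \<longlonglongrightarrow> levy_kernel z x"
        unfolding levy_kernel_def by (intro AE_I2 tendsto_intros Z)
      show "AE x in \<nu>. norm (levy_kernel (Z n) x) \<le> (K\<^sup>2 / 2 + 2) * min 1 (x\<^sup>2)" for n
      proof (rule AE_I2)
        fix x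
        have "(Z n)\<^sup>2 \<le> K\<^sup>2" using K(1) K(2)[of n] by (intro power2_le_iff_abs_le[THEN iffD2]) auto
        then have "((Z n)\<^sup>2 / 2 + 2) * min 1 (x\<^sup>2) \<le> (K\<^sup>2 / 2 + 2) * min 1 (x\<^sup>2)"
          by (intro mult_right_mono) auto
        with levy_kernel_bound[of "Z n" x]
        show "norm (levy_kernel (Z n) x) \<le> (K\<^sup>2 / 2 + 2) * min 1 (x\<^sup>2)" by linarith
      qed
    qed (rule mz)+
    then show "((\<lambda>z. CLINT x|\<nu>. levy_kernel z x) \<circ> Z) \<longlonglongrightarrow> (CLINT x|\<nu>. levy_kernel z x)"
      by (simp add: o_def)
  qed
  then show ?thesis
    unfolding levy_exponent_kernel by (intro continuous_intros) simp_all
qed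

lemma Re_levy_exponent:
  assumes \<nu>: "levy_measure \<nu>"
  shows "integrable \<nu> (\<lambda>x. 1 - cos (z * x))"
    and "- Re (levy_exponent \<sigma>2 \<nu> \<gamma> z) = \<sigma>2 * z\<^sup>2 / 2 + (LINT x|\<nu>. 1 - cos (z * x))"
proof -
  have eq: "Re (levy_kernel z x) = - (1 - cos (z * x))" for x
    by (simp add: levy_kernel_def Re_exp)
  note int = integrable_levy_kernel[OF \<nu>, of z]
  have "integrable \<nu> (\<lambda>x. - Re (levy_kernel z x))" using int by simp
  then show "integrable \<nu> (\<lambda>x. 1 - cos (z * x))" unfolding eq by simp
  show "- Re (levy_exponent \<sigma>2 \<nu> \<gamma> z) = \<sigma>2 * z\<^sup>2 / 2 + (LINT x|\<nu>. 1 - cos (z * x))"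
  proof -
    have "(LINT x|\<nu>. 1 - cos (z * x)) = - (LINT x|\<nu>. - (1 - cos (z * x)))"
      by (simp only: integral_minus minus_minus)
    also have "\<dots> = - Re (CLINT x|\<nu>. levy_kernel z x)"
      using integral_Re[OF int] unfolding eq by simp
    finally show ?thesis unfolding levy_exponent_kernel by simp
  qed
qed

abbreviation restrict_measure :: "real measure \<Rightarrow> real set \<Rightarrow> real measure" where
  "restrict_measure \<nu> S \<equiv> density \<nu> (\<lambda>x. ennreal (indicator S x))"

lemma integral_restrict_measure:
  fixes h :: "real \<Rightarrow> 'b :: {banach, second_countable_topology}"
  assumes "sets \<nu> = sets borel" "S \<in> sets borel" "h \<in> borel_measurable borel"
  shows "integral\<^sup>L (restrict_measure \<nu> S) h = (LINT x:S|\<nu>. h x)"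
    and "integrable (restrict_measure \<nu> S) h \<longleftrightarrow> set_integrable \<nu> S h"
  unfolding set_lebesgue_integral_def set_integrable_def
proof -
  have [simp]: "borel_measurable \<nu> = borel_measurable borel"
    by (rule measurable_cong_sets[OF assms(1) refl])
  show "integral\<^sup>L (restrict_measure \<nu> S) h = (LINT x|\<nu>. indicator S x *\<^sub>R h x)"
    using assms by (intro integral_density) auto
  show "integrable (restrict_measure \<nu> S) h \<longleftrightarrow> integrable \<nu> (\<lambda>x. indicator S x *\<^sub>R h x)"
    using assms by (intro integrable_density) auto
qed

lemma emeasure_restrict_measure:
  assumes sets: "sets \<nu> = sets borel" and [measurable]: "S \<in> sets borel" "A \<in> sets borel"
  shows "emeasure (restrict_measure \<nu> S) A = emeasure \<nu> (S \<inter> A)"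
proof -
  note [measurable_cong] = sets
  have "emeasure (restrict_measure \<nu> S) A = (\<integral>\<^sup>+x. ennreal (indicator S x) * indicator A x \<partial>\<nu>)"
    using sets by (intro emeasure_density) auto
  also have "\<dots> = (\<integral>\<^sup>+x. indicator (S \<inter> A) x \<partial>\<nu>)"
    by (intro nn_integral_cong) (auto split: split_indicator)
  finally show ?thesis using sets by simp
qed

lemma levy_measure_restrict:
  assumes \<nu>: "levy_measure \<nu>" and S[measurable]: "S \<in> sets borel"
  shows "levy_measure (restrict_measure \<nu> S)"
proof -
  have sets: "sets \<nu> = sets borel" by (rule levy_measure_sets[OF \<nu>])
  have "emeasure \<nu> (S \<inter> {0}) \<le> emeasure \<nu> {0}"
    using S sets by (intro emeasure_mono) auto
  then have "emeasure (restrict_measure \<nu> S) {0} = 0"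
    using \<nu> emeasure_restrict_measure[OF sets S] by (simp add: levy_measure_def)
  moreover have "(\<integral>\<^sup>+x. ennreal (min 1 (x\<^sup>2)) \<partial>restrict_measure \<nu> S)
      = (\<integral>\<^sup>+x. ennreal (indicator S x) * ennreal (min 1 (x\<^sup>2)) \<partial>\<nu>)"
    using sets[measurable_cong] by (intro nn_integral_density) measurable
  moreover have "\<dots> \<le> (\<integral>\<^sup>+x. ennreal (min 1 (x\<^sup>2)) \<partial>\<nu>)"
    by (intro nn_integral_mono) (auto split: split_indicator)
  ultimately show ?thesis
    using \<nu> by (auto simp: levy_measure_def)
qed

lemma finite_levy_measure_away_from_0:
  assumes \<nu>: "levy_measure \<nu>" and S: "S \<in> sets borel" and d: "0 < d" "\<And>x. x \<in> S \<Longrightarrow> d \<le> \<bar>x\<bar>"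
  shows "emeasure \<nu> S < \<infinity>" and "finite_measure (restrict_measure \<nu> S)"
proof -
  have sets: "sets \<nu> = sets borel" by (rule levy_measure_sets[OF \<nu>])
  define c where "c = min 1 (d\<^sup>2)"
  have c: "0 < c" using d(1) by (simp add: c_def)
  have "ennreal c * emeasure \<nu> S = (\<integral>\<^sup>+x. ennreal c * indicator S x \<partial>\<nu>)"
    using S sets by (simp add: nn_integral_cmult_indicator)
  also have "\<dots> \<le> (\<integral>\<^sup>+x. ennreal (min 1 (x\<^sup>2)) \<partial>\<nu>)"
  proof (intro nn_integral_mono)
    fix x
    have "d\<^sup>2 \<le> x\<^sup>2" if "x \<in> S"
      using power_mono[OF d(2)[OF that], of 2] d(1) by simp
    then show "ennreal c * indicator S x \<le> ennreal (min 1 (x\<^sup>2))"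
      unfolding c_def by (auto split: split_indicator simp: min_def intro!: ennreal_leI)
  qed
  also have "\<dots> < \<infinity>" using \<nu> by (simp add: levy_measure_def)
  finally show fin: "emeasure \<nu> S < \<infinity>"
    using c by (auto simp: ennreal_mult_less_top less_top[symmetric] ennreal_mult_eq_top_iff)
  have "emeasure (restrict_measure \<nu> S) UNIV = emeasure \<nu> S"
    using emeasure_restrict_measure[OF sets S, of UNIV] by simp
  moreover have "space \<nu> = UNIV" using sets_eq_imp_space_eq[OF sets] by simp
  ultimately show "finite_measure (restrict_measure \<nu> S)"
    using fin by (intro finite_measureI) auto
qed

text \<open>
  Splits off the jumps with size in \<open>S\<close>. Because these have finite total intensity they need no compensation, and
  their compensator is absorbed in the drift \<open>\<gamma>'\<close>.
\<close>

lemma levy_exponent_split: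
  assumes \<nu>: "levy_measure \<nu>" and S: "S \<in> sets borel" and fin: "finite_measure (restrict_measure \<nu> S)"
  obtains \<gamma>' where "\<And>z. levy_exponent \<sigma>2 \<nu> \<gamma> z
      = (CLINT x|restrict_measure \<nu> S. iexp (z * x) - 1) + levy_exponent \<sigma>2 (restrict_measure \<nu> (- S)) \<gamma>' z"
proof -
  have sets[measurable_cong]: "sets \<nu> = sets borel" by (rule levy_measure_sets[OF \<nu>])
  have S': "- S \<in> sets borel" using S by auto
  interpret F: finite_measure "restrict_measure \<nu> S" by (rule fin)
  let ?\<rho> = "restrict_measure \<nu> S"
  define m where "m = (LINT x|?\<rho>. x * indicator {-1..1} x)"
  have [measurable_cong]: "sets ?\<rho> = sets borel" using sets by simp
  have im: "integrable ?\<rho> (\<lambda>x. x * indicator {-1..1} x)"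
    by (rule F.integrable_const_bound[where B=1]) (auto split: split_indicator)
  have ie: "integrable ?\<rho> (\<lambda>x. iexp (z * x) - 1)" for z
  proof (rule Bochner_Integration.integrable_diff)
    show "integrable ?\<rho> (\<lambda>x. iexp (z * x))"
      by (rule F.integrable_const_bound[where B=1]) auto
  qed simp
  have split: "(CLINT x|\<nu>. levy_kernel z x) = (CLINT x|?\<rho>. iexp (z * x) - 1) - \<i> * of_real (z * m)
      + (CLINT x|restrict_measure \<nu> (- S). levy_kernel z x)" for z
  proof -
    have "set_integrable \<nu> A (levy_kernel z)" if "A \<in> sets borel" for A
      unfolding set_integrable_def using integrable_levy_kernel[OF \<nu>] that sets
      by (intro integrable_mult_indicator) auto
    then have "(LINT x:(S \<union> - S)|\<nu>. levy_kernel z x) = (LINT x:S|\<nu>. levy_kernel z x) + (LINT x:- S|\<nu>. levy_kernel z x)"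
      using S S' by (intro set_integral_Un) auto
    then have "(CLINT x|\<nu>. levy_kernel z x) = (CLINT x|?\<rho>. levy_kernel z x) + (CLINT x|restrict_measure \<nu> (- S). levy_kernel z x)"
      using S S' sets by (simp add: integral_restrict_measure set_lebesgue_integral_def)
    moreover have "(CLINT x|?\<rho>. levy_kernel z x)
        = (CLINT x|?\<rho>. (iexp (z * x) - 1) - \<i> * of_real z * of_real (x * indicator {-1..1} x))"
      by (simp add: levy_kernel_def mult.assoc)
    moreover have "\<dots> = (CLINT x|?\<rho>. iexp (z * x) - 1) - \<i> * of_real z * of_real m"
      unfolding m_def using im ie
      by (subst Bochner_Integration.integral_diff) (auto simp del: of_real_mult intro!: integrable_of_real)
    ultimately show ?thesis by simp
  qed
  show ?thesis
    by (rule that[of "\<gamma> - m"]) (simp add: levy_exponent_kernel split algebra_simps)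
qed

lemma char_fun_finite_levy_exponent:
  assumes \<nu>: "levy_measure \<nu>" and fin: "finite_measure \<nu>" and \<sigma>2: "0 \<le> \<sigma>2" and t: "0 \<le> t"
  shows "char_fun (\<lambda>z. exp (of_real t * levy_exponent \<sigma>2 \<nu> \<gamma> z))"
proof -
  have sets: "sets \<nu> = sets borel" by (rule levy_measure_sets[OF \<nu>])
  have UNIV: "restrict_measure \<nu> UNIV = \<nu>" by (simp add: density_1)
  obtain \<gamma>' where \<gamma>': "\<And>z. levy_exponent \<sigma>2 \<nu> \<gamma> z
      = (CLINT x|\<nu>. iexp (z * x) - 1) + levy_exponent \<sigma>2 (restrict_measure \<nu> {}) \<gamma>' z"
    using levy_exponent_split[OF \<nu>, of UNIV] fin UNIV by auto
  have "(CLINT x|restrict_measure \<nu> {}. levy_kernel z x) = 0" for z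
    using sets by (subst integral_restrict_measure) (auto simp: set_lebesgue_integral_def)
  then have eq: "levy_exponent \<sigma>2 \<nu> \<gamma> z
      = (CLINT x|\<nu>. iexp (z * x) - 1) + \<i> * of_real (\<gamma>' * z) - of_real (\<sigma>2 * z\<^sup>2 / 2)" for z
    by (subst \<gamma>') (simp add: levy_exponent_kernel)
  have "char_fun (\<lambda>z. exp (of_real t * (CLINT x|\<nu>. iexp (z * x) - 1)) * iexp (t * \<gamma>' * z)
      * exp (of_real (- (t * \<sigma>2) * z\<^sup>2 / 2)))"
    using t \<sigma>2 by (intro char_fun_mult char_fun_exp_finite_measure fin sets char_fun_shift char_fun_gauss) auto
  then show ?thesis
    unfolding eq by (simp add: algebra_simps flip: exp_add)
qed

text \<open>
  The existence half of the Levy-Khintchine formula. For a finite Levy measure the distribution is a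
  translated convolution of a normal and a compound Poisson distribution; in general one discards the jumps of
  size below \<open>1 / Suc k\<close> and lets \<open>k\<close> tend to infinity.
\<close>

lemma char_fun_levy_exponent:
  assumes \<nu>: "levy_measure \<nu>" and \<sigma>2: "0 \<le> \<sigma>2" and t: "0 \<le> t"
  shows "char_fun (\<lambda>z. exp (of_real t * levy_exponent \<sigma>2 \<nu> \<gamma> z))"
proof -
  have sets[measurable_cong]: "sets \<nu> = sets borel" by (rule levy_measure_sets[OF \<nu>])
  define S where "S k = {x :: real. 1 / Suc k \<le> \<bar>x\<bar>}" for k :: nat
  have S[measurable]: "S k \<in> sets borel" for k unfolding S_def by measurable
  show ?thesis
  proof (rule char_fun_limit)
    fix k :: nat
    let ?\<rho> = "restrict_measure \<nu> (S k)"
    have fin: "finite_measure ?\<rho>"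
      by (rule finite_levy_measure_away_from_0(2)[OF \<nu> S, of "1 / Suc k"]) (auto simp: S_def)
    show "char_fun (\<lambda>z. exp (of_real t * levy_exponent \<sigma>2 ?\<rho> \<gamma> z))"
      by (rule char_fun_finite_levy_exponent[OF levy_measure_restrict[OF \<nu> S] fin \<sigma>2 t])
  next
    fix z
    have "(\<lambda>k. CLINT x|restrict_measure \<nu> (S k). levy_kernel z x) \<longlonglongrightarrow> (CLINT x|\<nu>. levy_kernel z x)"
    proof -
      have "(\<lambda>k. CLINT x|\<nu>. indicator (S k) x *\<^sub>R levy_kernel z x) \<longlonglongrightarrow> (CLINT x|\<nu>. levy_kernel z x)"
      proof (rule integral_dominated_convergence[where w="\<lambda>x. norm (levy_kernel z x)"])
        show "AE x in \<nu>. (\<lambda>k. indicator (S k) x *\<^sub>R levy_kernel z x) \<longlonglongrightarrow> levy_kernel z x"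
        proof (rule AE_I2)
          fix x
          show "(\<lambda>k. indicator (S k) x *\<^sub>R levy_kernel z x) \<longlonglongrightarrow> levy_kernel z x"
          proof (cases "x = 0")
            case True
            then show ?thesis by (simp add: levy_kernel_def)
          next
            case False
            then have "\<forall>\<^sub>F k in sequentially. x \<in> S k"
              using order_tendstoD(2)[OF LIMSEQ_Suc[OF lim_inverse_n'], of "\<bar>x\<bar>"]
              by (auto simp: S_def elim!: eventually_mono)
            then show ?thesis
              by (intro tendsto_eventually) (auto elim!: eventually_mono)
          qed
        qed
        show "integrable \<nu> (\<lambda>x. norm (levy_kernel z x))"
          using integrable_levy_kernel[OF \<nu>] by (rule integrable_norm)
        show "levy_kernel z \<in> borel_measurable \<nu>" "(\<lambda>x. indicator (S k) x *\<^sub>R levy_kernel z x) \<in> borel_measurable \<nu>" for k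
          by measurable
      qed (auto split: split_indicator)
      then show ?thesis using sets S by (simp add: integral_restrict_measure set_lebesgue_integral_def)
    qed
    then show "(\<lambda>k. exp (of_real t * levy_exponent \<sigma>2 (restrict_measure \<nu> (S k)) \<gamma> z))
        \<longlonglongrightarrow> exp (of_real t * levy_exponent \<sigma>2 \<nu> \<gamma> z)"
      unfolding levy_exponent_kernel by (intro tendsto_intros)
  next
    show "isCont (\<lambda>z. exp (of_real t * levy_exponent \<sigma>2 \<nu> \<gamma> z)) 0"
      by (intro continuous_intros isCont_levy_exponent \<nu>)
  qed
qed

section \<open>Integrals of an exponent along an integrand\<close>

text \<open>
  Turns the exponential of the integral into a finite product of exponentials, one for each level set of \<open>h\<close>.
\<close>

lemma set_integral_finite_range:
  fixes G :: "real \<Rightarrow> complex"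
  assumes V: "finite V" "\<And>s. s \<in> A \<Longrightarrow> h s \<in> V"
    and meas: "\<And>y. y \<in> V \<Longrightarrow> A \<inter> {s. h s = y} \<in> sets borel"
    and fin: "\<And>y. y \<in> V \<Longrightarrow> emeasure lborel (A \<inter> {s. h s = y}) < \<infinity>"
  shows "(CLINT s:A|lborel. G (h s)) = (\<Sum>y\<in>V. of_real (measure lborel (A \<inter> {s. h s = y})) * G y)"
proof -
  have "(CLINT s:A|lborel. G (h s)) = (CLINT s|lborel. \<Sum>y\<in>V. indicator (A \<inter> {s. h s = y}) s *\<^sub>R G y)"
    unfolding set_lebesgue_integral_def
  proof (intro Bochner_Integration.integral_cong refl)
    fix s
    have "(\<Sum>y\<in>V. indicator (A \<inter> {s. h s = y}) s *\<^sub>R G y) = (\<Sum>y\<in>V. if h s = y then indicator A s *\<^sub>R G y else 0)"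
      by (intro sum.cong) (auto split: split_indicator)
    also have "\<dots> = indicator A s *\<^sub>R G (h s)"
      using V by (auto split: split_indicator)
    finally show "indicator A s *\<^sub>R G (h s) = (\<Sum>y\<in>V. indicator (A \<inter> {s. h s = y}) s *\<^sub>R G y)" by simp
  qed
  also have "\<dots> = (\<Sum>y\<in>V. CLINT s|lborel. indicator (A \<inter> {s. h s = y}) s *\<^sub>R G y)"
    using meas fin by (intro Bochner_Integration.integral_sum) auto
  also have "\<dots> = (\<Sum>y\<in>V. of_real (measure lborel (A \<inter> {s. h s = y})) * G y)"
    using meas fin by (intro sum.cong) (auto simp: scaleR_conv_of_real)
  finally show ?thesis .
qed

lemma bounded_on_compact_interval:
  fixes \<Psi> :: "real \<Rightarrow> complex"
  assumes "\<And>z. isCont \<Psi> z"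
  obtains B where "0 \<le> B" "\<And>u. \<bar>u\<bar> \<le> K \<Longrightarrow> norm (\<Psi> u) \<le> B"
proof -
  have "compact (\<Psi> ` {-K..K})"
    using assms by (intro compact_continuous_image continuous_at_imp_continuous_on) auto
  then obtain B where B: "\<And>u. u \<in> {-K..K} \<Longrightarrow> norm (\<Psi> u) \<le> B"
    using compact_imp_bounded bounded_iff by (metis imageI)
  show ?thesis
    by (rule that[of "max 0 B"]) (auto intro!: max.coboundedI2 B)
qed

lemma isCont_measurable: "(\<And>z. isCont \<Psi> z) \<Longrightarrow> \<Psi> \<in> borel_measurable borel" for \<Psi> :: "real \<Rightarrow> complex"
  by (intro borel_measurable_continuous_onI continuous_at_imp_continuous_on) auto

text \<open>
  Dominated convergence: a continuous \<open>\<Psi>\<close> is bounded on the compact interval that contains all values of the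
  \<open>g n\<close>.
\<close>

lemma exponent_integral_tendsto:
  fixes \<Psi> :: "real \<Rightarrow> complex"
  assumes cont: "\<And>z. isCont \<Psi> z"
    and E: "E \<in> sets borel" "emeasure lborel E < \<infinity>"
    and g: "\<And>n. g n \<in> borel_measurable borel" and h: "h \<in> borel_measurable borel"
    and bound: "\<And>n s. s \<in> E \<Longrightarrow> \<bar>g n s\<bar> \<le> K"
    and lim: "AE s in lborel. s \<in> E \<longrightarrow> (\<lambda>n. g n s) \<longlonglongrightarrow> h s"
  shows "(\<lambda>n. CLINT s:E|lborel. \<Psi> (g n s)) \<longlonglongrightarrow> (CLINT s:E|lborel. \<Psi> (h s))"
proof -
  obtain B where B: "0 \<le> B" "\<And>u. \<bar>u\<bar> \<le> K \<Longrightarrow> norm (\<Psi> u) \<le> B"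
    using bounded_on_compact_interval[OF cont, of K] by blast
  note [measurable] = g h E(1) isCont_measurable[OF cont]
  show ?thesis
    unfolding set_lebesgue_integral_def
  proof (rule integral_dominated_convergence[where w="\<lambda>s. indicator E s * B"])
    show "integrable lborel (\<lambda>s. indicator E s * B)"
      using E by simp
    show "AE s in lborel. (\<lambda>n. indicator E s *\<^sub>R \<Psi> (g n s)) \<longlonglongrightarrow> indicator E s *\<^sub>R \<Psi> (h s)"
      using lim by eventually_elim (auto split: split_indicator intro: isCont_tendsto_compose[OF cont])
    show "AE s in lborel. norm (indicator E s *\<^sub>R \<Psi> (g n s)) \<le> indicator E s * B" for n
      using B bound by (intro AE_I2) (auto split: split_indicator)
  qed measurable
qed

lemma isCont_exponent_integral:
  fixes \<Psi> :: "real \<Rightarrow> complex"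
  assumes cont: "\<And>z. isCont \<Psi> z"
    and E: "E \<in> sets borel" "emeasure lborel E < \<infinity>"
    and f[measurable]: "f \<in> borel_measurable borel" and m: "\<And>s. s \<in> E \<Longrightarrow> \<bar>f s\<bar> \<le> m"
  shows "isCont (\<lambda>z. CLINT s:E|lborel. \<Psi> (z * f s)) z"
  unfolding continuous_at_sequentially
proof safe
  fix Z assume Z: "Z \<longlonglongrightarrow> z"
  have "Bseq Z" by (rule convergent_imp_Bseq[OF convergentI[OF Z]])
  then obtain K where K: "0 < K" "\<And>n. norm (Z n) \<le> K"
    unfolding Bseq_def by blast
  have "(\<lambda>n. CLINT s:E|lborel. \<Psi> (Z n * f s)) \<longlonglongrightarrow> (CLINT s:E|lborel. \<Psi> (z * f s))"
  proof (rule exponent_integral_tendsto[OF cont E, where K="K * m"])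
    show "\<bar>Z n * f s\<bar> \<le> K * m" if "s \<in> E" for n s
      unfolding abs_mult using K(2)[of n] m[OF that] K(1) by (intro mult_mono) auto
    show "AE s in lborel. s \<in> E \<longrightarrow> (\<lambda>n. Z n * f s) \<longlonglongrightarrow> z * f s"
      by (intro AE_I2 impI tendsto_intros Z)
  qed measurable
  then show "((\<lambda>z. CLINT s:E|lborel. \<Psi> (z * f s)) \<circ> Z) \<longlonglongrightarrow> (CLINT s:E|lborel. \<Psi> (z * f s))"
    by (simp add: o_def)
qed

text \<open>
  For a step function \<open>h\<close> in place of \<open>f\<close> the exponential is a finite product of functions
  \<open>exp (t * \<Psi> (z * y))\<close>, each of which is a rescaled characteristic function. A bounded \<open>f\<close> is a uniform limit of the step functions obtained by
  rounding down to multiples of \<open>1 / Suc n\<close>.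
\<close>

lemma char_fun_exponent_integral:
  fixes \<Psi> :: "real \<Rightarrow> complex"
  assumes char: "\<And>t. 0 \<le> t \<Longrightarrow> char_fun (\<lambda>z. exp (of_real t * \<Psi> z))"
    and cont: "\<And>z. isCont \<Psi> z"
    and E: "E \<in> sets borel" "emeasure lborel E < \<infinity>"
    and f[measurable]: "f \<in> borel_measurable borel" and m: "\<And>s. s \<in> E \<Longrightarrow> \<bar>f s\<bar> \<le> m"
  shows "char_fun (\<lambda>z. exp (CLINT s:E|lborel. \<Psi> (z * f s)))"
proof (rule char_fun_limit)
  define h where "h n s = of_int \<lfloor>f s * Suc n\<rfloor> / real (Suc n)" for n s
  have [measurable]: "h n \<in> borel_measurable borel" for n unfolding h_def by measurable
  have h: "\<bar>h n s - f s\<bar> \<le> 1 / Suc n" for n s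
  proof -
    have "\<bar>of_int \<lfloor>f s * Suc n\<rfloor> - f s * Suc n\<bar> \<le> 1" by linarith
    then have "\<bar>(of_int \<lfloor>f s * Suc n\<rfloor> - f s * Suc n) / Suc n\<bar> \<le> 1 / Suc n"
      by (simp add: abs_divide divide_right_mono)
    then show ?thesis by (simp add: h_def diff_divide_distrib)
  qed
  show "char_fun (\<lambda>z. exp (CLINT s:E|lborel. \<Psi> (z * h n s)))" for n
  proof -
    define V where "V = (\<lambda>i. of_int i / real (Suc n)) ` {\<lfloor>- m * Suc n\<rfloor>..\<lfloor>m * Suc n\<rfloor>}"
    have V: "finite V" unfolding V_def by simp
    have hV: "h n s \<in> V" if "s \<in> E" for s
    proof -
      have "- m * Suc n \<le> f s * Suc n" "f s * Suc n \<le> m * Suc n"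
        using m[OF that] by (intro mult_right_mono; simp)+
      then show ?thesis unfolding V_def h_def by (auto intro!: imageI floor_mono)
    qed
    have fin: "emeasure lborel (E \<inter> {s. h n s = y}) < \<infinity>" for y
      using E by (intro order_le_less_trans[OF emeasure_mono E(2)]) auto
    have "(CLINT s:E|lborel. \<Psi> (z * h n s))
        = (\<Sum>y\<in>V. of_real (measure lborel (E \<inter> {s. h n s = y})) * \<Psi> (z * y))" for z
      using E by (intro set_integral_finite_range[OF V hV]) (auto simp: fin[simplified])
    then show ?thesis
      by (auto simp: exp_sum V intro!: char_fun_prod char_fun_scale[where \<phi>="\<lambda>z. exp (of_real t * \<Psi> z)" for t] char)
  qed
  show "(\<lambda>n. exp (CLINT s:E|lborel. \<Psi> (z * h n s))) \<longlonglongrightarrow> exp (CLINT s:E|lborel. \<Psi> (z * f s))" for z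
  proof (intro tendsto_exp exponent_integral_tendsto[OF cont E, where K="\<bar>z\<bar> * (m + 1)"])
    fix n s assume "s \<in> E"
    have "1 / real (Suc n) \<le> 1" by simp
    then have "\<bar>h n s\<bar> \<le> m + 1" using h[of n s] m[OF \<open>s \<in> E\<close>] by linarith
    then show "\<bar>z * h n s\<bar> \<le> \<bar>z\<bar> * (m + 1)" by (simp add: abs_mult mult_left_mono)
  next
    have "(\<lambda>n. h n s) \<longlonglongrightarrow> f s" for s
    proof (rule Lim_null_comparison[THEN LIM_zero_cancel])
      show "\<forall>\<^sub>F n in sequentially. norm (h n s - f s) \<le> 1 / Suc n" using h by simp
      show "(\<lambda>n. 1 / real (Suc n)) \<longlonglongrightarrow> 0" using LIMSEQ_Suc[OF lim_1_over_n] by simp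
    qed
    then show "AE s in lborel. s \<in> E \<longrightarrow> (\<lambda>n. z * h n s) \<longlonglongrightarrow> z * f s"
      by (intro AE_I2 impI tendsto_intros)
  qed measurable
  show "isCont (\<lambda>z. exp (CLINT s:E|lborel. \<Psi> (z * f s))) 0"
    by (intro continuous_intros isCont_exponent_integral[OF cont E f m])
qed

section \<open>Independently scattered random measures\<close>

abbreviation char_rv :: "'a measure \<Rightarrow> ('a \<Rightarrow> real) \<Rightarrow> real \<Rightarrow> complex" where
  "char_rv M X \<equiv> char (distr M borel X)"

lemma char_distr_cong_AE:
  assumes "X \<in> borel_measurable M" "Y \<in> borel_measurable M" "AE \<omega> in M. X \<omega> = Y \<omega>"
  shows "char_rv M X z = char_rv M Y z"
proof -
  have "distr M borel X = distr M borel Y"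
    using assms by (intro distr_cong_AE) auto
  then show ?thesis by simp
qed

lemma char_tendsto_AE:
  assumes "prob_space M" and X[measurable]: "\<And>n. X n \<in> borel_measurable M" and Y[measurable]: "Y \<in> borel_measurable M"
    and lim: "AE \<omega> in M. (\<lambda>n. X n \<omega>) \<longlonglongrightarrow> (Y \<omega> :: real)"
  shows "(\<lambda>n. char_rv M (X n) z) \<longlonglongrightarrow> char_rv M Y z"
proof -
  interpret prob_space M by fact
  have "(\<lambda>n. CLINT \<omega>|M. iexp (z * X n \<omega>)) \<longlonglongrightarrow> (CLINT \<omega>|M. iexp (z * Y \<omega>))"
  proof (rule integral_dominated_convergence[where w="\<lambda>_. 1"])
    show "AE \<omega> in M. (\<lambda>n. iexp (z * X n \<omega>)) \<longlonglongrightarrow> iexp (z * Y \<omega>)"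
      using lim by eventually_elim (intro tendsto_intros)
  qed auto
  then show ?thesis
    unfolding char_def by (simp add: integral_distr)
qed

text \<open>
  The difference of the two exponentials is at most \<open>2\<close> where \<open>\<bar>X i - Y\<bar> > \<delta>\<close> and at most \<open>\<bar>z\<bar> * \<delta>\<close>
  elsewhere.
\<close>

lemma char_tendsto_in_prob:
  assumes M: "prob_space M" and conv: "tendsto_in_prob M X Y F"
  shows "((\<lambda>i. char_rv M (X i) z) \<longlongrightarrow> char_rv M Y z) F"
proof -
  interpret prob_space M by fact
  have meas: "\<forall>\<^sub>F i in F. X i \<in> borel_measurable M" and Y[measurable]: "Y \<in> borel_measurable M"
    and lim: "\<And>\<epsilon>. 0 < \<epsilon> \<Longrightarrow> ((\<lambda>i. prob {\<omega> \<in> space M. \<bar>X i \<omega> - Y \<omega>\<bar> > \<epsilon>}) \<longlongrightarrow> 0) F"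
    using conv by (auto simp: tendsto_in_prob_def)
  have bound: "norm (char_rv M X' z - char_rv M Y z)
      \<le> 2 * prob {\<omega> \<in> space M. \<bar>X' \<omega> - Y \<omega>\<bar> > \<delta>} + \<bar>z\<bar> * \<delta>"
    if [measurable]: "X' \<in> borel_measurable M" and "0 < \<delta>" for X' \<delta>
  proof -
    let ?A = "{\<omega> \<in> space M. \<bar>X' \<omega> - Y \<omega>\<bar> > \<delta>}"
    have int: "complex_integrable M (\<lambda>\<omega>. iexp (z * X' \<omega>))" "complex_integrable M (\<lambda>\<omega>. iexp (z * Y \<omega>))"
      by (rule integrable_const_bound[where B=1]; auto)+
    have "norm (char_rv M X' z - char_rv M Y z)
        = norm (CLINT \<omega>|M. iexp (z * X' \<omega>) - iexp (z * Y \<omega>))"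
      unfolding char_def using int by (simp add: integral_distr)
    also have "\<dots> \<le> (LINT \<omega>|M. norm (iexp (z * X' \<omega>) - iexp (z * Y \<omega>)))"
      by (rule integral_norm_bound)
    also have "\<dots> \<le> (LINT \<omega>|M. 2 * indicator ?A \<omega> + \<bar>z\<bar> * \<delta>)"
    proof (rule integral_mono)
      show "integrable M (\<lambda>\<omega>. norm (iexp (z * X' \<omega>) - iexp (z * Y \<omega>)))"
        using int by (intro integrable_norm Bochner_Integration.integrable_diff)
      show "integrable M (\<lambda>\<omega>. 2 * indicator ?A \<omega> + \<bar>z\<bar> * \<delta>)"
        by (intro Bochner_Integration.integrable_add integrable_mult_right integrable_const
              integrable_const_bound[where B=1]) auto
      fix \<omega> assume "\<omega> \<in> space M"
      have two: "norm (iexp (z * X' \<omega>) - iexp (z * Y \<omega>)) \<le> 2"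
        using norm_triangle_ineq4[of "iexp (z * X' \<omega>)" "iexp (z * Y \<omega>)"] by simp
      have "iexp (z * X' \<omega>) - iexp (z * Y \<omega>) = iexp (z * Y \<omega>) * (iexp (z * (X' \<omega> - Y \<omega>)) - 1)"
        by (simp add: right_diff_distrib flip: exp_add)
      then have "norm (iexp (z * X' \<omega>) - iexp (z * Y \<omega>)) = norm (iexp (z * (X' \<omega> - Y \<omega>)) - 1)"
        by (simp only: norm_mult norm_exp_i_times mult_1)
      also have "\<dots> \<le> \<bar>z * (X' \<omega> - Y \<omega>)\<bar>"
        using iexp_approx1[of "z * (X' \<omega> - Y \<omega>)" 0] by simp
      finally have "norm (iexp (z * X' \<omega>) - iexp (z * Y \<omega>)) \<le> \<bar>z\<bar> * \<bar>X' \<omega> - Y \<omega>\<bar>"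
        by (simp only: abs_mult)
      moreover have "\<bar>z\<bar> * \<bar>X' \<omega> - Y \<omega>\<bar> \<le> \<bar>z\<bar> * \<delta>" if "\<omega> \<notin> ?A"
        using that \<open>\<omega> \<in> space M\<close> by (intro mult_left_mono) auto
      moreover have "0 \<le> \<bar>z\<bar> * \<delta>" using \<open>0 < \<delta>\<close> by simp
      ultimately show "norm (iexp (z * X' \<omega>) - iexp (z * Y \<omega>)) \<le> 2 * indicator ?A \<omega> + \<bar>z\<bar> * \<delta>"
        using two by (cases "\<omega> \<in> ?A") (simp_all only: indicator_simps, auto)
    qed
    also have "\<dots> = 2 * prob ?A + \<bar>z\<bar> * \<delta>"
    proof -
      have "integrable M (\<lambda>\<omega>. 2 * indicator ?A \<omega> :: real)"
        by (intro integrable_mult_right integrable_const_bound[where B=1]) auto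
      then show ?thesis
        by (subst Bochner_Integration.integral_add) (auto simp: prob_space)
    qed
    finally show ?thesis .
  qed
  show ?thesis
    unfolding tendsto_iff dist_norm
  proof (intro allI impI)
    fix e :: real assume "0 < e"
    define \<delta> where "\<delta> = e / (2 * (\<bar>z\<bar> + 1))"
    have \<delta>: "0 < \<delta>" using \<open>0 < e\<close> by (simp add: \<delta>_def)
    have "\<bar>z\<bar> * \<delta> \<le> (\<bar>z\<bar> + 1) * \<delta>" using \<delta> by simp
    also have "\<dots> = e / 2" by (simp add: \<delta>_def field_simps)
    finally have z\<delta>: "\<bar>z\<bar> * \<delta> \<le> e / 2" .
    have "\<forall>\<^sub>F i in F. prob {\<omega> \<in> space M. \<bar>X i \<omega> - Y \<omega>\<bar> > \<delta>} < e / 4"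
      using lim[OF \<delta>] \<open>0 < e\<close> by (intro order_tendstoD(2)[where y=0]) auto
    with meas show "\<forall>\<^sub>F i in F. norm (char_rv M (X i) z - char_rv M Y z) < e"
    proof eventually_elim
      case (elim i)
      from bound[OF elim(1) \<delta>] elim(2) z\<delta> show ?case by linarith
    qed
  qed
qed

lemma bounded_borel_emeasure: "A \<in> bounded_borel \<Longrightarrow> A \<in> sets borel \<and> emeasure lborel A < \<infinity>"
  using emeasure_bounded_finite by (auto simp: bounded_borel_def)

lemma bounded_borel_subset_Icc:
  assumes "A \<in> bounded_borel"
  obtains T where "0 < T" "A \<subseteq> {0..T}"
proof -
  from assms obtain T where "\<And>x. x \<in> A \<Longrightarrow> \<bar>x\<bar> \<le> T" unfolding bounded_borel_def bounded_iff by auto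
  moreover have "A \<subseteq> {0..}" using assms by (simp add: bounded_borel_def)
  ultimately show ?thesis by (intro that[of "max 1 T"]) fastforce+
qed

lemma bounded_borel_subset: "A \<in> bounded_borel \<Longrightarrow> B \<in> sets borel \<Longrightarrow> B \<subseteq> A \<Longrightarrow> B \<in> bounded_borel"
  by (auto simp: bounded_borel_def intro: bounded_subset)

locale scattered_measure = prob_space M for M :: "'a measure" +
  fixes Lam :: "real set \<Rightarrow> 'a \<Rightarrow> real"
  assumes Lam: "indep_scattered M Lam"

lemma (in scattered_measure) indep_scattered_measurable:
  "A \<in> bounded_borel \<Longrightarrow> Lam A \<in> borel_measurable M"
  using Lam by (simp add: indep_scattered_def)

lemma (in scattered_measure) indep_scattered_indep:
  fixes A :: "nat \<Rightarrow> real set"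
  assumes "range A \<subseteq> bounded_borel" "disjoint_family A"
  shows "indep_vars (\<lambda>_. borel) (\<lambda>n. Lam (A n)) UNIV"
  using Lam[unfolded indep_scattered_def, THEN conjunct2, rule_format, OF assms(1,2)] by (rule conjunct1)

lemma (in scattered_measure) indep_scattered_sums:
  fixes A :: "nat \<Rightarrow> real set"
  assumes "range A \<subseteq> bounded_borel" "disjoint_family A" "(\<Union>n. A n) \<in> bounded_borel"
  shows "AE \<omega> in M. (\<lambda>n. Lam (A n) \<omega>) sums Lam (\<Union>n. A n) \<omega>"
  using Lam[unfolded indep_scattered_def, THEN conjunct2, rule_format, OF assms(1,2)] assms(3) by (rule conjunct2[THEN mp])

text \<open>
  Additivity and independence are postulated for sequences; a finite family is continued by empty sets.
\<close>

lemma (in scattered_measure) indep_scattered_finite: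
  fixes n :: nat
  assumes A: "\<And>i. i < n \<Longrightarrow> A i \<in> bounded_borel" "disjoint_family_on A {..<n}"
  shows "indep_vars (\<lambda>_. borel) (\<lambda>i. Lam (A i)) {..<n}"
proof -
  define B where "B i = (if i < n then A i else {})" for i
  have B1: "range B \<subseteq> bounded_borel"
    using A(1) by (auto simp: B_def bounded_borel_def)
  have B2: "disjoint_family B"
    using A(2) by (auto simp: B_def disjoint_family_on_def)
  have "indep_vars (\<lambda>_. borel) (\<lambda>i. Lam (B i)) UNIV"
    by (rule indep_scattered_indep[OF B1 B2])
  then have "indep_vars (\<lambda>_. borel) (\<lambda>i. Lam (B i)) {..<n}"
    by (rule indep_vars_subset) auto
  then show ?thesis
    by (rule indep_vars_cong[THEN iffD1, rotated -1]) (auto simp: B_def)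
qed

lemma (in scattered_measure) indep_scattered_empty:
  shows "AE \<omega> in M. Lam {} \<omega> = 0"
proof -
  have "{} \<in> bounded_borel" by (simp add: bounded_borel_def)
  then have "AE \<omega> in M. (\<lambda>n::nat. Lam {} \<omega>) sums Lam {} \<omega>"
    using indep_scattered_sums[of "\<lambda>_. {}"] by (auto simp: disjoint_family_on_def)
  then show ?thesis
    by eventually_elim (auto simp: sums_iff summable_const_iff)
qed

lemma (in scattered_measure) char_scattered_Union:
  assumes A: "range A \<subseteq> bounded_borel" "disjoint_family A" "(\<Union>n. A n) \<in> bounded_borel"
  shows "(\<lambda>n. \<Prod>i<n. char_rv M (Lam (A i)) z) \<longlonglongrightarrow> char_rv M (Lam (\<Union>n. A n)) z"
proof -
  note meas = indep_scattered_measurable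
  have "(\<lambda>n. char_rv M (\<lambda>\<omega>. \<Sum>i<n. Lam (A i) \<omega>) z) \<longlonglongrightarrow> char_rv M (Lam (\<Union>n. A n)) z"
  proof (rule char_tendsto_AE[OF prob_space_axioms])
    show "(\<lambda>\<omega>. \<Sum>i<n. Lam (A i) \<omega>) \<in> borel_measurable M" for n
      using A by (intro borel_measurable_sum meas) auto
    show "Lam (\<Union>n. A n) \<in> borel_measurable M" by (rule meas[OF A(3)])
    show "AE \<omega> in M. (\<lambda>n. \<Sum>i<n. Lam (A i) \<omega>) \<longlonglongrightarrow> Lam (\<Union>n. A n) \<omega>"
      using indep_scattered_sums[OF A] by (simp only: sums_def)
  qed
  moreover have "char_rv M (\<lambda>\<omega>. \<Sum>i<n. Lam (A i) \<omega>) z = (\<Prod>i<n. char_rv M (Lam (A i)) z)" for n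
  proof (intro char_distr_sum indep_scattered_finite)
    show "A i \<in> bounded_borel" for i using A(1) by auto
    show "disjoint_family_on A {..<n}" by (rule disjoint_family_on_mono[OF _ A(2)]) simp
  qed
  ultimately show ?thesis by (simp only:)
qed

lemma char_distr_0: "prob_space M \<Longrightarrow> char_rv M (\<lambda>_. 0) z = 1"
  unfolding char_def by (subst integral_distr) (auto simp: prob_space.prob_space)

lemma (in scattered_measure) char_scattered_empty:
  shows "char_rv M (Lam {}) z = 1"
proof -
  have "char_rv M (Lam {}) z = char_rv M (\<lambda>_. 0) z"
    using indep_scattered_empty
    by (intro char_distr_cong_AE indep_scattered_measurable) (auto simp: bounded_borel_def)
  then show ?thesis by (simp only: char_distr_0[OF prob_space_axioms])
qed

lemma (in scattered_measure) char_scattered_Un: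
  assumes A: "A \<in> bounded_borel" "B \<in> bounded_borel" "A \<inter> B = {}"
  shows "char_rv M (Lam (A \<union> B)) z = char_rv M (Lam A) z * char_rv M (Lam B) z"
proof -
  define C where "C n = (if n = 0 then A else if n = (1::nat) then B else {})" for n
  have C01: "C 0 = A" "C 1 = B" by (simp_all add: C_def)
  have "C n \<subseteq> A \<union> B" for n by (simp add: C_def)
  with C01 have U: "(\<Union>n. C n) = A \<union> B" by blast
  have "A \<union> B \<in> bounded_borel" using A by (auto simp: bounded_borel_def)
  moreover have "range C \<subseteq> bounded_borel" using A by (auto simp: C_def bounded_borel_def)
  moreover have "disjoint_family C" using A(3) by (auto simp: C_def disjoint_family_on_def)
  ultimately have "(\<lambda>n. \<Prod>i<n. char_rv M (Lam (C i)) z) \<longlonglongrightarrow> char_rv M (Lam (A \<union> B)) z"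
    using char_scattered_Union[of C z] by (simp only: U)
  then have "(\<lambda>n. \<Prod>i<n+2. char_rv M (Lam (C i)) z) \<longlonglongrightarrow> char_rv M (Lam (A \<union> B)) z"
    by (rule LIMSEQ_ignore_initial_segment)
  moreover have "(\<Prod>i<n+2. char_rv M (Lam (C i)) z) = char_rv M (Lam A) z * char_rv M (Lam B) z" for n
  proof -
    have "(\<Prod>i<n+2. char_rv M (Lam (C i)) z) = (\<Prod>i\<in>{0, 1}. char_rv M (Lam (C i)) z)"
      by (intro prod.mono_neutral_right) (auto simp: C_def char_scattered_empty)
    then show ?thesis using C01 by simp
  qed
  ultimately show ?thesis by (simp only: LIMSEQ_const_iff)
qed

text \<open>
  On intervals the formula is the hypothesis. The sets for which it holds form a Dynkin system: for relative
  complements one divides by \<open>exp (\<lambda> A * \<Psi> z)\<close>, which never vanishes, and for disjoint unions one uses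
  countable additivity almost surely. The point \<open>0\<close> lies in no interval \<open>{a<..b}\<close> with \<open>a \<ge> 0\<close> and is added at the end.
\<close>

lemma (in scattered_measure) char_random_measure:
  fixes \<Psi> :: "real \<Rightarrow> complex"
  assumes zero: "AE \<omega> in M. Lam {0} \<omega> = 0"
    and ivl: "\<And>a b z. 0 \<le> a \<Longrightarrow> a \<le> b \<Longrightarrow> char_rv M (Lam {a<..b}) z = exp (of_real (b - a) * \<Psi> z)"
    and A: "A \<in> bounded_borel"
  shows "char_rv M (Lam A) z = exp (of_real (measure lborel A) * \<Psi> z)"
proof -
  note meas = indep_scattered_measurable
  define Q where "Q B \<longleftrightarrow> (\<forall>z. char_rv M (Lam B) z = exp (of_real (measure lborel B) * \<Psi> z))" for B
  obtain T where T: "0 < T" "A \<subseteq> {0..T}" by (rule bounded_borel_subset_Icc[OF A])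
  let ?I = "{0<..T}"
  have I: "B \<inter> ?I \<in> bounded_borel" if "B \<in> sets borel" for B
    using that by (auto simp: bounded_borel_def intro: bounded_subset[OF bounded_closed_interval[of 0 T]])
  have fin: "emeasure lborel (B \<inter> ?I) \<noteq> \<infinity>" if "B \<in> sets borel" for B
    using bounded_borel_emeasure[OF I[OF that]] by auto
  have borel: "sets borel = sigma_sets UNIV (range (\<lambda>(a, b). {a<..b :: real}))"
    by (simp add: borel_sigma_sets_Ioc)
  have QI: "Q ?I" using ivl[of 0 T] T(1) by (simp add: Q_def)
  have pow: "range (\<lambda>(a, b). {a<..b :: real}) \<subseteq> Pow UNIV" by simp
  have stable: "Int_stable (range (\<lambda>(a, b). {a<..b :: real}))"
    by (auto simp: Int_stable_def)
  have "Q (B \<inter> ?I)" if "B \<in> sigma_sets UNIV (range (\<lambda>(a, b). {a<..b :: real}))" for B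
    using stable pow that
  proof (induction rule: sigma_sets_induct_disjoint)
    case (basic B)
    then obtain a b where B: "B = {a<..b}" by auto
    have eq: "B \<inter> ?I = {max a 0<..min b T}" by (auto simp: B)
    show ?case
    proof (cases "max a 0 \<le> min b T")
      case True
      then show ?thesis unfolding eq Q_def using ivl[of "max a 0" "min b T"] by simp
    next
      case False
      then have "B \<inter> ?I = {}" unfolding eq by (intro greaterThanAtMost_empty) linarith
      then show ?thesis using char_scattered_empty by (simp add: Q_def)
    qed
  next
    case empty
    then show ?case using char_scattered_empty by (simp add: Q_def)
  next
    case (compl B)
    then have B: "B \<in> sets borel" by (simp add: borel)
    then have B': "UNIV - B \<in> sets borel" by auto
    have un: "(B \<inter> ?I) \<union> ((UNIV - B) \<inter> ?I) = ?I" and dis: "(B \<inter> ?I) \<inter> ((UNIV - B) \<inter> ?I) = {}" by auto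
    have "measure lborel ((B \<inter> ?I) \<union> ((UNIV - B) \<inter> ?I)) = measure lborel (B \<inter> ?I) + measure lborel ((UNIV - B) \<inter> ?I)"
      using B B' dis fin[OF B] fin[OF B'] by (intro measure_Union) auto
    then have m: "measure lborel ?I = measure lborel (B \<inter> ?I) + measure lborel ((UNIV - B) \<inter> ?I)"
      by (simp only: un)
    show ?case
      unfolding Q_def
    proof
      fix z
      have "exp (of_real (measure lborel (B \<inter> ?I)) * \<Psi> z) * exp (of_real (measure lborel ((UNIV - B) \<inter> ?I)) * \<Psi> z)
          = exp (of_real (measure lborel ?I) * \<Psi> z)"
        unfolding m by (simp add: distrib_right exp_add)
      also have "\<dots> = char_rv M (Lam ?I) z" using QI by (simp add: Q_def)
      also have "\<dots> = char_rv M (Lam (B \<inter> ?I)) z * char_rv M (Lam ((UNIV - B) \<inter> ?I)) z"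
        using char_scattered_Un[OF I[OF B] I[OF B'] dis] by (simp only: un)
      finally show "char_rv M (Lam ((UNIV - B) \<inter> ?I)) z = exp (of_real (measure lborel ((UNIV - B) \<inter> ?I)) * \<Psi> z)"
        using compl by (simp add: Q_def)
    qed
  next
    case (union B)
    then have B: "B i \<in> sets borel" for i by (auto simp: borel)
    let ?B = "\<lambda>i. B i \<inter> ?I"
    have U: "(\<Union>i. B i) \<inter> ?I = (\<Union>i. ?B i)" by auto
    have UB: "(\<Union>i. ?B i) \<in> bounded_borel" unfolding U[symmetric] using B by (intro I) auto
    have dis: "disjoint_family ?B" using union(1) by (auto simp: disjoint_family_on_def)
    show ?case
      unfolding Q_def U
    proof
      fix z
      have "(\<lambda>n. \<Prod>i<n. char_rv M (Lam (?B i)) z) \<longlonglongrightarrow> char_rv M (Lam (\<Union>i. ?B i)) z"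
        using I B dis UB by (intro char_scattered_Union) auto
      moreover have "(\<Prod>i<n. char_rv M (Lam (?B i)) z) = exp (of_real (\<Sum>i<n. measure lborel (?B i)) * \<Psi> z)" for n
        using union(3) by (simp add: Q_def sum_distrib_right exp_sum)
      moreover have "(\<lambda>n. exp (of_real (\<Sum>i<n. measure lborel (?B i)) * \<Psi> z)) \<longlonglongrightarrow> exp (of_real (measure lborel (\<Union>i. ?B i)) * \<Psi> z)"
      proof (intro tendsto_intros)
        have "(\<lambda>i. measure lborel (?B i)) sums measure lborel (\<Union>i. ?B i)"
          using B dis bounded_borel_emeasure[OF UB] by (intro measure_UNION) auto
        then show "(\<lambda>n. \<Sum>i<n. measure lborel (?B i)) \<longlonglongrightarrow> measure lborel (\<Union>i. ?B i)"
          by (simp add: sums_def)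
      qed
      ultimately show "char_rv M (Lam (\<Union>i. ?B i)) z = exp (of_real (measure lborel (\<Union>i. ?B i)) * \<Psi> z)"
        using LIMSEQ_unique by auto
    qed
  qed
  moreover have A': "A \<in> sets borel" using A by (simp add: bounded_borel_def)
  ultimately have Q: "Q (A \<inter> ?I)" by (simp only: borel)
  have A0: "A \<inter> {0} \<in> bounded_borel" using A A' by (intro bounded_borel_subset[OF A]) auto
  have dis: "(A \<inter> ?I) \<inter> (A \<inter> {0}) = {}" by auto
  have un: "A = (A \<inter> ?I) \<union> (A \<inter> {0})" using T(2) by force
  have "AE \<omega> in M. Lam (A \<inter> {0}) \<omega> = 0"
    using zero indep_scattered_empty by (cases "0 \<in> A") auto
  then have "char_rv M (Lam (A \<inter> {0})) z = char_rv M (\<lambda>_. 0) z"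
    using A0 by (intro char_distr_cong_AE meas) auto
  also have "\<dots> = 1" by (rule char_distr_0[OF prob_space_axioms])
  finally have c0: "char_rv M (Lam (A \<inter> {0})) z = 1" .
  have m: "measure lborel A = measure lborel (A \<inter> ?I)"
  proof -
    have "emeasure lborel (A \<inter> {0}) = 0"
      by (rule emeasure_lborel_countable) auto
    then have "A \<inter> {0} \<in> null_sets lborel" using A' by (auto simp: null_sets_def)
    then have "emeasure lborel ((A \<inter> ?I) \<union> (A \<inter> {0})) = emeasure lborel (A \<inter> ?I)"
      using A' by (intro emeasure_Un_null_set) auto
    then have "emeasure lborel A = emeasure lborel (A \<inter> ?I)" by (simp only: un[symmetric])
    then show ?thesis by (simp add: measure_def)
  qed
  have "char_rv M (Lam A) z = char_rv M (Lam (A \<inter> ?I)) z * char_rv M (Lam (A \<inter> {0})) z"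
    using char_scattered_Un[OF I[OF A'] A0 dis] by (simp only: un[symmetric])
  then show ?thesis using Q c0 m by (simp add: Q_def)
qed

text \<open>
  The level sets of \<open>g\<close> are disjoint, so the summands of the integral are independent.
\<close>

lemma (in scattered_measure) char_simple_random_integral:
  fixes \<Psi> :: "real \<Rightarrow> complex"
  assumes charL: "\<And>A z. A \<in> bounded_borel \<Longrightarrow> char_rv M (Lam A) z = exp (of_real (measure lborel A) * \<Psi> z)"
    and g: "simple_function (restrict_space borel {0..t}) g"
    and A: "A \<in> sets borel" "A \<subseteq> {0..t}"
  shows "simple_random_integral Lam t g A \<in> borel_measurable M"
    and "char_rv M (simple_random_integral Lam t g A) z = exp (CLINT s:A|lborel. \<Psi> (z * g s))"
proof -
  let ?V = "g ` {0..t}"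
  define B where "B y = A \<inter> {s \<in> {0..t}. g s = y}" for y
  have V: "finite ?V" using simple_functionD(1)[OF g] by (simp add: space_restrict_space)
  have Aeq: "A \<inter> {s. g s = y} = B y" for y using A(2) by (auto simp: B_def)
  have "{s \<in> {0..t}. g s = y} \<in> sets borel" for y
  proof -
    have "g -` {y} \<inter> {0..t} \<in> sets (restrict_space borel {0..t})"
      using simple_functionD(2)[OF g, of "{y}"] by (simp add: space_restrict_space)
    then have "g -` {y} \<inter> {0..t} \<in> sets borel"
      by (subst (asm) sets_restrict_space_iff) auto
    moreover have "g -` {y} \<inter> {0..t} = {s \<in> {0..t}. g s = y}" by auto
    ultimately show ?thesis by simp
  qed
  then have Bm: "B y \<in> sets borel" for y using A by (auto simp: B_def)
  have B: "B y \<in> bounded_borel" for y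
    using Bm by (auto simp: bounded_borel_def B_def intro: bounded_subset[OF bounded_closed_interval])
  have meas: "Lam (B y) \<in> borel_measurable M" for y
    using indep_scattered_measurable[OF B] .
  have eq: "simple_random_integral Lam t g A = (\<lambda>\<omega>. \<Sum>y\<in>?V. y * Lam (B y) \<omega>)"
    by (auto simp: simple_random_integral_def B_def)
  show "simple_random_integral Lam t g A \<in> borel_measurable M"
    unfolding eq using meas by (intro borel_measurable_sum borel_measurable_times) auto
  obtain h where h: "bij_betw h {..<card ?V} ?V"
    using ex_bij_betw_nat_finite[OF V] by (auto simp: atLeast0LessThan)
  have "indep_vars (\<lambda>_. borel) (\<lambda>i. Lam (B (h i))) {..<card ?V}"
  proof (intro indep_scattered_finite B)
    have "B y \<inter> B y' = {}" if "y \<noteq> y'" for y y' using that by (auto simp: B_def)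
    moreover have "h i \<noteq> h j" if "i < card ?V" "j < card ?V" "i \<noteq> j" for i j
      using h that unfolding bij_betw_def inj_on_def by blast
    ultimately show "disjoint_family_on (\<lambda>i. B (h i)) {..<card ?V}"
      unfolding disjoint_family_on_def by blast
  qed
  then have ind: "indep_vars (\<lambda>_. borel) (\<lambda>i \<omega>. h i * Lam (B (h i)) \<omega>) {..<card ?V}"
    by (rule indep_vars_compose2[where Y="\<lambda>i x. h i * x"]) auto
  have single: "char_rv M (\<lambda>\<omega>. y * Lam (B y) \<omega>) z = exp (of_real (measure lborel (B y)) * \<Psi> (z * y))" for y
  proof -
    have "char_rv M (\<lambda>\<omega>. y * Lam (B y) \<omega>) z = char_rv M (Lam (B y)) (z * y)"
      using meas by (simp add: char_def integral_distr mult.assoc)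
    then show ?thesis using charL[OF B] by simp
  qed
  have "char_rv M (simple_random_integral Lam t g A) z
      = (\<Prod>y\<in>?V. exp (of_real (measure lborel (B y)) * \<Psi> (z * y)))"
  proof -
    have "simple_random_integral Lam t g A = (\<lambda>\<omega>. \<Sum>i<card ?V. h i * Lam (B (h i)) \<omega>)"
      unfolding eq by (intro ext sum.reindex_bij_betw[OF h, symmetric])
    then show ?thesis
      using prod.reindex_bij_betw[OF h, of "\<lambda>y. exp (of_real (measure lborel (B y)) * \<Psi> (z * y))"]
      by (simp only: char_distr_sum[OF ind] single)
  qed
  also have "\<dots> = exp (\<Sum>y\<in>?V. of_real (measure lborel (B y)) * \<Psi> (z * y))"
    using V by (simp add: exp_sum)
  also have "(\<Sum>y\<in>?V. of_real (measure lborel (B y)) * \<Psi> (z * y)) = (CLINT s:A|lborel. \<Psi> (z * g s))"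
    using A V Bm bounded_borel_emeasure[OF B]
    by (subst set_integral_finite_range[where V="?V"]) (auto simp: Aeq)
  finally show "char_rv M (simple_random_integral Lam t g A) z = exp (CLINT s:A|lborel. \<Psi> (z * g s))" .
qed

section \<open>Splitting off a bounded piece of the integrand\<close>

lemma set_integrable_exponent:
  fixes \<Psi> :: "real \<Rightarrow> complex"
  assumes cont: "\<And>z. isCont \<Psi> z"
    and E: "E \<in> sets borel" "emeasure lborel E < \<infinity>"
    and g[measurable]: "g \<in> borel_measurable borel" and K: "\<And>s. s \<in> E \<Longrightarrow> \<bar>g s\<bar> \<le> K"
  shows "set_integrable lborel E (\<lambda>s. \<Psi> (z * g s))"
proof -
  obtain B where B: "0 \<le> B" "\<And>u. \<bar>u\<bar> \<le> \<bar>z\<bar> * K \<Longrightarrow> norm (\<Psi> u) \<le> B"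
    using bounded_on_compact_interval[OF cont, of "\<bar>z\<bar> * K"] by blast
  note [measurable] = E(1) isCont_measurable[OF cont]
  show ?thesis
    unfolding set_integrable_def
  proof (rule integrableI_bounded_set_indicator[where B=B])
    show "AE s in lborel. s \<in> E \<longrightarrow> norm (\<Psi> (z * g s)) \<le> B"
      using K by (intro AE_I2 impI B(2)) (simp add: abs_mult mult_left_mono)
  qed (use E in auto)
qed

text \<open>
  For the approximating step functions the quotient is the characteristic function of their integral over the
  complement of \<open>E\<close>, and \<open>char_fun_limit\<close> keeps this property in the limit. The approximation converges only almost
  everywhere, without any bound; the limit is therefore first taken on the subset of \<open>E\<close> where it has become bounded by
  \<open>m + 1\<close> from index \<open>k\<close> on, and these subsets exhaust \<open>E\<close> up to a null set as \<open>k\<close> grows.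
\<close>

lemma (in scattered_measure) char_fun_quotient_random_integral:
  fixes \<Psi> :: "real \<Rightarrow> complex" and f :: "real \<Rightarrow> real"
  assumes charL: "\<And>A z. A \<in> bounded_borel \<Longrightarrow> char_rv M (Lam A) z = exp (of_real (measure lborel A) * \<Psi> z)"
    and cont: "\<And>z. isCont \<Psi> z"
    and f[measurable]: "f \<in> borel_measurable borel"
    and J: "has_random_integral M Lam f t J"
    and E[measurable]: "E \<in> sets borel" and Et: "E \<subseteq> {0..t}" and m: "\<And>s. s \<in> E \<Longrightarrow> \<bar>f s\<bar> \<le> m"
  shows "char_fun (\<lambda>z. char_rv M J z / exp (CLINT s:E|lborel. \<Psi> (z * f s)))"
proof -
  let ?F = "\<lambda>A z. CLINT s:A|lborel. \<Psi> (z * f s)"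
  obtain g where g: "\<And>n. simple_function (restrict_space borel {0..t}) (g n)"
    and lim: "AE s in lborel. s \<in> {0..t} \<longrightarrow> (\<lambda>n. g n s) \<longlonglongrightarrow> f s"
    and conv: "tendsto_in_prob M (\<lambda>n. simple_random_integral Lam t (g n) {0..t}) J sequentially"
    using J unfolding has_random_integral_def by auto
  have Jm[measurable]: "J \<in> borel_measurable M" using conv by (simp add: tendsto_in_prob_def)
  interpret D: real_distribution "distr M borel J" by simp
  define g' where "g' n s = (if s \<in> {0..t} then g n s else 0)" for n s
  let ?G = "\<lambda>n A z. CLINT s:A|lborel. \<Psi> (z * g' n s)"
  have g'[measurable]: "g' n \<in> borel_measurable borel" for n
  proof -
    have "g n \<in> borel_measurable (restrict_space borel {0..t})"
      using g by (rule borel_measurable_simple_function)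
    then show ?thesis unfolding g'_def by (subst (asm) measurable_restrict_space_iff[where c=0]) auto
  qed
  have g'_bdd: "\<exists>K. \<forall>s\<in>{0..t}. \<bar>g' n s\<bar> \<le> K" for n
  proof -
    have "finite (g n ` {0..t})" using simple_functionD(1)[OF g] by (simp add: space_restrict_space)
    then have "finite ((\<lambda>s. \<bar>g' n s\<bar>) ` {0..t})"
      by (rule finite_subset[OF _ finite_imageI[where h=abs], rotated]) (auto simp: g'_def)
    then show ?thesis by (intro exI[of _ "Max ((\<lambda>s. \<bar>g' n s\<bar>) ` {0..t})"]) auto
  qed
  have fin: "emeasure lborel A < \<infinity>" if "A \<in> sets borel" "A \<subseteq> {0..t}" for A
    using that emeasure_bounded_finite[OF bounded_subset[OF bounded_closed_interval that(2)]] by simp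
  \<comment> \<open>The part of \<open>E\<close> on which the approximation is bounded from index \<open>k\<close> on.\<close>
  define E' where "E' k = E \<inter> (\<Inter>n\<in>{k..}. {s. \<bar>g' n s\<bar> \<le> m + 1})" for k
  have E'[measurable]: "E' k \<in> sets borel" for k unfolding E'_def by measurable
  have E'E: "E' k \<subseteq> E" for k by (auto simp: E'_def)
  have bd: "\<bar>g' n s\<bar> \<le> m + 1" if "s \<in> E' k" "k \<le> n" for s k n
    using that by (auto simp: E'_def)
  have part: "char_fun (\<lambda>z. char_rv M J z / exp (?F (E' k) z))" for k
  proof (rule char_fun_limit)
    have R: "{0..t} - E' k \<in> sets borel" by measurable
    show "char_fun (char_rv M (simple_random_integral Lam t (g (n + k)) ({0..t} - E' k)))" for n
      using char_simple_random_integral(1)[OF charL g R]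
      by (intro char_funI[OF real_distribution_distr]) auto
    fix z
    \<comment> \<open>Additivity of the exponent over \<open>E' k\<close> and its complement in \<open>{0..t}\<close>.\<close>
    have quot: "char_rv M (simple_random_integral Lam t (g n) ({0..t} - E' k)) z
        = char_rv M (simple_random_integral Lam t (g n) {0..t}) z / exp (?G n (E' k) z)" for n
    proof -
      obtain K where K: "\<And>s. s \<in> {0..t} \<Longrightarrow> \<bar>g' n s\<bar> \<le> K" using g'_bdd[of n] by blast
      have un: "{0..t} = E' k \<union> ({0..t} - E' k)" using E'E[of k] Et by auto
      have cong: "(CLINT s:A|lborel. \<Psi> (z * g n s)) = ?G n A z" if "A \<subseteq> {0..t}" for A
        unfolding set_lebesgue_integral_def using that
        by (intro Bochner_Integration.integral_cong) (auto simp: g'_def split: split_indicator)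
      have "(?G n (E' k \<union> ({0..t} - E' k)) z)
          = ?G n (E' k) z + ?G n ({0..t} - E' k) z"
        using E'E[of k] Et K
        by (intro set_integral_Un set_integrable_exponent[OF cont, where K=K] fin) auto
      then have eq: "(?G n ({0..t}) z)
          = ?G n (E' k) z + ?G n ({0..t} - E' k) z"
        by (simp only: un[symmetric])
      have "char_rv M (simple_random_integral Lam t (g n) {0..t}) z = exp (?G n ({0..t}) z)"
        using char_simple_random_integral(2)[OF charL g, of "{0..t}" n z] by (simp add: cong)
      moreover have "char_rv M (simple_random_integral Lam t (g n) ({0..t} - E' k)) z
          = exp (?G n ({0..t} - E' k) z)"
        using char_simple_random_integral(2)[OF charL g R, of n z] by (simp add: cong)
      ultimately show ?thesis unfolding eq exp_add by simp
    qed
    have "(\<lambda>n. char_rv M (simple_random_integral Lam t (g n) {0..t}) z) \<longlonglongrightarrow> char_rv M J z"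
      by (rule char_tendsto_in_prob[OF prob_space_axioms conv])
    then have 1: "(\<lambda>n. char_rv M (simple_random_integral Lam t (g (n + k)) {0..t}) z) \<longlonglongrightarrow> char_rv M J z"
      by (rule LIMSEQ_ignore_initial_segment)
    have 2: "(\<lambda>n. CLINT s:E' k|lborel. \<Psi> (z * g' (n + k) s)) \<longlonglongrightarrow> ?F (E' k) z"
    proof (rule exponent_integral_tendsto[OF cont E' fin, where K="\<bar>z\<bar> * (m + 1)"])
      show "\<bar>z * g' (n + k) s\<bar> \<le> \<bar>z\<bar> * (m + 1)" if "s \<in> E' k" for n s
        using bd[OF that, of "n + k"] by (simp add: abs_mult mult_left_mono)
      show "AE s in lborel. s \<in> E' k \<longrightarrow> (\<lambda>n. z * g' (n + k) s) \<longlonglongrightarrow> z * f s"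
        using lim
      proof eventually_elim
        case (elim s)
        show ?case
        proof
          assume "s \<in> E' k"
          then have s: "s \<in> {0..t}" using E'E[of k] Et by auto
          then have "(\<lambda>n. g' n s) \<longlonglongrightarrow> f s" using elim by (simp add: g'_def)
          then show "(\<lambda>n. z * g' (n + k) s) \<longlonglongrightarrow> z * f s"
            by (intro tendsto_intros LIMSEQ_ignore_initial_segment)
        qed
      qed
    qed (use E'E[of k] Et in auto)
    show "(\<lambda>n. char_rv M (simple_random_integral Lam t (g (n + k)) ({0..t} - E' k)) z)
      \<longlonglongrightarrow> char_rv M J z / exp (?F (E' k) z)"
      unfolding quot using 1 2 by (intro tendsto_divide tendsto_exp) auto
  next
    show "isCont (\<lambda>z. char_rv M J z / exp (?F (E' k) z)) 0"
      using E'E[of k] Et m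
      by (intro continuous_divide continuous_exp D.isCont_char isCont_exponent_integral[OF cont E' fin f, where m=m]) auto
  qed
  show ?thesis
  proof (rule char_fun_limit[OF part])
    fix z
    obtain B where B: "0 \<le> B" "\<And>u. \<bar>u\<bar> \<le> \<bar>z\<bar> * m \<Longrightarrow> norm (\<Psi> u) \<le> B"
      using bounded_on_compact_interval[OF cont, of "\<bar>z\<bar> * m"] by blast
    note [measurable] = isCont_measurable[OF cont]
    have "(\<lambda>k. CLINT s:E' k|lborel. \<Psi> (z * f s)) \<longlonglongrightarrow> ?F E z"
      unfolding set_lebesgue_integral_def
    proof (rule integral_dominated_convergence[where w="\<lambda>s. indicator E s * B"])
      show "integrable lborel (\<lambda>s. indicator E s * B)" using fin[OF E Et] by simp
      show "AE s in lborel. norm (indicator (E' k) s *\<^sub>R \<Psi> (z * f s)) \<le> indicator E s * B" for k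
        using B E'E[of k] m by (intro AE_I2) (auto split: split_indicator simp: abs_mult mult_left_mono)
      show "AE s in lborel. (\<lambda>k. indicator (E' k) s *\<^sub>R \<Psi> (z * f s)) \<longlonglongrightarrow> indicator E s *\<^sub>R \<Psi> (z * f s)"
        using lim
      proof eventually_elim
        case (elim s)
        show ?case
        proof (cases "s \<in> E")
          case True
          then have "s \<in> {0..t}" using Et by auto
          then have "(\<lambda>n. \<bar>g' n s\<bar>) \<longlonglongrightarrow> \<bar>f s\<bar>" using elim by (intro tendsto_rabs) (simp add: g'_def)
          moreover have "\<bar>f s\<bar> < m + 1" using m[OF True] by simp
          ultimately have "\<forall>\<^sub>F n in sequentially. \<bar>g' n s\<bar> < m + 1" by (rule order_tendstoD(2))
          then obtain k0 where "\<And>n. k0 \<le> n \<Longrightarrow> \<bar>g' n s\<bar> < m + 1" unfolding eventually_sequentially by blast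
          then have "\<forall>k\<ge>k0. s \<in> E' k"
            using True unfolding E'_def by (auto intro!: less_imp_le)
          then have "\<forall>\<^sub>F k in sequentially. indicator (E' k) s *\<^sub>R \<Psi> (z * f s) = indicator E s *\<^sub>R \<Psi> (z * f s)"
            using True unfolding eventually_sequentially by (intro exI[of _ k0]) simp
          then show ?thesis by (rule tendsto_eventually)
        next
          case False
          then have "s \<notin> E' k" for k using E'E by auto
          with False show ?thesis by simp
        qed
      qed
    qed measurable
    then show "(\<lambda>k. char_rv M J z / exp (?F (E' k) z))
        \<longlonglongrightarrow> char_rv M J z / exp (?F E z)"
      by (intro tendsto_divide tendsto_exp) auto
  next
    show "isCont (\<lambda>z. char_rv M J z / exp (?F E z)) 0"
      using fin[OF E Et] m
      by (intro continuous_divide continuous_exp D.isCont_char isCont_exponent_integral[OF cont E _ f, where m=m]) auto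
  qed
qed

lemma char_increment:
  assumes "levy_process M \<eta>" "has_char_triplet M \<eta> \<sigma>2 \<nu> \<gamma>" "0 \<le> a" "a \<le> b"
  shows "char_rv M (\<lambda>\<omega>. \<eta> b \<omega> - \<eta> a \<omega>) z = exp (of_real (b - a) * levy_exponent \<sigma>2 \<nu> \<gamma> z)"
proof -
  interpret levy_process M \<eta> by fact
  have "distr M borel (\<lambda>\<omega>. \<eta> b \<omega> - \<eta> a \<omega>) = distr M borel (\<eta> (b - a))"
    using stationary_increments[of a "b - a"] assms(3,4) by simp
  then show ?thesis
    using assms(2,4) by (simp add: has_char_triplet_def)
qed

text \<open>
  The setting of the theorem, with an integrand that is Borel measurable on the whole line.
\<close>

locale levy_integral = levy_process M \<eta> for M :: "'a measure" and \<eta> +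
  fixes \<sigma>2 :: real and \<nu> :: "real measure" and \<gamma> :: real and f :: "real \<Rightarrow> real" and X :: "'a \<Rightarrow> real"
  assumes trip: "has_char_triplet M \<eta> \<sigma>2 \<nu> \<gamma>"
    and f[measurable]: "f \<in> borel_measurable borel"
    and X: "has_improper_levy_integral M \<eta> f X"
begin

abbreviation \<Psi> :: "real \<Rightarrow> complex" where "\<Psi> \<equiv> levy_exponent \<sigma>2 \<nu> \<gamma>"

lemma \<nu>: "levy_measure \<nu>" and \<sigma>2: "0 \<le> \<sigma>2"
  using trip by (auto simp: has_char_triplet_def)

lemma sets_\<nu>[measurable_cong]: "sets \<nu> = sets borel"
  by (rule levy_measure_sets[OF \<nu>])

lemma isCont_\<Psi>: "isCont \<Psi> z"
  by (rule isCont_levy_exponent[OF \<nu>])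

end

text \<open>
  The factorisation on which all conditions rest: dividing out the contribution of \<open>E\<close> leaves a characteristic function.
  The divisor does not depend on the upper limit of integration, so letting that limit tend to infinity is
  another application of \<open>char_fun_limit\<close>.
\<close>

lemma (in levy_integral) char_fun_quotient_improper_integral:
  assumes E: "E \<in> bounded_borel" and m: "\<And>s. s \<in> E \<Longrightarrow> \<bar>f s\<bar> \<le> m"
  shows "X \<in> borel_measurable M"
    and "char_fun (\<lambda>z. char_rv M X z / exp (CLINT s:E|lborel. \<Psi> (z * f s)))"
proof -
  let ?F = "\<lambda>A z. CLINT s:A|lborel. \<Psi> (z * f s)"
  note cont = isCont_\<Psi>
  obtain Lam J where L: "induced_random_measure M \<eta> Lam"
    and J: "\<And>t. 0 < t \<Longrightarrow> has_random_integral M Lam f t (J t)"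
    and conv: "tendsto_in_prob M J X at_top"
    using X unfolding has_improper_levy_integral_def by blast
  have scattered: "indep_scattered M Lam" and zero: "AE \<omega> in M. Lam {0} \<omega> = 0"
    and ivl: "\<And>a b. 0 \<le> a \<Longrightarrow> a \<le> b \<Longrightarrow> AE \<omega> in M. Lam {a<..b} \<omega> = \<eta> b \<omega> - \<eta> a \<omega>"
    using L by (auto simp: induced_random_measure_def)
  interpret scattered_measure M Lam by unfold_locales (rule scattered)
  have Xm[measurable]: "X \<in> borel_measurable M" using conv by (simp add: tendsto_in_prob_def)
  then show "X \<in> borel_measurable M" .
  have char_ivl: "char_rv M (Lam {a<..b}) z = exp (of_real (b - a) * \<Psi> z)" if "0 \<le> a" "a \<le> b" for a b z
  proof -
    have "{a<..b} \<in> bounded_borel"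
      using that by (auto simp: bounded_borel_def intro: bounded_subset[OF bounded_closed_interval[of a b]])
    then have "char_rv M (Lam {a<..b}) z = char_rv M (\<lambda>\<omega>. \<eta> b \<omega> - \<eta> a \<omega>) z"
      using that by (intro char_distr_cong_AE indep_scattered_measurable ivl borel_measurable_diff rv) auto
    then show ?thesis using char_increment[OF levy_process_axioms trip that] by simp
  qed
  have charL: "char_rv M (Lam A) z = exp (of_real (measure lborel A) * \<Psi> z)" if "A \<in> bounded_borel" for A z
    by (rule char_random_measure[OF zero char_ivl that])
  obtain T where T: "0 < T" "E \<subseteq> {0..T}" by (rule bounded_borel_subset_Icc[OF E])
  have Eb: "E \<in> sets borel" "emeasure lborel E < \<infinity>" using bounded_borel_emeasure[OF E] by auto
  interpret D: real_distribution "distr M borel X" by simp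
  show "char_fun (\<lambda>z. char_rv M X z / exp (?F E z))"
  proof (rule char_fun_limit)
    show "char_fun (\<lambda>z. char_rv M (J (T + real n)) z / exp (?F E z))" for n
      using T by (intro char_fun_quotient_random_integral[OF charL cont f J Eb(1) _ m]) auto
    fix z
    have "filterlim (\<lambda>n. T + real n) at_top sequentially"
      by (intro filterlim_tendsto_add_at_top[OF tendsto_const] filterlim_real_sequentially)
    then have "(\<lambda>n. char_rv M (J (T + real n)) z) \<longlonglongrightarrow> char_rv M X z"
      by (rule filterlim_compose[OF char_tendsto_in_prob[OF prob_space_axioms conv]])
    then show "(\<lambda>n. char_rv M (J (T + real n)) z / exp (?F E z))
        \<longlonglongrightarrow> char_rv M X z / exp (?F E z)"
      by (intro tendsto_intros) auto
  next
    show "isCont (\<lambda>z. char_rv M X z / exp (?F E z)) 0"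
      by (intro continuous_divide continuous_exp D.isCont_char isCont_exponent_integral[OF cont Eb f m]) auto
  qed
qed

section \<open>Square integrable characteristic functions\<close>

lemma char_uminus: "real_distribution \<mu> \<Longrightarrow> char \<mu> (- z) = cnj (char \<mu> z)"
  by (simp add: complex_eq_iff Re_char Im_char)

text \<open>
  The overlap of two Gaussian bumps is a convolution of Gaussians, so it is a Gaussian with variance
  \<open>2 * h\<^sup>2\<close> in the distance of the centres.
\<close>

lemma normal_overlap:
  assumes h: "0 < h"
  shows "(\<integral>\<^sup>+x. ennreal (normal_density 0 h (x - y)) * ennreal (normal_density 0 h (x - y')) \<partial>lborel)
    = ennreal (normal_density 0 (sqrt (h\<^sup>2 + h\<^sup>2)) (y - y'))"
proof -
  have "(\<integral>\<^sup>+x. ennreal (normal_density 0 h (x - y)) * ennreal (normal_density 0 h (x - y')) \<partial>lborel)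
      = (\<integral>\<^sup>+x. ennreal (normal_density 0 h ((y' + 1 * x) - y)) * ennreal (normal_density 0 h ((y' + 1 * x) - y')) \<partial>lborel)"
    by (subst nn_integral_real_affine[where c=1 and t=y']) auto
  also have "\<dots> = (\<integral>\<^sup>+x. ennreal (normal_density 0 h ((y - y') - x) * normal_density 0 h x) \<partial>lborel)"
  proof (intro nn_integral_cong)
    fix x
    have "normal_density 0 h ((y' + 1 * x) - y) = normal_density 0 h ((y - y') - x)"
      by (simp add: normal_density_def power2_commute algebra_simps)
    then show "ennreal (normal_density 0 h ((y' + 1 * x) - y)) * ennreal (normal_density 0 h ((y' + 1 * x) - y'))
        = ennreal (normal_density 0 h ((y - y') - x) * normal_density 0 h x)"
      by (simp add: ennreal_mult)
  qed
  also have "\<dots> = ennreal (normal_density 0 (sqrt (h\<^sup>2 + h\<^sup>2)) (y - y'))"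
    using conv_normal_density_zero_mean[OF h h] by (rule fun_cong)
  finally show ?thesis .
qed

text \<open>
  The left-hand side is the expectation of the normal density at \<open>Y - Y'\<close> for independent \<open>Y\<close> and
  \<open>Y'\<close> with law \<open>\<mu>\<close>. The characteristic function of \<open>Y - Y'\<close> is \<open>\<bar>char \<mu> z\<bar>\<^sup>2\<close>, and \<open>char_parseval\<close> expresses the expectation as
  a Gaussian average of it.
\<close>

lemma normal_energy_le:
  assumes \<mu>: "real_distribution \<mu>" and int: "integrable lborel (\<lambda>z. (norm (char \<mu> z))\<^sup>2)" and \<tau>: "0 < \<tau>"
  shows "(\<integral>\<^sup>+y. \<integral>\<^sup>+y'. ennreal (normal_density 0 \<tau> (y - y')) \<partial>\<mu> \<partial>\<mu>)
    \<le> ennreal ((LINT z|lborel. (norm (char \<mu> z))\<^sup>2) / (2 * pi))"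
proof -
  interpret A: real_distribution \<mu> by fact
  \<comment> \<open>The law \<open>s\<close> below is that of the difference of two independent copies.\<close>
  define \<mu>' where "\<mu>' = distr \<mu> borel (\<lambda>x. -1 * x)"
  have \<mu>': "real_distribution \<mu>'" unfolding \<mu>'_def by simp
  interpret A': real_distribution \<mu>' by (rule \<mu>')
  define s where "s = (\<mu> \<star> \<mu>')"
  have s: "real_distribution s" unfolding s_def by (rule real_distribution_convolution[OF \<mu> \<mu>'])
  interpret S: real_distribution s by (rule s)
  have char': "char \<mu>' z = cnj (char \<mu> z)" for z
    unfolding \<mu>'_def by (subst char_distr_times[OF \<mu>]) (simp add: char_uminus[OF \<mu>])
  have char_s: "char s z = of_real ((norm (char \<mu> z))\<^sup>2)" for z
    unfolding s_def char_convolution[OF \<mu> \<mu>'] char' complex_norm_square ..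
  let ?q = "\<lambda>z. (norm (char \<mu> z))\<^sup>2"
  have qm[measurable]: "?q \<in> borel_measurable borel" by measurable
  have "(\<integral>\<^sup>+y. \<integral>\<^sup>+y'. ennreal (normal_density 0 \<tau> (y - y')) \<partial>\<mu> \<partial>\<mu>)
      = (\<integral>\<^sup>+x. ennreal (normal_density 0 \<tau> x) \<partial>s)"
    unfolding s_def
    by (subst nn_integral_convolution[OF A.finite_measure_axioms A'.finite_measure_axioms])
       (auto simp: \<mu>'_def nn_integral_distr)
  also have "\<dots> = ennreal (LINT x|s. normal_density 0 \<tau> x)"
  proof (intro nn_integral_eq_integral)
    show "integrable s (normal_density 0 \<tau>)"
    proof (rule S.integrable_const_bound[where B="1 / (sqrt (2 * pi * \<tau>\<^sup>2))"])
      show "AE x in s. norm (normal_density 0 \<tau> x) \<le> 1 / sqrt (2 * pi * \<tau>\<^sup>2)"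
        by (auto simp: normal_density_def divide_right_mono)
    qed measurable
  qed auto
  also have "(LINT x|s. normal_density 0 \<tau> x) = (1 / (\<tau> * sqrt (2 * pi))) * (LINT x|s. exp (- (1 / \<tau> * x)\<^sup>2 / 2))"
    using \<tau> by (simp add: normal_density_def power_divide real_sqrt_mult mult.commute)
  also have "(LINT x|s. exp (- (1 / \<tau> * x)\<^sup>2 / 2)) = (LINT z|std_normal_distribution. ?q (1 / \<tau> * z))"
  proof -
    have "complex_of_real (LINT z|std_normal_distribution. ?q (1 / \<tau> * z))
        = complex_of_real (LINT x|s. exp (- (1 / \<tau> * x)\<^sup>2 / 2))"
      using char_parseval[OF s real_dist_normal_dist, of "1 / \<tau>"]
      unfolding char_s char_std_normal_distribution integral_complex_of_real .
    then show ?thesis by (simp only: of_real_eq_iff)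
  qed
  also have "(LINT z|std_normal_distribution. ?q (1 / \<tau> * z)) = (LINT z|lborel. std_normal_density z * ?q (1 / \<tau> * z))"
    by (subst integral_density) auto
  also have "\<dots> \<le> (LINT z|lborel. (1 / sqrt (2 * pi)) * ?q (1 / \<tau> * z))"
  proof (rule integral_mono)
    have "integrable lborel (\<lambda>z. ?q (0 + 1 / \<tau> * z))"
      using int \<tau> by (intro lborel_integrable_real_affine) auto
    then show i2: "integrable lborel (\<lambda>z. (1 / sqrt (2 * pi)) * ?q (1 / \<tau> * z))"
      by (intro integrable_mult_right) simp
    have le: "std_normal_density z * ?q (1 / \<tau> * z) \<le> (1 / sqrt (2 * pi)) * ?q (1 / \<tau> * z)" for z
      by (intro mult_right_mono) (auto simp: std_normal_density_def divide_right_mono)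
    then show "std_normal_density z * ?q (1 / \<tau> * z) \<le> (1 / sqrt (2 * pi)) * ?q (1 / \<tau> * z)" for z .
    show "integrable lborel (\<lambda>z. std_normal_density z * ?q (1 / \<tau> * z))"
      by (rule Bochner_Integration.integrable_bound[OF i2]) (use le in \<open>auto intro!: AE_I2\<close>)
  qed
  also have "\<dots> = (1 / sqrt (2 * pi)) * (\<tau> * (LINT z|lborel. ?q z))"
    using \<tau> lborel_integral_real_affine[of "1 / \<tau>" ?q 0] by simp
  finally have "(\<integral>\<^sup>+y. \<integral>\<^sup>+y'. ennreal (normal_density 0 \<tau> (y - y')) \<partial>\<mu> \<partial>\<mu>)
      \<le> ennreal ((1 / (\<tau> * sqrt (2 * pi))) * ((1 / sqrt (2 * pi)) * (\<tau> * (LINT z|lborel. ?q z))))"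
    using \<tau> by (simp add: ennreal_leI mult_left_mono divide_right_mono)
  also have "(1 / (\<tau> * sqrt (2 * pi))) * ((1 / sqrt (2 * pi)) * (\<tau> * (LINT z|lborel. ?q z))) = (LINT z|lborel. ?q z) / (2 * pi)"
    using \<tau> by (simp add: field_simps)
  finally show ?thesis .
qed

abbreviation smoothed_mass :: "real measure \<Rightarrow> real set \<Rightarrow> nat \<Rightarrow> ennreal" where
  "smoothed_mass \<mu> U k \<equiv>
    \<integral>\<^sup>+y. \<integral>\<^sup>+z. indicator U (y + z / Suc k) \<partial>std_normal_distribution \<partial>\<mu>"

text \<open>
  A point of an open set stays in it under small perturbations, so this is Fatou's lemma applied twice.
\<close>

lemma emeasure_open_le_smoothed:
  assumes \<mu>: "real_distribution \<mu>" and U: "open U"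
  shows "emeasure \<mu> U \<le> liminf (smoothed_mass \<mu> U)"
proof -
  interpret A: real_distribution \<mu> by fact
  interpret N: real_distribution std_normal_distribution by (rule real_dist_normal_dist)
  have [measurable]: "U \<in> sets borel" using U by simp
  have pt: "indicator U y \<le> liminf (\<lambda>k. indicator U (y + z / Suc k) :: ennreal)" for y z :: real
  proof (cases "y \<in> U")
    case True
    have "(\<lambda>k. y + z / Suc k) \<longlonglongrightarrow> y + 0"
      by (intro tendsto_intros LIMSEQ_Suc[OF lim_const_over_n])
    then have "\<forall>\<^sub>F k in sequentially. y + z / Suc k \<in> U"
      using topological_tendstoD[OF _ U, of "\<lambda>k. y + z / Suc k" y sequentially] True by simp
    then have "\<forall>\<^sub>F k in sequentially. 1 \<le> (indicator U (y + z / Suc k) :: ennreal)"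
      by eventually_elim simp
    then show ?thesis using True by (intro Liminf_bounded) (auto elim: eventually_mono)
  qed simp
  have "emeasure \<mu> U = (\<integral>\<^sup>+y. \<integral>\<^sup>+z. indicator U y \<partial>std_normal_distribution \<partial>\<mu>)"
    using N.emeasure_space_1 by (simp del: N.space_eq_univ)
  also have "\<dots> \<le> (\<integral>\<^sup>+y. \<integral>\<^sup>+z. liminf (\<lambda>k. indicator U (y + z / Suc k)) \<partial>std_normal_distribution \<partial>\<mu>)"
    by (intro nn_integral_mono pt)
  also have "\<dots> \<le> (\<integral>\<^sup>+y. liminf (\<lambda>k. \<integral>\<^sup>+z. indicator U (y + z / Suc k) \<partial>std_normal_distribution) \<partial>\<mu>)"
    by (intro nn_integral_mono nn_integral_liminf) measurable
  also have "\<dots> \<le> liminf (smoothed_mass \<mu> U)"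
    by (intro nn_integral_liminf) measurable
  finally show ?thesis .
qed

text \<open>
  Young's inequality \<open>p \<le> a / 2 + p\<^sup>2 / (2 * a)\<close>, in a form that also covers \<open>p = \<infinity>\<close>.
\<close>

lemma ennreal_le_square:
  fixes p :: ennreal
  assumes "0 < a"
  shows "p \<le> ennreal (a / 2) + ennreal (1 / (2 * a)) * (p * p)"
proof (cases p)
  case (real r)
  have "0 \<le> (r - a)\<^sup>2 / (2 * a)" using assms by simp
  also have "(r - a)\<^sup>2 / (2 * a) = a / 2 + 1 / (2 * a) * (r * r) - r"
    using assms by (simp add: field_simps power2_eq_square)
  finally have "r \<le> a / 2 + 1 / (2 * a) * (r * r)" by simp
  then have "ennreal r \<le> ennreal (a / 2 + 1 / (2 * a) * (r * r))" by (rule ennreal_leI)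
  then show ?thesis using real assms by (simp add: ennreal_mult[symmetric] ennreal_plus[symmetric] del: ennreal_plus)
next
  case top
  then show ?thesis using assms by (simp add: ennreal_mult_top ennreal_top_mult)
qed

text \<open>
  The convolution of \<open>\<mu>\<close> with a centred normal distribution of deviation \<open>h\<close> has a density \<open>p\<close>, and the
  integral of \<open>p\<^sup>2\<close> is bounded uniformly in \<open>h\<close> by \<open>normal_overlap\<close> and \<open>normal_energy_le\<close>. Young's inequality then bounds the
  mass which the smoothed law gives to \<open>U\<close>, and \<open>emeasure_open_le_smoothed\<close> removes the smoothing.
\<close>

lemma emeasure_open_le_char_L2:
  assumes \<mu>: "real_distribution \<mu>" and int: "integrable lborel (\<lambda>z. (norm (char \<mu> z))\<^sup>2)"
    and U: "open U" and a: "0 < a"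
  shows "emeasure \<mu> U \<le> ennreal (a / 2) * emeasure lborel U
    + ennreal (1 / (2 * a)) * ennreal ((LINT z|lborel. (norm (char \<mu> z))\<^sup>2) / (2 * pi))"
    (is "_ \<le> ?R")
proof -
  interpret A: real_distribution \<mu> by fact
  interpret AL: pair_sigma_finite \<mu> lborel ..
  have [measurable]: "U \<in> sets borel" using U by simp
  have "smoothed_mass \<mu> U k \<le> ?R" for k
  proof -
    define h where "h = 1 / real (Suc k)"
    have h: "0 < h" by (simp add: h_def)
    let ?n = "normal_density 0 h"
    \<comment> \<open>The density of the convolution of \<open>\<mu>\<close> with the normal distribution of deviation \<open>h\<close>.\<close>
    define p where "p x = (\<integral>\<^sup>+y. ennreal (?n (x - y)) \<partial>\<mu>)" for x
    have [measurable]: "p \<in> borel_measurable borel" unfolding p_def by measurable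
    have inner: "(\<integral>\<^sup>+z. indicator U (y + z / Suc k) \<partial>std_normal_distribution) = (\<integral>\<^sup>+x. indicator U x * ennreal (?n (x - y)) \<partial>lborel)" for y
    proof -
      have "(\<integral>\<^sup>+x. indicator U x * ennreal (?n (x - y)) \<partial>lborel)
          = ennreal \<bar>h\<bar> * (\<integral>\<^sup>+z. indicator U (y + h * z) * ennreal (?n ((y + h * z) - y)) \<partial>lborel)"
        using h by (intro nn_integral_real_affine) auto
      also have "\<dots> = (\<integral>\<^sup>+z. ennreal \<bar>h\<bar> * (indicator U (y + h * z) * ennreal (?n ((y + h * z) - y))) \<partial>lborel)"
        by (intro nn_integral_cmult[symmetric]) measurable
      also have "\<dots> = (\<integral>\<^sup>+z. ennreal (std_normal_density z) * indicator U (y + z / Suc k) \<partial>lborel)"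
      proof (intro nn_integral_cong)
        fix z
        have "sqrt (2 * pi * h\<^sup>2) = sqrt (2 * pi) * h" "(h * z)\<^sup>2 / (2 * h\<^sup>2) = z\<^sup>2 / 2"
          using h by (simp_all add: real_sqrt_mult power_mult_distrib)
        then have "h * ?n (h * z) = std_normal_density z"
          using h by (simp add: normal_density_def)
        then have n: "ennreal h * ennreal (?n (h * z)) = ennreal (std_normal_density z)"
          using h by (simp add: ennreal_mult[symmetric])
        have e: "h * z = z / Suc k" by (simp add: h_def)
        have "ennreal \<bar>h\<bar> * (indicator U (y + h * z) * ennreal (?n ((y + h * z) - y)))
            = (ennreal h * ennreal (?n (h * z))) * indicator U (y + h * z)"
          using h by (simp add: ac_simps)
        also have "\<dots> = ennreal (std_normal_density z) * indicator U (y + h * z)"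
          by (simp only: n)
        also have "\<dots> = ennreal (std_normal_density z) * indicator U (y + z / Suc k)"
          by (simp only: e)
        finally show "ennreal \<bar>h\<bar> * (indicator U (y + h * z) * ennreal (?n ((y + h * z) - y)))
            = ennreal (std_normal_density z) * indicator U (y + z / Suc k)" .
      qed
      also have "\<dots> = (\<integral>\<^sup>+z. indicator U (y + z / Suc k) \<partial>std_normal_distribution)"
        by (intro nn_integral_density[symmetric]) measurable
      finally show ?thesis ..
    qed
    have "smoothed_mass \<mu> U k
        = (\<integral>\<^sup>+y. \<integral>\<^sup>+x. indicator U x * ennreal (?n (x - y)) \<partial>lborel \<partial>\<mu>)"
      by (simp only: inner)
    also have "\<dots> = (\<integral>\<^sup>+x. \<integral>\<^sup>+y. indicator U x * ennreal (?n (x - y)) \<partial>\<mu> \<partial>lborel)"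
      by (rule AL.Fubini'[symmetric]) measurable
    also have "\<dots> = (\<integral>\<^sup>+x. indicator U x * p x \<partial>lborel)"
      unfolding p_def by (intro nn_integral_cong nn_integral_cmult) measurable
    also have "\<dots> \<le> (\<integral>\<^sup>+x. ennreal (a / 2) * indicator U x + ennreal (1 / (2 * a)) * (p x * p x) \<partial>lborel)"
    proof (intro nn_integral_mono)
      fix x
      show "indicator U x * p x \<le> ennreal (a / 2) * indicator U x + ennreal (1 / (2 * a)) * (p x * p x)"
        using ennreal_le_square[OF a, of "p x"] by (cases "x \<in> U") simp_all
    qed
    also have "\<dots> = ennreal (a / 2) * emeasure lborel U + ennreal (1 / (2 * a)) * (\<integral>\<^sup>+x. p x * p x \<partial>lborel)"
      by (subst nn_integral_add) (auto simp: nn_integral_cmult nn_integral_cmult_indicator)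
    also have "\<dots> \<le> ?R"
    proof (intro add_left_mono mult_left_mono)
      have "(\<integral>\<^sup>+x. p x * p x \<partial>lborel) = (\<integral>\<^sup>+x. \<integral>\<^sup>+y. p x * ennreal (?n (x - y)) \<partial>\<mu> \<partial>lborel)"
        unfolding p_def by (intro nn_integral_cong nn_integral_cmult[symmetric]) measurable
      also have "\<dots> = (\<integral>\<^sup>+y. \<integral>\<^sup>+x. p x * ennreal (?n (x - y)) \<partial>lborel \<partial>\<mu>)"
        by (rule AL.Fubini') measurable
      also have "\<dots> = (\<integral>\<^sup>+y. \<integral>\<^sup>+x. \<integral>\<^sup>+y'. ennreal (?n (x - y)) * ennreal (?n (x - y')) \<partial>\<mu> \<partial>lborel \<partial>\<mu>)"
        unfolding p_def by (intro nn_integral_cong, subst nn_integral_cmult) (auto simp: mult.commute)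
      also have "\<dots> = (\<integral>\<^sup>+y. \<integral>\<^sup>+y'. \<integral>\<^sup>+x. ennreal (?n (x - y)) * ennreal (?n (x - y')) \<partial>lborel \<partial>\<mu> \<partial>\<mu>)"
        by (intro nn_integral_cong AL.Fubini') measurable
      also have "\<dots> = (\<integral>\<^sup>+y. \<integral>\<^sup>+y'. ennreal (normal_density 0 (sqrt (h\<^sup>2 + h\<^sup>2)) (y - y')) \<partial>\<mu> \<partial>\<mu>)"
        by (simp only: normal_overlap[OF h])
      also have "\<dots> \<le> ennreal ((LINT z|lborel. (norm (char \<mu> z))\<^sup>2) / (2 * pi))"
        using h by (intro normal_energy_le[OF \<mu> int]) (auto intro: add_pos_pos)
      finally show "(\<integral>\<^sup>+x. p x * p x \<partial>lborel) \<le> ennreal ((LINT z|lborel. (norm (char \<mu> z))\<^sup>2) / (2 * pi))" .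
    qed simp
    finally show ?thesis .
  qed
  then have "liminf (smoothed_mass \<mu> U) \<le> liminf (\<lambda>_::nat. ?R)"
    by (intro Liminf_mono always_eventually allI)
  also have "\<dots> = ?R" by (rule Liminf_const) simp
  finally have "liminf (smoothed_mass \<mu> U) \<le> ?R" .
  then show ?thesis using emeasure_open_le_smoothed[OF \<mu> U] by (rule order_trans[rotated])
qed

text \<open>
  A null set has open neighbourhoods of arbitrarily small Lebesgue measure; in \<open>emeasure_open_le_char_L2\<close> first choose
  \<open>a\<close> large and then the neighbourhood small.
\<close>

lemma absolutely_continuous_if_char_L2:
  assumes \<mu>: "real_distribution \<mu>" and int: "integrable lborel (\<lambda>z. (norm (char \<mu> z))\<^sup>2)"
  shows "absolutely_continuous lborel \<mu>"
  unfolding absolutely_continuous_def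
proof
  fix B :: "real set" assume B: "B \<in> null_sets lborel"
  interpret A: real_distribution \<mu> by fact
  define C where "C = (LINT z|lborel. (norm (char \<mu> z))\<^sup>2) / (2 * pi)"
  have C: "0 \<le> C" unfolding C_def by (intro divide_nonneg_pos integral_nonneg_AE) auto
  have "emeasure \<mu> B \<le> 0 + ennreal e" if e: "0 < e" for e
  proof -
    have Bm: "B \<in> sets borel" using B by auto
    \<comment> \<open>Then \<open>C / (2 * a) \<le> e / 2\<close>; the summand 1 keeps \<open>a\<close> positive when \<open>C = 0\<close>.\<close>
    define a where "a = (C + 1) / e"
    have a: "0 < a" using C e by (simp add: a_def)
    obtain U where U: "open U" "B \<subseteq> U" "emeasure lborel (U - B) < ennreal (e / a)"
      by (rule outer_regular_lborel[OF Bm divide_pos_pos[OF e a]])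
    have "emeasure lborel U \<le> emeasure lborel B + emeasure lborel (U - B)"
    proof -
      have "U = B \<union> (U - B)" using U(2) by auto
      moreover have "emeasure lborel (B \<union> (U - B)) \<le> emeasure lborel B + emeasure lborel (U - B)"
        using Bm U(1) by (intro emeasure_subadditive) auto
      ultimately show ?thesis by simp
    qed
    then have "emeasure lborel U \<le> emeasure lborel (U - B)" using B by (simp add: null_setsD1)
    then have Ule: "emeasure lborel U \<le> ennreal (e / a)" using U(3) by (rule order.strict_implies_order[OF le_less_trans])
    have 1: "ennreal (a / 2) * emeasure lborel U \<le> ennreal (e / 2)"
    proof -
      from Ule have "ennreal (a / 2) * emeasure lborel U \<le> ennreal (a / 2) * ennreal (e / a)" by (rule mult_left_mono) simp
      also have "\<dots> = ennreal (e / 2)" using a e by (simp add: ennreal_mult[symmetric])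
      finally show ?thesis .
    qed
    have "1 / (2 * a) * C \<le> e / 2" using C e by (simp add: a_def field_simps)
    then have 2: "ennreal (1 / (2 * a)) * ennreal C \<le> ennreal (e / 2)"
      using a C by (simp add: ennreal_mult[symmetric] ennreal_leI)
    have "emeasure \<mu> B \<le> emeasure \<mu> U" using U by (intro emeasure_mono) auto
    also have "\<dots> \<le> ennreal (a / 2) * emeasure lborel U + ennreal (1 / (2 * a)) * ennreal C"
      unfolding C_def by (rule emeasure_open_le_char_L2[OF \<mu> int U(1) a])
    also have "\<dots> \<le> ennreal (e / 2) + ennreal (e / 2)" using 1 2 by (rule add_mono)
    also have "\<dots> = ennreal e" using e by (simp add: ennreal_plus[symmetric] del: ennreal_plus)
    finally show ?thesis by simp
  qed
  then have "emeasure \<mu> B \<le> 0" by (rule ennreal_le_epsilon)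
  then show "B \<in> null_sets \<mu>" using B by (auto simp: null_sets_def)
qed

section \<open>Absolute continuity from a convolution factor\<close>

text \<open>
  Used to replace an integrand that is measurable only on the half-line by its extension by \<open>0\<close>.
\<close>

lemma has_improper_levy_integral_cong:
  assumes "\<And>s. 0 \<le> s \<Longrightarrow> f s = f' s"
  shows "has_improper_levy_integral M \<eta> f X \<longleftrightarrow> has_improper_levy_integral M \<eta> f' X"
proof -
  have "(s \<in> {0..t} \<longrightarrow> (\<lambda>n. g n s) \<longlonglongrightarrow> f s) \<longleftrightarrow> (s \<in> {0..t} \<longrightarrow> (\<lambda>n. g n s) \<longlonglongrightarrow> f' s)" for g :: "nat \<Rightarrow> real \<Rightarrow> real" and s t
    using assms by auto
  then have "has_random_integral M Lam f t J \<longleftrightarrow> has_random_integral M Lam f' t J" for Lam t J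
    unfolding has_random_integral_def by (simp only:)
  then show ?thesis unfolding has_improper_levy_integral_def by (simp only:)
qed

lemma convolution_factor:
  assumes "real_distribution \<mu>" "real_distribution \<rho>" "char_fun \<phi>"
    and "\<And>z. char \<mu> z = char \<rho> z * \<phi> z"
  shows "\<exists>\<kappa>. real_distribution \<kappa> \<and> \<mu> = (\<kappa> \<star> \<rho>)"
proof -
  obtain \<kappa> where \<kappa>: "real_distribution \<kappa>" "char \<kappa> = \<phi>"
    using assms(3) unfolding char_fun_def by blast
  have "char \<mu> = char (\<kappa> \<star> \<rho>)"
    using assms \<kappa> by (auto simp: char_convolution)
  then have "\<mu> = (\<kappa> \<star> \<rho>)"
    using assms \<kappa> by (intro Levy_uniqueness real_distribution_convolution)
  then show ?thesis using \<kappa>(1) by blast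
qed

lemma null_sets_times_vimage:
  fixes c :: real
  assumes "c \<noteq> 0" "B \<in> null_sets lborel"
  shows "{x. c * x \<in> B} \<in> null_sets lborel"
proof -
  have B[measurable]: "B \<in> sets borel" using assms(2) by auto
  have "emeasure lborel {x. c * x \<in> B} = emeasure (distr lborel borel ((*) c)) B"
    by (subst emeasure_distr) (auto simp: vimage_def)
  also have "\<dots> = emeasure (density lborel (\<lambda>_. inverse \<bar>c\<bar>)) B"
    using assms(1) by (simp add: lborel_distr_mult)
  also have "\<dots> = 0"
    using assms(2) by (simp add: emeasure_density nn_integral_cmult_indicator null_setsD1)
  finally show ?thesis by (intro null_setsI) auto
qed

text \<open>
  The factor that belongs to \<open>E = {a<..<a + b}\<close> has characteristic function \<open>exp (b * \<Psi> (z * c))\<close>, which is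
  that of \<open>c * \<eta> b\<close>.
\<close>

lemma (in levy_integral) abs_cont_rv_constant_piece:
  assumes b: "0 < b" and ac: "abs_cont_rv M (\<eta> b)" and a: "0 \<le> a" and c: "c \<noteq> 0"
    and const: "\<And>s. s \<in> {a<..<a + b} \<Longrightarrow> f s = c"
  shows "abs_cont_rv M X"
proof -
  let ?E = "{a<..<a + b}"
  have E: "?E \<in> bounded_borel"
    using a by (auto simp: bounded_borel_def intro: bounded_subset[OF bounded_closed_interval[of a "a + b"]])
  note quot = char_fun_quotient_improper_integral[OF E, of "\<bar>c\<bar>"]
  have Xm[measurable]: "X \<in> borel_measurable M" using const by (intro quot(1)) auto
  have \<eta>m[measurable]: "\<eta> b \<in> borel_measurable M" using b by (intro rv) auto
  define \<rho> where "\<rho> = distr (distr M borel (\<eta> b)) borel (\<lambda>x. c * x)"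
  interpret N: real_distribution "distr M borel (\<eta> b)" by simp
  have \<rho>: "real_distribution \<rho>" unfolding \<rho>_def by simp
  have int: "(CLINT s:?E|lborel. \<Psi> (z * f s)) = of_real b * \<Psi> (z * c)" for z
  proof -
    have "(CLINT s:?E|lborel. \<Psi> (z * f s)) = (CLINT s:?E|lborel. \<Psi> (z * c))"
      using const by (intro set_lebesgue_integral_cong) auto
    also have "\<dots> = of_real b * \<Psi> (z * c)"
      using b by (simp add: set_lebesgue_integral_def scaleR_conv_of_real)
    finally show ?thesis .
  qed
  have char_\<rho>: "char \<rho> z = exp (of_real b * \<Psi> (z * c))" for z
    unfolding \<rho>_def using trip b
    by (simp add: char_distr_times N.real_distribution_axioms has_char_triplet_def)
  have "char_rv M X z = char \<rho> z * (char_rv M X z / exp (CLINT s:?E|lborel. \<Psi> (z * f s)))" for z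
    by (simp add: char_\<rho> int)
  then obtain \<kappa> where \<kappa>: "real_distribution \<kappa>" "distr M borel X = (\<kappa> \<star> \<rho>)"
    using convolution_factor[OF real_distribution_distr[OF Xm] \<rho> quot(2)] const by auto
  have "emeasure (\<kappa> \<star> \<rho>) B \<le> 0" if B: "B \<in> null_sets lborel" for B
  proof (rule null_mass_convolution[OF \<kappa>(1) \<rho> _ B])
    fix B' :: "real set" assume B': "B' \<in> null_sets lborel"
    have "{x. c * x \<in> B'} \<in> null_sets (distr M borel (\<eta> b))"
      using ac null_sets_times_vimage[OF c B'] by (auto simp: abs_cont_rv_def absolutely_continuous_def)
    then show "emeasure \<rho> B' \<le> 0"
      using B' unfolding \<rho>_def by (subst emeasure_distr) (auto simp: vimage_def null_setsD1)
  qed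
  then show ?thesis
    unfolding abs_cont_rv_def absolutely_continuous_def \<kappa>(2) by (auto simp: null_sets_def)
qed

text \<open>
  The pieces of the support of \<open>f\<close> to which the factorisation applies, and on which \<open>f\<close> stays away from
  \<open>0\<close>; their lengths approach the length of the support.
\<close>

lemma finite_piece_of_support:
  fixes f :: "real \<Rightarrow> real"
  assumes f[measurable]: "f \<in> borel_measurable borel"
  defines "E \<equiv> \<lambda>n. {s \<in> {0..real n}. 1 / Suc n \<le> \<bar>f s\<bar> \<and> \<bar>f s\<bar> \<le> real n}"
  shows "E n \<in> bounded_borel" and "incseq E"
    and "(SUP n. emeasure lborel (E n)) = emeasure lborel {s \<in> {0..}. f s \<noteq> 0}"
proof -
  have m: "E n \<in> sets borel" for n unfolding E_def by measurable
  show "E n \<in> bounded_borel"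
    using m by (auto simp: bounded_borel_def E_def intro: bounded_subset[OF bounded_closed_interval[of 0 "real n"]])
  show inc: "incseq E"
  proof (rule incseq_SucI)
    fix n
    have "1 / real (Suc (Suc n)) \<le> 1 / real (Suc n)" by (intro divide_left_mono) auto
    then show "E n \<subseteq> E (Suc n)" by (auto simp: E_def)
  qed
  have "(\<Union>n. E n) = {s \<in> {0..}. f s \<noteq> 0}"
  proof (intro equalityI subsetI)
    fix s assume s: "s \<in> {s \<in> {0..}. f s \<noteq> 0}"
    obtain i where i: "max s \<bar>f s\<bar> \<le> real i" using real_arch_simple by blast
    obtain j where j: "1 / real (Suc j) < \<bar>f s\<bar>"
      using s reals_Archimedean[of "\<bar>f s\<bar>"] by (auto simp: inverse_eq_divide)
    have "1 / real (Suc (max i j)) \<le> 1 / real (Suc j)" by (intro divide_left_mono) auto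
    then have "s \<in> E (max i j)" using s i j unfolding E_def by auto
    then show "s \<in> (\<Union>n. E n)" by blast
  next
    fix s assume "s \<in> (\<Union>n. E n)"
    then obtain n where n: "s \<in> {0..real n}" "1 / Suc n \<le> \<bar>f s\<bar>" by (auto simp: E_def)
    have "0 < 1 / real (Suc n)" by simp
    with n(2) have "f s \<noteq> 0" by linarith
    with n(1) show "s \<in> {s \<in> {0..}. f s \<noteq> 0}" by simp
  qed
  then show "(SUP n. emeasure lborel (E n)) = emeasure lborel {s \<in> {0..}. f s \<noteq> 0}"
    using m inc by (subst SUP_emeasure_incseq) auto
qed

abbreviation normalised_restriction :: "real measure \<Rightarrow> real set \<Rightarrow> real \<Rightarrow> real measure" where
  "normalised_restriction \<mu> S v \<equiv> density \<mu> (\<lambda>x. ennreal (indicator S x / v))"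

lemma normalised_restriction:
  fixes h :: "real \<Rightarrow> 'b :: {banach, second_countable_topology}"
  assumes sets[measurable_cong]: "sets \<mu> = sets borel" and S[measurable]: "S \<in> sets borel"
    and v: "0 < v" "emeasure \<mu> S = ennreal v"
  shows "A \<in> sets borel \<Longrightarrow> emeasure (normalised_restriction \<mu> S v) A = emeasure \<mu> (S \<inter> A) / ennreal v"
    and "prob_space (normalised_restriction \<mu> S v)"
    and "h \<in> borel_measurable borel \<Longrightarrow> set_integrable \<mu> S h \<Longrightarrow> integrable (normalised_restriction \<mu> S v) h"
    and "h \<in> borel_measurable borel \<Longrightarrow>
      integral\<^sup>L (normalised_restriction \<mu> S v) h = (1 / v) *\<^sub>R (LINT x:S|\<mu>. h x)"
proof -
  show em: "emeasure (normalised_restriction \<mu> S v) A = emeasure \<mu> (S \<inter> A) / ennreal v"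
    if [measurable]: "A \<in> sets borel" for A
  proof -
    have "emeasure (normalised_restriction \<mu> S v) A = (\<integral>\<^sup>+x. ennreal (1 / v) * indicator (S \<inter> A) x \<partial>\<mu>)"
      by (subst emeasure_density) (auto simp: sets intro!: nn_integral_cong split: split_indicator)
    then show ?thesis
      using v sets by (simp add: nn_integral_cmult_indicator divide_ennreal_def inverse_ennreal mult.commute inverse_eq_divide)
  qed
  have "space \<mu> = UNIV" using sets_eq_imp_space_eq[OF sets] by simp
  then show "prob_space (normalised_restriction \<mu> S v)"
    using em[of UNIV] v by (intro prob_spaceI) (simp add: ennreal_divide_self)
  assume [measurable]: "h \<in> borel_measurable borel"
  have eq: "(indicator S x / v) *\<^sub>R h x = (1 / v) *\<^sub>R (indicator S x *\<^sub>R h x)" for x by simp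
  have "integral\<^sup>L (normalised_restriction \<mu> S v) h = (LINT x|\<mu>. (indicator S x / v) *\<^sub>R h x)"
    using v by (intro integral_density) (auto split: split_indicator)
  then show "integral\<^sup>L (normalised_restriction \<mu> S v) h = (1 / v) *\<^sub>R (LINT x:S|\<mu>. h x)"
    unfolding set_lebesgue_integral_def eq integral_scaleR_right .
  assume "set_integrable \<mu> S h"
  then show "integrable (normalised_restriction \<mu> S v) h"
    using v unfolding set_integrable_def
    by (subst integrable_density) (auto simp: eq split: split_indicator simp del: scaleR_scaleR)
qed

text \<open>
  Split the jumps with size in \<open>S\<close> off the exponent. Their contribution over \<open>E\<close> is the exponent of a
  compound Poisson distribution whose jumps are distributed as \<open>f s * x\<close>, where \<open>s\<close> is uniform on \<open>E\<close> and \<open>x\<close> has the normalised law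
  \<open>\<nu>\<close> on \<open>S\<close>; the hypothesis \<open>null\<close> makes this jump law absolutely continuous. The rest of the exponent, integrated over \<open>E\<close>,
  gives a characteristic function by \<open>char_fun_exponent_integral\<close>.
\<close>

lemma (in levy_integral) abs_cont_rv_null_bound:
  assumes E: "E \<in> bounded_borel" and m: "\<And>s. s \<in> E \<Longrightarrow> \<bar>f s\<bar> \<le> m" and E0: "0 < emeasure lborel E"
    and S[measurable]: "S \<in> sets borel" and d: "0 < d" "\<And>x. x \<in> S \<Longrightarrow> d \<le> \<bar>x\<bar>" and S0: "0 < emeasure \<nu> S"
    and null: "\<And>B. B \<in> null_sets lborel \<Longrightarrow> AE s in lborel. s \<in> E \<longrightarrow> emeasure \<nu> (S \<inter> {x. f s * x \<in> B}) = 0"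
    and B: "B \<in> null_sets lborel"
  shows "emeasure (distr M borel X) B \<le> ennreal (exp (- (measure lborel E * measure \<nu> S)))"
proof -
  note sets = sets_\<nu>
  have Em[measurable]: "E \<in> sets borel" and Efin: "emeasure lborel E < \<infinity>"
    using bounded_borel_emeasure[OF E] by auto
  define l where "l = measure lborel E"
  define v where "v = measure \<nu> S"
  have Sfin: "emeasure \<nu> S < \<infinity>" by (rule finite_levy_measure_away_from_0(1)[OF \<nu> S d])
  have le: "emeasure lborel E = ennreal l" and ve: "emeasure \<nu> S = ennreal v"
    using Efin Sfin by (auto simp: l_def v_def emeasure_eq_ennreal_measure)
  have l: "0 < l" and v: "0 < v" using E0 S0 by (auto simp: le ve)
  note cont = isCont_\<Psi>
  let ?\<nu>S = "restrict_measure \<nu> S"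
  have fin: "finite_measure ?\<nu>S" by (rule finite_levy_measure_away_from_0(2)[OF \<nu> S d])
  interpret FS: finite_measure ?\<nu>S by (rule fin)
  obtain \<gamma>' where split: "\<And>z. \<Psi> z = (CLINT x|?\<nu>S. iexp (z * x) - 1) + levy_exponent \<sigma>2 (restrict_measure \<nu> (- S)) \<gamma>' z"
    using levy_exponent_split[OF \<nu> S fin] by blast
  define \<xi> where "\<xi> z = (CLINT x|?\<nu>S. iexp (z * x) - 1)" for z
  define \<Psi>r where "\<Psi>r = levy_exponent \<sigma>2 (restrict_measure \<nu> (- S)) \<gamma>'"
  have \<nu>': "levy_measure (restrict_measure \<nu> (- S))"
    using S by (intro levy_measure_restrict[OF \<nu>]) auto
  have cont': "isCont \<Psi>r z" for z unfolding \<Psi>r_def by (rule isCont_levy_exponent[OF \<nu>'])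
  have split': "\<Psi> z = \<xi> z + \<Psi>r z" for z unfolding \<xi>_def \<Psi>r_def by (rule split)
  then have "\<xi> = (\<lambda>z. \<Psi> z - \<Psi>r z)" by auto
  then have cont\<xi>: "isCont \<xi> z" for z using cont cont' by auto
  \<comment> \<open>The uniform distribution on \<open>E\<close>, the normalised jump law on \<open>S\<close>, and the law of the product.\<close>
  define Q where "Q = normalised_restriction lborel E l"
  define N where "N = normalised_restriction \<nu> S v"
  note Qn = normalised_restriction[OF sets_lborel Em l le, folded Q_def]
  note Nn = normalised_restriction[OF sets S v ve, folded N_def]
  interpret Q: prob_space Q by (rule Qn(2))
  interpret N: prob_space N by (rule Nn(2))
  have [measurable_cong]: "sets Q = sets borel" "sets N = sets borel" by (simp_all add: Q_def N_def sets)
  interpret P: pair_prob_space Q N ..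
  define \<rho> where "\<rho> = distr (Q \<Otimes>\<^sub>M N) borel (\<lambda>(s, x). f s * x)"
  have \<rho>: "real_distribution \<rho>" unfolding \<rho>_def by (intro P.real_distribution_distr) measurable
  have charN: "char N u = 1 + \<xi> u / of_real v" for u
  proof -
    have int: "integrable N (\<lambda>x. iexp (u * x))" by (rule N.integrable_const_bound[where B=1]) auto
    have "char N u - 1 = (CLINT x|N. iexp (u * x) - 1)"
      unfolding char_def using int N.prob_space by (subst Bochner_Integration.integral_diff) auto
    also have "\<dots> = (1 / v) *\<^sub>R \<xi> u"
      unfolding \<xi>_def using sets by (subst Nn(4)) (auto simp: integral_restrict_measure)
    finally show ?thesis by (simp add: scaleR_conv_of_real algebra_simps)
  qed
  have int\<xi>: "(CLINT s:E|lborel. \<xi> (z * f s)) = of_real (l * v) * (char \<rho> z - 1)" for z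
  proof -
    have int: "integrable (Q \<Otimes>\<^sub>M N) (\<lambda>(s, x). iexp (z * (f s * x)))"
      by (rule P.integrable_const_bound[where B=1]) auto
    have "char \<rho> z = (CLINT p|Q \<Otimes>\<^sub>M N. (case p of (s, x) \<Rightarrow> iexp (z * (f s * x))))"
      unfolding char_def \<rho>_def by (subst integral_distr) (auto simp: split_beta')
    also have "\<dots> = (CLINT s|Q. CLINT x|N. iexp (z * (f s * x)))"
      using P.integral_fst'[OF int] by simp
    also have "\<dots> = (CLINT s|Q. char N (z * f s))" by (simp add: char_def mult.assoc)
    also have "\<dots> = (CLINT s|Q. 1 + \<xi> (z * f s) / of_real v)" by (simp only: charN)
    finally have c: "char \<rho> z = (CLINT s|Q. 1 + \<xi> (z * f s) / of_real v)" .
    note [measurable] = isCont_measurable[OF cont\<xi>]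
    have si: "set_integrable lborel E (\<lambda>s. \<xi> (z * f s))"
      by (rule set_integrable_exponent[OF cont\<xi> Em Efin f m])
    have \<xi>f: "(\<lambda>s. \<xi> (z * f s)) \<in> borel_measurable borel" by measurable
    note iQ = Qn(3)[OF \<xi>f si]
    note Qn(4)[OF \<xi>f]
    moreover have "char \<rho> z = 1 + (CLINT s|Q. \<xi> (z * f s)) / of_real v"
      unfolding c using iQ Q.prob_space by (subst Bochner_Integration.integral_add) auto
    ultimately show ?thesis using l v by (simp add: scaleR_conv_of_real field_simps)
  qed
  have \<rho>ac: "absolutely_continuous lborel \<rho>"
    unfolding absolutely_continuous_def
  proof
    fix B' :: "real set" assume B': "B' \<in> null_sets lborel"
    then have [measurable]: "B' \<in> sets borel" by auto
    have "emeasure \<rho> B' = (\<integral>\<^sup>+p. indicator B' (f (fst p) * snd p) \<partial>(Q \<Otimes>\<^sub>M N))"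
      unfolding \<rho>_def by (subst nn_integral_indicator[symmetric], simp, subst nn_integral_distr) (auto simp: split_beta')
    also have "\<dots> = (\<integral>\<^sup>+s. \<integral>\<^sup>+x. indicator B' (f s * x) \<partial>N \<partial>Q)"
      by (subst N.nn_integral_fst[symmetric]) auto
    also have "\<dots> = (\<integral>\<^sup>+s. emeasure N {x. f s * x \<in> B'} \<partial>Q)"
    proof (intro nn_integral_cong)
      fix s
      have "(\<integral>\<^sup>+x. indicator B' (f s * x) \<partial>N) = (\<integral>\<^sup>+x. indicator {x. f s * x \<in> B'} x \<partial>N)"
        by (intro nn_integral_cong) (auto split: split_indicator)
      then show "(\<integral>\<^sup>+x. indicator B' (f s * x) \<partial>N) = emeasure N {x. f s * x \<in> B'}" by simp
    qed
    also have "\<dots> = (\<integral>\<^sup>+s. 0 \<partial>Q)"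
    proof (intro nn_integral_cong_AE)
      have "AE s in lborel. 0 < ennreal (indicator E s / l) \<longrightarrow> emeasure N {x. f s * x \<in> B'} = 0"
        using null[OF B'] by eventually_elim (auto simp: Nn(1) split: split_indicator)
      then show "AE s in Q. emeasure N {x. f s * x \<in> B'} = 0"
        unfolding Q_def by (subst AE_density) auto
    qed
    finally show "B' \<in> null_sets \<rho>" by (auto simp: null_sets_def \<rho>_def)
  qed
  note quot = char_fun_quotient_improper_integral[OF E m]
  have Xm[measurable]: "X \<in> borel_measurable M" by (rule quot(1))
  have lv: "0 < l * v" using l v by simp
  note CP = real_distribution_compound_poisson[OF \<rho>, of "l * v"]
  have rest: "char_fun (\<lambda>z. exp (CLINT s:E|lborel. \<Psi>r (z * f s)))"
    unfolding \<Psi>r_def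
    by (intro char_fun_exponent_integral[OF _ _ Em Efin f m] char_fun_levy_exponent \<nu>' \<sigma>2 isCont_levy_exponent)
  have factor: "exp (CLINT s:E|lborel. \<Psi> (z * f s)) = char (compound_poisson (l * v) \<rho>) z * exp (CLINT s:E|lborel. \<Psi>r (z * f s))" for z
  proof -
    have "(CLINT s:E|lborel. \<Psi> (z * f s)) = (CLINT s:E|lborel. \<xi> (z * f s)) + (CLINT s:E|lborel. \<Psi>r (z * f s))"
      unfolding split' by (intro set_integral_add set_integrable_exponent[OF _ Em Efin f m] cont\<xi> cont')
    then show ?thesis by (simp add: int\<xi> char_compound_poisson[OF lv \<rho>] exp_add)
  qed
  have decomp: "char_rv M X z = char (compound_poisson (l * v) \<rho>) z *
      (exp (CLINT s:E|lborel. \<Psi>r (z * f s)) * (char_rv M X z / exp (CLINT s:E|lborel. \<Psi> (z * f s))))" for z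
    unfolding mult.assoc[symmetric] factor[symmetric] by simp
  have "\<exists>\<kappa>. real_distribution \<kappa> \<and> distr M borel X = (\<kappa> \<star> compound_poisson (l * v) \<rho>)"
    by (rule convolution_factor[OF real_distribution_distr[OF Xm] CP char_fun_mult[OF rest quot(2)]])
      (assumption, rule decomp)
  then obtain \<kappa> where \<kappa>: "real_distribution \<kappa>" "distr M borel X = (\<kappa> \<star> compound_poisson (l * v) \<rho>)"
    by blast
  show ?thesis
    unfolding \<kappa>(2) l_def[symmetric] v_def[symmetric]
    by (intro null_mass_convolution[OF \<kappa>(1) CP _ B] compound_poisson_null_mass[OF lv \<rho> \<rho>ac])
qed

text \<open>
  With the convention \<open>0 * \<infinity> = 0\<close> multiplication in \<^typ>\<open>ennreal\<close> commutes with suprema.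
\<close>

lemma ex_product_gt:
  fixes u v :: "nat \<Rightarrow> ennreal"
  assumes "(SUP n. u n) * (SUP j. v j) = \<infinity>" and "K < \<infinity>"
  shows "\<exists>n j. K < u n * v j"
proof (rule ccontr)
  assume "\<not> ?thesis"
  then have le: "u n * v j \<le> K" for n j by (auto simp: not_less)
  have "(SUP n. u n) * (SUP j. v j) = (SUP n. u n * (SUP j. v j))"
    by (simp only: SUP_mult_right_ennreal)
  also have "\<dots> \<le> K"
  proof (rule SUP_least)
    fix n
    have "u n * (SUP j. v j) = (SUP j. u n * v j)" by (simp only: SUP_mult_left_ennreal)
    also have "\<dots> \<le> K" by (rule SUP_least) (rule le)
    finally show "u n * (SUP j. v j) \<le> K" .
  qed
  finally show False using assms by simp
qed

text \<open>
  The set \<open>D\<close> collects the jump sizes in use. The bound of \<open>abs_cont_rv_null_bound\<close>, applied to bounded pieces of the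
  support and to the jumps in \<open>D\<close> of size at least \<open>1 / Suc j\<close>, becomes arbitrarily small.
\<close>

lemma (in levy_integral) abs_cont_rv_infinite_activity:
  fixes D :: "real set"
  assumes D[measurable]: "D \<in> sets borel"
    and mass: "emeasure lborel {s \<in> {0..}. f s \<noteq> 0} * emeasure \<nu> D = \<infinity>"
    and null: "\<And>B d. B \<in> null_sets lborel \<Longrightarrow> 0 < d \<Longrightarrow>
      AE s in lborel. 0 \<le> s \<longrightarrow> f s \<noteq> 0 \<longrightarrow> emeasure \<nu> ({x \<in> D. d \<le> \<bar>x\<bar>} \<inter> {x. f s * x \<in> B}) = 0"
  shows "abs_cont_rv M X"
proof -
  define E where "E n = {s \<in> {0..real n}. 1 / Suc n \<le> \<bar>f s\<bar> \<and> \<bar>f s\<bar> \<le> real n}" for n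
  note E = finite_piece_of_support[OF f, folded E_def]
  note sets = sets_\<nu>
  define S where "S j = {x \<in> D. 1 / Suc j \<le> \<bar>x\<bar>}" for j :: nat
  have S: "S j \<in> sets borel" for j unfolding S_def by measurable
  have away: "1 / Suc j \<le> \<bar>x\<bar>" if "x \<in> S j" for j x using that by (simp add: S_def)
  have inc: "incseq S"
  proof (rule incseq_SucI)
    fix n
    have "1 / real (Suc (Suc n)) \<le> 1 / real (Suc n)" by (intro divide_left_mono) auto
    then show "S n \<subseteq> S (Suc n)" by (auto simp: S_def)
  qed
  have U: "(\<Union>j. S j) = D - {0}"
  proof (intro equalityI subsetI)
    fix x assume x: "x \<in> D - {0}"
    obtain j where "1 / real (Suc j) < \<bar>x\<bar>"
      using x reals_Archimedean[of "\<bar>x\<bar>"] by (auto simp: inverse_eq_divide)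
    then show "x \<in> (\<Union>j. S j)" using x by (auto simp: S_def intro!: exI[of _ j])
  next
    fix x assume "x \<in> (\<Union>j. S j)"
    then obtain j where j: "1 / real (Suc j) \<le> \<bar>x\<bar>" "x \<in> D" by (auto simp: S_def)
    have "0 < 1 / real (Suc j)" by simp
    with j show "x \<in> D - {0}" by (auto simp del: of_nat_Suc)
  qed
  have "(SUP j. emeasure \<nu> (S j)) = emeasure \<nu> (D - {0})"
    unfolding U[symmetric] by (rule SUP_emeasure_incseq[OF _ inc]) (use S sets in blast)
  also have "\<dots> = emeasure \<nu> D"
    using \<nu> sets D by (intro emeasure_Diff_null_set) (auto simp: levy_measure_def null_sets_def)
  finally have SUP: "(SUP j. emeasure \<nu> (S j)) = emeasure \<nu> D" .
  have bound: "emeasure (distr M borel X) B \<le> ennreal (exp (- K))" if K: "0 < K" and B: "B \<in> null_sets lborel" for K B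
  proof -
    have "(SUP n. emeasure lborel (E n)) * (SUP j. emeasure \<nu> (S j)) = \<infinity>"
      unfolding E(3) SUP by (rule mass)
    then obtain n j where nj: "ennreal K < emeasure lborel (E n) * emeasure \<nu> (S j)"
      using ex_product_gt[of "\<lambda>n. emeasure lborel (E n)" "\<lambda>j. emeasure \<nu> (S j)" "ennreal K"] by auto
    have d: "0 < 1 / real (Suc j)" by simp
    have Efin: "emeasure lborel (E n) < \<infinity>" using bounded_borel_emeasure[OF E(1)] by auto
    have Sfin: "emeasure \<nu> (S j) < \<infinity>"
      by (rule finite_levy_measure_away_from_0(1)[OF \<nu> S d away])
    have "emeasure lborel (E n) * emeasure \<nu> (S j) = ennreal (measure lborel (E n) * measure \<nu> (S j))"
      using Efin Sfin by (simp add: emeasure_eq_ennreal_measure ennreal_mult)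
    then have "K \<le> measure lborel (E n) * measure \<nu> (S j)"
      using nj K by (simp add: ennreal_less_iff)
    have pos: "0 < emeasure lborel (E n)" "0 < emeasure \<nu> (S j)"
      using nj by (auto simp: zero_less_iff_neq_zero)
    have ae: "AE s in lborel. s \<in> E n \<longrightarrow> emeasure \<nu> (S j \<inter> {x. f s * x \<in> B'}) = 0" if "B' \<in> null_sets lborel" for B'
      using null[OF that d]
    proof eventually_elim
      case (elim s)
      have "0 < 1 / real (Suc n)" by simp
      then have "s \<in> E n \<Longrightarrow> 0 \<le> s \<and> f s \<noteq> 0" by (auto simp: E_def simp del: of_nat_Suc)
      then show ?case using elim unfolding S_def by blast
    qed
    have m: "\<bar>f s\<bar> \<le> real n" if "s \<in> E n" for s using that by (simp add: E_def)
    have "emeasure (distr M borel X) B \<le> ennreal (exp (- (measure lborel (E n) * measure \<nu> (S j))))"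
      by (rule abs_cont_rv_null_bound[OF E(1) m pos(1) S d away pos(2) ae B])
    also have "\<dots> \<le> ennreal (exp (- K))"
      using \<open>K \<le> _\<close> by (intro ennreal_leI) simp
    finally show ?thesis .
  qed
  have "emeasure (distr M borel X) B = 0" if B: "B \<in> null_sets lborel" for B
  proof (rule ccontr)
    assume "emeasure (distr M borel X) B \<noteq> 0"
    then have "0 < emeasure (distr M borel X) B" by (simp add: zero_less_iff_neq_zero)
    then obtain y where y: "0 < y" "y < emeasure (distr M borel X) B" by (rule dense[THEN exE]) blast
    define e where "e = enn2real y"
    have "y = ennreal e" using y(2) unfolding e_def by (cases y) auto
    then have e: "0 < e" "ennreal e < emeasure (distr M borel X) B" using y by auto
    \<comment> \<open>Chosen so that \<open>exp (- K) \<le> e\<close> and \<open>K > 0\<close>.\<close>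
    define K where "K = max 1 (- ln e)"
    have "exp (- K) \<le> exp (ln e)" unfolding K_def by (subst exp_le_cancel_iff) simp
    then have "ennreal (exp (- K)) \<le> ennreal e" using e(1) by (intro ennreal_leI) simp
    moreover have "emeasure (distr M borel X) B \<le> ennreal (exp (- K))"
      by (rule bound[OF _ B]) (simp add: K_def)
    ultimately have "emeasure (distr M borel X) B \<le> ennreal e" by (rule order_trans[rotated])
    then show False using e(2) by (simp add: not_less[symmetric])
  qed
  then show ?thesis
    unfolding abs_cont_rv_def absolutely_continuous_def by (auto simp: null_sets_def)
qed

text \<open>
  The absolutely continuous part of \<open>\<nu>\<close> is the restriction of \<open>\<nu>\<close> to the complement of a null set, which serves
  as the set of jump sizes.
\<close>

lemma (in levy_integral) abs_cont_rv_ac_part: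
  assumes dec: "lebesgue_decomposition \<nu> \<nu>ac \<nu>sing"
    and mass: "emeasure lborel {s \<in> {0..}. f s \<noteq> 0} * emeasure \<nu>ac UNIV = \<infinity>"
  shows "abs_cont_rv M X"
proof -
  obtain N where N: "N \<in> null_sets lborel" "emeasure \<nu>sing (- N) = 0"
    and sets: "sets \<nu>ac = sets borel" "sets \<nu>sing = sets borel"
    and sum: "\<And>A. A \<in> sets borel \<Longrightarrow> emeasure \<nu> A = emeasure \<nu>ac A + emeasure \<nu>sing A"
    and ac: "absolutely_continuous lborel \<nu>ac"
    using dec unfolding lebesgue_decomposition_def by blast
  have Nb: "N \<in> sets borel" using N(1) by auto
  have D[measurable]: "- N \<in> sets borel" using Nb by auto
  have off_N: "emeasure \<nu> A = emeasure \<nu>ac A" if "A \<in> sets borel" "A \<subseteq> - N" for A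
  proof -
    have "emeasure \<nu>sing A \<le> emeasure \<nu>sing (- N)"
      using that sets Nb by (intro emeasure_mono) auto
    then show ?thesis using sum[OF that(1)] N(2) by simp
  qed
  have "emeasure \<nu> (- N) = emeasure \<nu>ac (UNIV - N)"
    using off_N[OF D] by (simp add: Compl_eq_Diff_UNIV)
  also have "\<dots> = emeasure \<nu>ac UNIV"
    using ac sets N(1) by (intro emeasure_Diff_null_set) (auto simp: absolutely_continuous_def)
  finally have total: "emeasure \<nu> (- N) = emeasure \<nu>ac UNIV" .
  show ?thesis
  proof (rule abs_cont_rv_infinite_activity[OF D])
    show "emeasure lborel {s \<in> {0..}. f s \<noteq> 0} * emeasure \<nu> (- N) = \<infinity>"
      unfolding total by (rule mass)
    fix B :: "real set" and d :: real assume B: "B \<in> null_sets lborel"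
    have "emeasure \<nu> ({x \<in> - N. d \<le> \<bar>x\<bar>} \<inter> {x. f s * x \<in> B}) = 0" (is "emeasure \<nu> ?A = 0") if "f s \<noteq> 0" for s
    proof -
      have n: "{x. f s * x \<in> B} \<in> null_sets lborel" by (rule null_sets_times_vimage[OF that B])
      have "{x \<in> - N. d \<le> \<bar>x\<bar>} \<in> sets borel" by measurable
      with n have n': "?A \<in> null_sets lborel"
        by (intro null_sets_subset[OF n]) auto
      have "emeasure \<nu> ?A = emeasure \<nu>ac ?A"
        using null_setsD2[OF n'] by (intro off_N) auto
      also have "\<dots> = 0" using ac n' by (auto simp: absolutely_continuous_def)
      finally show ?thesis .
    qed
    then show "AE s in lborel. 0 \<le> s \<longrightarrow> f s \<noteq> 0 \<longrightarrow> emeasure \<nu> ({x \<in> - N. d \<le> \<bar>x\<bar>} \<inter> {x. f s * x \<in> B}) = 0"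
      by (intro AE_I2 impI)
  qed
qed

text \<open>
  Here the integrand makes the law of \<open>f s * x\<close> absolutely continuous: for every fixed \<open>x \<noteq> 0\<close> the set of
  \<open>s\<close> with \<open>f s \<noteq> 0\<close> and \<open>f s * x \<in> B\<close> is null when \<open>B\<close> is, and Tonelli exchanges the roles of \<open>s\<close> and
  \<open>x\<close>.
\<close>

lemma (in levy_integral) abs_cont_rv_spreading_integrand:
  assumes spread: "\<And>B. B \<in> sets borel \<Longrightarrow> B \<subseteq> UNIV - {0} \<Longrightarrow> emeasure lborel B = 0 \<Longrightarrow>
          emeasure lborel {s \<in> {0..}. f s \<in> B} = 0"
    and mass: "emeasure lborel {s \<in> {0..}. f s \<noteq> 0} * emeasure \<nu> UNIV = \<infinity>"
  shows "abs_cont_rv M X"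
proof -
  note sets = sets_\<nu>
  show ?thesis
  proof (rule abs_cont_rv_infinite_activity[where D=UNIV])
    show "emeasure lborel {s \<in> {0..}. f s \<noteq> 0} * emeasure \<nu> UNIV = \<infinity>" by (rule mass)
    fix B :: "real set" and d :: real assume B: "B \<in> null_sets lborel" and d: "0 < d"
    from B have [measurable]: "B \<in> sets borel" by auto
    define S where "S = {x \<in> UNIV. d \<le> \<bar>x\<bar>}"
    have S[measurable]: "S \<in> sets borel" unfolding S_def by measurable
    let ?\<rho> = "restrict_measure \<nu> S"
    interpret F: finite_measure ?\<rho>
      by (rule finite_levy_measure_away_from_0(2)[OF \<nu> S d]) (simp add: S_def)
    interpret LF: pair_sigma_finite lborel ?\<rho> ..
    have em: "emeasure \<nu> (S \<inter> {x. f s * x \<in> B}) = (\<integral>\<^sup>+x. indicator B (f s * x) \<partial>?\<rho>)" for s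
    proof -
      have "(\<integral>\<^sup>+x. indicator B (f s * x) \<partial>?\<rho>) = (\<integral>\<^sup>+x. indicator {x. f s * x \<in> B} x \<partial>?\<rho>)"
        by (intro nn_integral_cong) (auto split: split_indicator)
      also have "\<dots> = emeasure ?\<rho> {x. f s * x \<in> B}" using sets by (intro nn_integral_indicator) auto
      also have "\<dots> = emeasure \<nu> (S \<inter> {x. f s * x \<in> B})"
        by (rule emeasure_restrict_measure[OF sets S]) measurable
      finally show ?thesis ..
    qed
    let ?D = "{s \<in> {0..}. f s \<noteq> 0}"
    have [measurable]: "?D \<in> sets borel" by measurable
    have zero: "(\<integral>\<^sup>+s. indicator ?D s * indicator B (f s * x) \<partial>lborel) = 0" if "x \<in> S" for x
    proof -
      have x: "x \<noteq> 0" using that d by (auto simp: S_def)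
      have "{y. y * x \<in> B} \<in> null_sets lborel" using null_sets_times_vimage[OF x B] by (simp add: mult.commute)
      then have "{y. y * x \<in> B} - {0} \<in> null_sets lborel" by (intro null_set_Diff) auto
      then have "emeasure lborel {s \<in> {0..}. f s \<in> {y. y * x \<in> B} - {0}} = 0"
        by (intro spread) auto
      moreover have "(\<integral>\<^sup>+s. indicator ?D s * indicator B (f s * x) \<partial>lborel)
          = (\<integral>\<^sup>+s. indicator {s \<in> {0..}. f s \<in> {y. y * x \<in> B} - {0}} s \<partial>lborel)"
        by (intro nn_integral_cong) (auto split: split_indicator)
      moreover have "\<dots> = emeasure lborel {s \<in> {0..}. f s \<in> {y. y * x \<in> B} - {0}}"
        by (intro nn_integral_indicator) measurable
      ultimately show ?thesis by simp
    qed
    have "(\<integral>\<^sup>+s. indicator ?D s * emeasure \<nu> (S \<inter> {x. f s * x \<in> B}) \<partial>lborel)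
        = (\<integral>\<^sup>+s. \<integral>\<^sup>+x. indicator ?D s * indicator B (f s * x) \<partial>?\<rho> \<partial>lborel)"
      unfolding em by (intro nn_integral_cong nn_integral_cmult[symmetric]) measurable
    also have "\<dots> = (\<integral>\<^sup>+x. \<integral>\<^sup>+s. indicator ?D s * indicator B (f s * x) \<partial>lborel \<partial>?\<rho>)"
      by (rule LF.Fubini'[symmetric]) measurable
    also have "\<dots> = (\<integral>\<^sup>+x. 0 \<partial>?\<rho>)"
    proof (intro nn_integral_cong_AE)
      have "AE x in \<nu>. 0 < ennreal (indicator S x) \<longrightarrow> (\<integral>\<^sup>+s. indicator ?D s * indicator B (f s * x) \<partial>lborel) = 0"
        using zero by (intro AE_I2) (auto split: split_indicator)
      then show "AE x in ?\<rho>. (\<integral>\<^sup>+s. indicator ?D s * indicator B (f s * x) \<partial>lborel) = 0"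
        by (subst AE_density) auto
    qed
    finally have z: "(\<integral>\<^sup>+s. indicator ?D s * emeasure \<nu> (S \<inter> {x. f s * x \<in> B}) \<partial>lborel) = 0" by simp
    have mm: "(\<lambda>s. indicator ?D s * emeasure \<nu> (S \<inter> {x. f s * x \<in> B})) \<in> borel_measurable lborel"
      unfolding em by measurable
    from z have "AE s in lborel. indicator ?D s * emeasure \<nu> (S \<inter> {x. f s * x \<in> B}) = 0"
      by (simp only: nn_integral_0_iff_AE[OF mm])
    then show "AE s in lborel. 0 \<le> s \<longrightarrow> f s \<noteq> 0 \<longrightarrow> emeasure \<nu> ({x \<in> UNIV. d \<le> \<bar>x\<bar>} \<inter> {x. f s * x \<in> B}) = 0"
      unfolding S_def[symmetric]
      by eventually_elim (auto split: split_indicator)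
  qed simp
qed

section \<open>Logarithmic growth of the exponent\<close>

text \<open>
  Concavity of the sine: its graph lies above the chord from \<open>0\<close> to \<open>pi / 2\<close>.
\<close>

lemma jordan_sin_bound:
  fixes u :: real assumes u: "0 \<le> u" "u \<le> pi / 2"
  shows "2 * u / pi \<le> sin u"
proof -
  have conv: "convex_on {0..pi} (\<lambda>x. - sin x)"
  proof (rule f''_ge0_imp_convex)
    fix x :: real assume "x \<in> {0..pi}"
    show "((\<lambda>x. - sin x) has_real_derivative - cos x) (at x)" by (auto intro!: derivative_eq_intros)
    show "((\<lambda>x. - cos x) has_real_derivative sin x) (at x)" by (auto intro!: derivative_eq_intros)
    show "0 \<le> sin x" using \<open>x \<in> {0..pi}\<close> by (auto intro: sin_ge_zero)
  qed simp
  have "2 * u / pi \<le> 1" using u(2) by (simp add: field_simps)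
  then have "- sin ((1 - 2 * u / pi) *\<^sub>R 0 + (2 * u / pi) *\<^sub>R (pi / 2)) \<le> (1 - 2 * u / pi) * (- sin 0) + (2 * u / pi) * (- sin (pi / 2))"
    using u(1) by (intro convex_onD[OF conv]) auto
  then show ?thesis by simp
qed

lemma one_minus_cos_lower:
  fixes u :: real assumes "\<bar>u\<bar> \<le> pi"
  shows "2 * u\<^sup>2 / pi\<^sup>2 \<le> 1 - cos u"
proof -
  have "(2 * (\<bar>u\<bar> / 2) / pi)\<^sup>2 \<le> (sin (\<bar>u\<bar> / 2))\<^sup>2"
    using assms by (intro power_mono jordan_sin_bound) auto
  moreover have "1 - cos \<bar>u\<bar> = 2 * (sin (\<bar>u\<bar> / 2))\<^sup>2"
    using cos_double_sin[of "\<bar>u\<bar> / 2"] by simp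
  ultimately show ?thesis by (simp add: power_divide)
qed

lemma integrable_inverse_power_decay:
  fixes p m :: real assumes p: "1 < p" and m: "0 < m"
  shows "integrable lborel (\<lambda>z. (1 + \<bar>z\<bar> / m) powr (- p))"
proof -
  let ?G = "\<lambda>z. (1 + \<bar>z\<bar> / m) powr (- p)"
  let ?H = "\<integral>\<^sup>+z. ennreal (?G z) * indicator {0..} z \<partial>lborel"
  \<comment> \<open>An antiderivative of the integrand on the positive half-line.\<close>
  define F where "F z = - (m / (p - 1)) * (1 + z / m) powr (1 - p)" for z
  have half: "?H < \<infinity>"
  proof -
    have "?H = (\<integral>\<^sup>+z. ennreal ((1 + z / m) powr (- p)) * indicator {0..} z \<partial>lborel)"
      by (intro nn_integral_cong) (auto split: split_indicator)
    also have "\<dots> = ennreal (0 - F 0)"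
    proof (rule nn_integral_FTC_atLeast)
      show "(F has_real_derivative (1 + x / m) powr (- p)) (at x)" if "0 \<le> x" for x
      proof -
        have pos: "0 < 1 + x / m" using that m by (intro add_pos_nonneg) auto
        have "((\<lambda>z. 1 + z / m) has_real_derivative 1 / m) (at x)"
          using m by (auto intro!: derivative_eq_intros)
        then have "((\<lambda>z. (1 + z / m) powr (1 - p)) has_real_derivative
            ((1 - p) * (1 + x / m) powr (1 - p - 1)) * (1 / m)) (at x)"
          by (rule DERIV_chain2[where f="\<lambda>y. y powr (1 - p)" and g="\<lambda>z. 1 + z / m", OF has_real_derivative_powr[OF pos]])
        then have "(F has_real_derivative - (m / (p - 1)) * (((1 - p) * (1 + x / m) powr (1 - p - 1)) * (1 / m))) (at x)"
          unfolding F_def by (rule DERIV_cmult)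
        moreover have "- (m / (p - 1)) * (((1 - p) * (1 + x / m) powr (1 - p - 1)) * (1 / m)) = (1 + x / m) powr (- p)"
        proof -
          have "1 - p - 1 = - p" by simp
          moreover have "- (m / (p - 1)) * ((1 - p) * (1 / m)) = 1" using p m by (simp add: divide_simps)
          moreover have "- (m / (p - 1)) * (((1 - p) * w) * (1 / m)) = (- (m / (p - 1)) * ((1 - p) * (1 / m))) * w" for w
            by (simp only: mult.assoc mult.commute mult.left_commute)
          ultimately show ?thesis by simp
        qed
        ultimately show ?thesis by (simp only:)
      qed
      have "filterlim (\<lambda>z. (1 / m) * z) at_top at_top"
        using m by (intro filterlim_tendsto_pos_mult_at_top[OF tendsto_const _ filterlim_ident]) simp
      then have "filterlim (\<lambda>z. 1 + (1 / m) * z) at_top at_top"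
        by (rule filterlim_tendsto_add_at_top[OF tendsto_const])
      then have "filterlim (\<lambda>z. 1 + z / m) at_top at_top" by simp
      then have "((\<lambda>z. (1 + z / m) powr (1 - p)) \<longlongrightarrow> 0) at_top"
        using p by (intro tendsto_neg_powr) auto
      then have "((\<lambda>z. - (m / (p - 1)) * (1 + z / m) powr (1 - p)) \<longlongrightarrow> - (m / (p - 1)) * 0) at_top"
        by (intro tendsto_intros)
      then show "(F \<longlongrightarrow> 0) at_top" unfolding F_def by simp
    qed auto
    finally show ?thesis by simp
  qed
  have "(\<integral>\<^sup>+z. ennreal (?G z) \<partial>lborel) \<le> (\<integral>\<^sup>+z. ennreal (?G z) * indicator {0..} z + ennreal (?G z) * indicator {0..} (- z) \<partial>lborel)"
    by (intro nn_integral_mono) (auto split: split_indicator)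
  also have "\<dots> = ?H + (\<integral>\<^sup>+z. ennreal (?G z) * indicator {0..} (- z) \<partial>lborel)"
    by (intro nn_integral_add) auto
  also have "(\<integral>\<^sup>+z. ennreal (?G z) * indicator {0..} (- z) \<partial>lborel) = ?H"
    using nn_integral_real_affine[of "\<lambda>z. ennreal (?G z) * indicator {0..} z" "-1" 0] by simp
  finally have "(\<integral>\<^sup>+z. ennreal (?G z) \<partial>lborel) < \<infinity>"
    using half by (simp add: le_less_trans)
  then show ?thesis
    by (intro integrableI_bounded) auto
qed

text \<open>
  The cofactor of the contribution of \<open>E\<close> is a characteristic function and has modulus at most \<open>1\<close>.
\<close>

lemma (in levy_integral) norm_char_improper_integral_le:
  assumes E: "E \<in> bounded_borel" and m: "\<And>s. s \<in> E \<Longrightarrow> \<bar>f s\<bar> \<le> m"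
    and q: "\<And>s. s \<in> E \<Longrightarrow> q \<le> - Re (\<Psi> (z * f s))"
  shows "norm (char_rv M X z) \<le> exp (- (measure lborel E * q))"
proof -
  let ?F = "\<lambda>A z. CLINT s:A|lborel. \<Psi> (z * f s)"
  have Eb: "E \<in> sets borel" "emeasure lborel E < \<infinity>" using bounded_borel_emeasure[OF E] by auto
  obtain \<kappa> where \<kappa>: "real_distribution \<kappa>"
    "char \<kappa> = (\<lambda>z. char_rv M X z / exp (?F E z))"
    using char_fun_quotient_improper_integral(2)[OF E m] unfolding char_fun_def by blast
  interpret K: real_distribution \<kappa> by fact
  have si: "set_integrable lborel E (\<lambda>s. \<Psi> (z * f s))"
    by (rule set_integrable_exponent[OF isCont_\<Psi> Eb f m])
  have "Re (?F E z) = (LINT s:E|lborel. Re (\<Psi> (z * f s)))"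
    using integral_Re[OF si[unfolded set_integrable_def]] by (simp add: set_lebesgue_integral_def)
  also have "\<dots> \<le> (LINT s:E|lborel. - q)"
  proof (rule set_integral_mono)
    show "set_integrable lborel E (\<lambda>s. Re (\<Psi> (z * f s)))"
      using integrable_Re[OF si[unfolded set_integrable_def]] by (simp add: set_integrable_def)
    show "set_integrable lborel E (\<lambda>s. - q)"
      using Eb by (simp add: set_integrable_def)
    show "Re (\<Psi> (z * f s)) \<le> - q" if "s \<in> E" for s using q[OF that] by simp
  qed
  also have "\<dots> = - (measure lborel E * q)"
    using Eb by (simp add: set_lebesgue_integral_def)
  finally have Re: "Re (?F E z) \<le> - (measure lborel E * q)" .
  have "char_rv M X z = exp (?F E z) * char \<kappa> z" by (simp add: \<kappa>(2))
  then have "norm (char_rv M X z) = exp (Re (?F E z)) * norm (char \<kappa> z)"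
    by (simp only: norm_mult norm_exp_eq_Re)
  also have "\<dots> \<le> exp (- (measure lborel E * q)) * 1"
    using Re K.cmod_char_le_1 by (intro mult_mono) auto
  finally show ?thesis by simp
qed

text \<open>
  On a piece \<open>E n\<close> of the support one has \<open>\<bar>f s\<bar> \<ge> 1 / m\<close>, so for large \<open>z\<close> the squared modulus of the characteristic function is at most
  \<open>(1 + \<bar>z\<bar> / m) powr (- 2 * a * \<kappa>)\<close> when the length of \<open>E n\<close> exceeds \<open>a\<close>. This is integrable because \<open>2 * a * \<kappa> > 1\<close>.
\<close>

lemma (in levy_integral) abs_cont_rv_log_growth:
  assumes a: "0 < a" "ennreal a < emeasure lborel {s \<in> {0..}. f s \<noteq> 0}"
    and \<kappa>: "0 < \<kappa>" "1 / 2 < a * \<kappa>" and R: "0 \<le> R"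
    and growth: "\<And>z. R \<le> \<bar>z\<bar> \<Longrightarrow> \<kappa> * ln (1 + \<bar>z\<bar>) \<le> - Re (\<Psi> z)"
  shows "abs_cont_rv M X"
proof -
  define E where "E n = {s \<in> {0..real n}. 1 / Suc n \<le> \<bar>f s\<bar> \<and> \<bar>f s\<bar> \<le> real n}" for n
  note E = finite_piece_of_support[OF f, folded E_def]
  obtain n where n: "ennreal a < emeasure lborel (E n)"
    using a(2) unfolding E(3)[symmetric] less_SUP_iff by blast
  have Efin: "emeasure lborel (E n) < \<infinity>" using bounded_borel_emeasure[OF E(1)] by auto
  then have l: "a < measure lborel (E n)"
    using n a(1) by (simp add: emeasure_eq_ennreal_measure ennreal_less_iff)
  define m where "m = real (Suc n)"
  have m: "0 < m" by (simp add: m_def)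
  define p where "p = 2 * a * \<kappa>"
  have p: "1 < p" using \<kappa>(2) by (simp add: p_def)
  let ?q = "\<lambda>z. (norm (char_rv M X z))\<^sup>2"
  have Xm[measurable]: "X \<in> borel_measurable M"
    by (rule char_fun_quotient_improper_integral(1)[OF E(1)[of n], of "real n"]) (simp add: E_def)
  have D: "real_distribution (distr M borel X)" by simp
  interpret D: real_distribution "distr M borel X" by (rule D)
  have large: "?q z \<le> (1 + \<bar>z\<bar> / m) powr (- p)" if z: "R * m \<le> \<bar>z\<bar>" for z
  proof -
    let ?L = "ln (1 + \<bar>z\<bar> / m)"
    have L: "0 \<le> ?L" using m by (intro ln_ge_zero) simp
    have "norm (char_rv M X z) \<le> exp (- (measure lborel (E n) * (\<kappa> * ?L)))"
    proof (rule norm_char_improper_integral_le[OF E(1)])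
      show "\<bar>f s\<bar> \<le> real n" if "s \<in> E n" for s using that by (simp add: E_def)
      fix s assume "s \<in> E n"
      then have "1 / m \<le> \<bar>f s\<bar>" by (simp add: E_def m_def)
      then have "\<bar>z\<bar> * (1 / m) \<le> \<bar>z\<bar> * \<bar>f s\<bar>" by (intro mult_left_mono) auto
      then have zf: "\<bar>z\<bar> / m \<le> \<bar>z * f s\<bar>" by (simp add: abs_mult)
      have "R \<le> \<bar>z\<bar> / m" using z m by (simp add: field_simps)
      then have "R \<le> \<bar>z * f s\<bar>" using zf by linarith
      then have "\<kappa> * ln (1 + \<bar>z * f s\<bar>) \<le> - Re (\<Psi> (z * f s))" by (rule growth)
      moreover have "\<kappa> * ?L \<le> \<kappa> * ln (1 + \<bar>z * f s\<bar>)"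
        using zf m \<kappa>(1) by (intro mult_left_mono ln_mono add_left_mono add_pos_nonneg) auto
      ultimately show "\<kappa> * ?L \<le> - Re (\<Psi> (z * f s))" by linarith
    qed
    also have "\<dots> \<le> exp (- (a * (\<kappa> * ?L)))"
      using l L \<kappa>(1) by (simp add: mult_right_mono)
    finally have "?q z \<le> (exp (- (a * (\<kappa> * ?L))))\<^sup>2" by (intro power_mono) auto
    also have "\<dots> = exp (- p * ?L)" by (simp add: p_def exp_double[symmetric] algebra_simps)
    also have "\<dots> = (1 + \<bar>z\<bar> / m) powr (- p)"
    proof -
      have "0 < 1 + \<bar>z\<bar> / m" using m by (intro add_pos_nonneg) auto
      then show ?thesis by (simp add: powr_def)
    qed
    finally show ?thesis .
  qed
  have all: "?q z \<le> (1 + R) powr p * (1 + \<bar>z\<bar> / m) powr (- p)" for z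
  proof (cases "R * m \<le> \<bar>z\<bar>")
    case True
    have "1 \<le> (1 + R) powr p" using R p by (intro ge_one_powr_ge_zero) auto
    then have "1 * (1 + \<bar>z\<bar> / m) powr (- p) \<le> (1 + R) powr p * (1 + \<bar>z\<bar> / m) powr (- p)"
      by (intro mult_right_mono) auto
    with large[OF True] show ?thesis by linarith
  next
    case False
    then have "\<bar>z\<bar> / m \<le> R" using m by (simp add: field_simps)
    then have "(1 + \<bar>z\<bar> / m) powr p \<le> (1 + R) powr p" using m p by (intro powr_mono2) auto
    moreover have pos: "0 < 1 + \<bar>z\<bar> / m" using m by (intro add_pos_nonneg) auto
    ultimately have "1 \<le> (1 + R) powr p * (1 + \<bar>z\<bar> / m) powr (- p)"
      by (simp add: powr_minus field_simps)
    moreover have "?q z \<le> 1" using D.cmod_char_le_1[of z] by (simp add: power_le_one)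
    ultimately show ?thesis by linarith
  qed
  have "integrable lborel ?q"
  proof (rule Bochner_Integration.integrable_bound)
    show "integrable lborel (\<lambda>z. (1 + R) powr p * (1 + \<bar>z\<bar> / m) powr (- p))"
      by (intro integrable_mult_right integrable_inverse_power_decay p m)
    show "AE z in lborel. norm (?q z) \<le> norm ((1 + R) powr p * (1 + \<bar>z\<bar> / m) powr (- p))"
      using all by (intro AE_I2) simp
  qed measurable
  then show ?thesis
    unfolding abs_cont_rv_def by (rule absolutely_continuous_if_char_L2[OF D])
qed

text \<open>
  Strictness of the inequality leaves room to decrease both factors to finite values.
\<close>

lemma ereal_product_gt_witnesses:
  fixes S :: ennreal and L :: ereal
  assumes S: "0 < S" and c: "0 < c" and prod: "ereal c < enn2ereal S * L"
  obtains a k :: real where "0 < a" "ennreal a < S" "0 < k" "ereal k < L" "c < a * k"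
proof -
  have L: "0 < L"
  proof (rule ccontr)
    assume "\<not> 0 < L"
    then have "enn2ereal S * L \<le> 0" by (simp add: ereal_mult_le_0_iff not_less)
    then show False using prod c by (simp add: not_less[symmetric])
      (metis ereal_less(2) order_less_imp_le order_less_le_trans order_less_trans)
  qed
  show ?thesis
  proof (cases S)
    case top
    obtain k where k: "0 < ereal k" "ereal k < L" using ereal_dense2[OF L] by auto
    show ?thesis
      by (rule that[of "(c + 1) / k" k]) (use k c top in \<open>auto simp: field_simps\<close>)
  next
    case (real s)
    then have s: "0 < s" using S by (simp add: ennreal_less_zero_iff zero_less_iff_neq_zero order_le_less)
    have e: "enn2ereal S = ereal s" using real by simp
    show ?thesis
    proof (cases L)
      case (real l)
      then have sl: "c < s * l" and l: "0 < l" using prod e L by auto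
      \<comment> \<open>Since \<open>c / l < s\<close>, any \<open>a\<close> strictly between satisfies \<open>c / a < l\<close>, which leaves room for \<open>k\<close>.\<close>
      define a where "a = (s + c / l) / 2"
      have cl: "c / l < s" using sl l by (simp add: field_simps)
      have a: "c / l < a" "a < s" "0 < a" using cl c l by (auto simp: a_def field_simps add_pos_pos)
      define k where "k = (l + c / a) / 2"
      have ca: "c / a < l" using a l by (simp add: field_simps)
      have k: "c / a < k" "k < l" "0 < k" using ca c a l by (auto simp: k_def field_simps add_pos_pos)
      show ?thesis
        by (rule that[of a k]) (use a k real \<open>S = ennreal s\<close> in \<open>auto simp: ennreal_less_iff field_simps\<close>)
    next
      case PInf
      show ?thesis
        by (rule that[of "s / 2" "(c + 1) / (s / 2)"])
           (use s c PInf \<open>S = ennreal s\<close> in \<open>auto simp: ennreal_less_iff field_simps\<close>)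
    next
      case MInf
      then show ?thesis using L by simp
    qed
  qed
qed

text \<open>
  Jumps of size at most \<open>pi / \<bar>z\<bar>\<close> satisfy \<open>\<bar>z * x\<bar> \<le> pi\<close>, the range of the quadratic lower bound for
  \<open>1 - cos\<close>; the Gaussian part has the larger factor \<open>1 / 2\<close> instead of \<open>2 / pi\<^sup>2\<close>.
\<close>

lemma truncated_second_moment_bound:
  assumes \<nu>: "levy_measure \<nu>" and \<sigma>2: "0 \<le> \<sigma>2" and z: "z \<noteq> 0" and small: "pi / \<bar>z\<bar> < 1"
  shows "2 * z\<^sup>2 / pi\<^sup>2 * (\<sigma>2 + (LINT x:{- (pi / \<bar>z\<bar>)..pi / \<bar>z\<bar>}|\<nu>. x\<^sup>2)) \<le> - Re (levy_exponent \<sigma>2 \<nu> \<gamma> z)"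
proof -
  let ?e = "pi / \<bar>z\<bar>"
  let ?I = "{- ?e..?e}"
  have sets[measurable_cong]: "sets \<nu> = sets borel" by (rule levy_measure_sets[OF \<nu>])
  have le: "2 * z\<^sup>2 / pi\<^sup>2 * (indicator ?I x * x\<^sup>2) \<le> 1 - cos (z * x)" for x
  proof (cases "x \<in> ?I")
    case True
    then have "\<bar>x\<bar> \<le> ?e" by auto
    then have "\<bar>z * x\<bar> \<le> pi" using z by (simp add: abs_mult field_simps)
    from one_minus_cos_lower[OF this] True show ?thesis by (simp add: power_mult_distrib)
  qed simp
  have int: "integrable \<nu> (\<lambda>x. indicator ?I x * x\<^sup>2)"
  proof (rule Bochner_Integration.integrable_bound[OF integrable_min_levy_measure[OF \<nu>]])
    show "(\<lambda>x. indicator ?I x * x\<^sup>2) \<in> borel_measurable \<nu>" by measurable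
    have "indicator ?I x * x\<^sup>2 \<le> min 1 (x\<^sup>2)" for x
    proof (cases "x \<in> ?I")
      case True
      then have "\<bar>x\<bar> \<le> 1" using small by auto
      then show ?thesis using True by (simp add: abs_square_le_1)
    qed simp
    then show "AE x in \<nu>. norm (indicator ?I x * x\<^sup>2) \<le> norm (min 1 (x\<^sup>2))"
      by (intro AE_I2) simp
  qed
  have "2 * z\<^sup>2 / pi\<^sup>2 * (LINT x:?I|\<nu>. x\<^sup>2) = (LINT x|\<nu>. 2 * z\<^sup>2 / pi\<^sup>2 * (indicator ?I x * x\<^sup>2))"
    by (simp add: set_lebesgue_integral_def)
  also have "\<dots> \<le> (LINT x|\<nu>. 1 - cos (z * x))"
    using int by (intro integral_mono le integrable_mult_right Re_levy_exponent(1)[OF \<nu>])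
  finally have 1: "2 * z\<^sup>2 / pi\<^sup>2 * (LINT x:?I|\<nu>. x\<^sup>2) \<le> (LINT x|\<nu>. 1 - cos (z * x))" .
  have "4 \<le> pi\<^sup>2" using power_mono[of 2 pi 2] pi_ge_two by simp
  then have "2 / pi\<^sup>2 \<le> 1 / 2" by (simp add: field_simps)
  then have "2 / pi\<^sup>2 * (z\<^sup>2 * \<sigma>2) \<le> 1 / 2 * (z\<^sup>2 * \<sigma>2)" using \<sigma>2 by (intro mult_right_mono) auto
  then have 2: "2 * z\<^sup>2 / pi\<^sup>2 * \<sigma>2 \<le> \<sigma>2 * z\<^sup>2 / 2" by (simp add: mult.commute)
  show ?thesis unfolding Re_levy_exponent(2)[OF \<nu>] distrib_left using 1 2 by linarith
qed


text \<open>
  Apply \<open>truncated_second_moment_bound\<close> with \<open>\<epsilon> = pi / \<bar>z\<bar>\<close>: the lower bound becomes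
  \<open>2 * k * \<bar>ln \<epsilon>\<bar> = 2 * k * (ln \<bar>z\<bar> - ln pi)\<close>. Passing to a slightly smaller constant \<open>k'\<close> absorbs the
  additive constant and the difference between \<open>ln \<bar>z\<bar>\<close> and \<open>ln (1 + \<bar>z\<bar>)\<close>.
\<close>

lemma log_growth_if_second_moment:
  fixes \<sigma>2 \<gamma> a k :: real
  assumes \<nu>: "levy_measure \<nu>" and \<sigma>2: "0 \<le> \<sigma>2" and a: "0 < a" and k: "0 < k" and ak: "1 / 4 < a * k"
    and ev: "\<forall>\<^sub>F \<epsilon> in at_right 0. k < inverse (\<epsilon>\<^sup>2) * inverse \<bar>ln \<epsilon>\<bar> * (\<sigma>2 + (LINT x:{-\<epsilon>..\<epsilon>}|\<nu>. x\<^sup>2))"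
  shows "\<exists>\<kappa> R. 0 < \<kappa> \<and> 1 / 2 < a * \<kappa> \<and> 0 \<le> R \<and>
    (\<forall>z. R \<le> \<bar>z\<bar> \<longrightarrow> \<kappa> * ln (1 + \<bar>z\<bar>) \<le> - Re (levy_exponent \<sigma>2 \<nu> \<gamma> z))"
proof -
  obtain b where b: "0 < b" "\<And>\<epsilon>. 0 < \<epsilon> \<Longrightarrow> \<epsilon> < b \<Longrightarrow> k < inverse (\<epsilon>\<^sup>2) * inverse \<bar>ln \<epsilon>\<bar> * (\<sigma>2 + (LINT x:{-\<epsilon>..\<epsilon>}|\<nu>. x\<^sup>2))"
    using ev unfolding eventually_at_right_field by auto
  \<comment> \<open>Halfway between \<open>k\<close> and the smallest constant that still gives \<open>1 / 4\<close> after multiplication by \<open>a\<close>.\<close>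
  define k' where "k' = (k + 1 / (4 * a)) / 2"
  have "1 / (4 * a) < k" using ak a by (simp add: field_simps)
  then have k': "k' < k" "1 / (4 * a) < k'" by (simp_all add: k'_def field_simps)
  have "0 < 1 / (4 * a)" using a by simp
  then have k'0: "0 < k'" using k'(2) by linarith
  have ak': "1 / 2 < a * (2 * k')" using k'(2) a by (simp add: field_simps)
  \<comment> \<open>For \<open>ln \<bar>z\<bar> \<ge> c\<close> one has \<open>k' * (ln 2 + ln \<bar>z\<bar>) \<le> k * (ln \<bar>z\<bar> - ln pi)\<close>.\<close>
  define c where "c = (k' * ln 2 + k * ln pi) / (k - k')"
  define R where "R = max (exp c) (max 4 (pi / b + 1))"
  have "2 * k' * ln (1 + \<bar>z\<bar>) \<le> - Re (levy_exponent \<sigma>2 \<nu> \<gamma> z)" if z: "R \<le> \<bar>z\<bar>" for z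
  proof -
    have z4: "4 \<le> \<bar>z\<bar>" and zb: "pi / b < \<bar>z\<bar>" and zc: "exp c \<le> \<bar>z\<bar>" using z by (auto simp: R_def)
    define e where "e = pi / \<bar>z\<bar>"
    have e0: "0 < e" using z4 by (auto simp: e_def)
    have e1: "e < 1" using z4 pi_less_4 by (simp add: e_def field_simps)
    have eb: "e < b" using zb b(1) z4 by (simp add: e_def field_simps)
    have lne: "\<bar>ln e\<bar> = ln \<bar>z\<bar> - ln pi" "0 < \<bar>ln e\<bar>"
    proof -
      have "ln e < 0" using e0 e1 by simp
      moreover have "ln e = ln pi - ln \<bar>z\<bar>" using z4 by (simp add: e_def ln_div)
      ultimately show "\<bar>ln e\<bar> = ln \<bar>z\<bar> - ln pi" "0 < \<bar>ln e\<bar>" by auto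
    qed
    let ?h = "\<sigma>2 + (LINT x:{-e..e}|\<nu>. x\<^sup>2)"
    have "k * \<bar>ln e\<bar> \<le> inverse (e\<^sup>2) * ?h"
    proof -
      have "k * \<bar>ln e\<bar> \<le> (inverse (e\<^sup>2) * inverse \<bar>ln e\<bar> * ?h) * \<bar>ln e\<bar>"
        using b(2)[OF e0 eb] by (intro mult_right_mono) auto
      also have "\<dots> = inverse (e\<^sup>2) * ?h * (inverse \<bar>ln e\<bar> * \<bar>ln e\<bar>)" by (simp only: ac_simps)
      also have "inverse \<bar>ln e\<bar> * \<bar>ln e\<bar> = 1" using lne(2) by (intro left_inverse) auto
      finally show ?thesis by simp
    qed
    moreover have "inverse (e\<^sup>2) = z\<^sup>2 / pi\<^sup>2" by (simp add: e_def power_divide)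
    ultimately have 1: "2 * (k * \<bar>ln e\<bar>) \<le> 2 * z\<^sup>2 / pi\<^sup>2 * ?h" by simp
    have "z \<noteq> 0" using z4 by auto
    then have 2: "2 * z\<^sup>2 / pi\<^sup>2 * ?h \<le> - Re (levy_exponent \<sigma>2 \<nu> \<gamma> z)"
      using truncated_second_moment_bound[OF \<nu> \<sigma>2, of z \<gamma>] e1 unfolding e_def by simp
    have "ln (1 + \<bar>z\<bar>) \<le> ln (2 * \<bar>z\<bar>)" using z4 by (intro ln_mono) auto
    also have "\<dots> = ln 2 + ln \<bar>z\<bar>" using z4 by (intro ln_mult_pos) auto
    finally have 3: "k' * ln (1 + \<bar>z\<bar>) \<le> k' * (ln 2 + ln \<bar>z\<bar>)" using k'0 by (intro mult_left_mono) auto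
    have "c \<le> ln \<bar>z\<bar>" using zc z4 by (subst ln_ge_iff) auto
    then have "c * (k - k') \<le> ln \<bar>z\<bar> * (k - k')" using k'(1) by (intro mult_right_mono) auto
    moreover have "c * (k - k') = k' * ln 2 + k * ln pi" using k'(1) by (simp add: c_def)
    ultimately have "k' * (ln 2 + ln \<bar>z\<bar>) \<le> k * (ln \<bar>z\<bar> - ln pi)" by (simp add: algebra_simps)
    with 1 2 3 lne(1) show ?thesis by simp
  qed
  moreover have "0 \<le> R" by (simp add: R_def le_max_iff_disj)
  ultimately show ?thesis using k'0 ak' by (intro exI[of _ "2 * k'"] exI[of _ R]) auto
qed

lemma log_growth_if_Liminf:
  fixes \<sigma>2 \<gamma> k :: real
  assumes "ereal k < Liminf at_infinity (\<lambda>z :: real. ereal (- Re (levy_exponent \<sigma>2 \<nu> \<gamma> z) / ln (1 + \<bar>z\<bar>)))"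
  shows "\<exists>R\<ge>0. \<forall>z. R \<le> \<bar>z\<bar> \<longrightarrow> k * ln (1 + \<bar>z\<bar>) \<le> - Re (levy_exponent \<sigma>2 \<nu> \<gamma> z)"
proof -
  have "\<forall>\<^sub>F z in at_infinity. ereal k < ereal (- Re (levy_exponent \<sigma>2 \<nu> \<gamma> z) / ln (1 + \<bar>z\<bar>))"
    by (rule less_LiminfD[OF assms])
  then obtain b where b: "\<And>z. b \<le> \<bar>z\<bar> \<Longrightarrow> k < - Re (levy_exponent \<sigma>2 \<nu> \<gamma> z) / ln (1 + \<bar>z\<bar>)"
    unfolding eventually_at_infinity by auto
  have "k * ln (1 + \<bar>z\<bar>) \<le> - Re (levy_exponent \<sigma>2 \<nu> \<gamma> z)" if "max 1 b \<le> \<bar>z\<bar>" for z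
  proof -
    have pos: "0 < ln (1 + \<bar>z\<bar>)" using that by (intro ln_gt_zero) auto
    have "k < - Re (levy_exponent \<sigma>2 \<nu> \<gamma> z) / ln (1 + \<bar>z\<bar>)" using that by (intro b) auto
    then have "k * ln (1 + \<bar>z\<bar>) < - Re (levy_exponent \<sigma>2 \<nu> \<gamma> z)"
      by (rule pos_less_divide_eq[OF pos, THEN iffD1])
    then show ?thesis by (rule less_imp_le)
  qed
  then show ?thesis by (intro exI[of _ "max 1 b"] conjI allI impI) (simp_all only: max.cobounded1 le_max_iff_disj zero_le_one simp_thms)
qed

section \<open>Sufficient conditions for absolute continuity\<close>

theorem corollary6p3:
  fixes M :: "'a measure" and \<eta> :: "real \<Rightarrow> 'a \<Rightarrow> real"
    and \<sigma>2 \<gamma> :: real and \<nu> :: "real measure"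
    and f :: "real \<Rightarrow> real" and X :: "'a \<Rightarrow> real"
  defines "supp_len \<equiv> emeasure lborel {s \<in> {0..}. f s \<noteq> 0}"
  assumes "levy_process M \<eta>"
    and "has_char_triplet M \<eta> \<sigma>2 \<nu> \<gamma>"
    and "f \<in> borel_measurable (restrict_space borel {0..})"
    and "has_improper_levy_integral M \<eta> f X"
    and "supp_len > 0"
  shows
    "(enn2ereal supp_len *
        Liminf (at_right 0) (\<lambda>\<epsilon>. ereal (inverse (\<epsilon>\<^sup>2) * inverse \<bar>ln \<epsilon>\<bar> *
          (\<sigma>2 + (LINT x:{-\<epsilon>..\<epsilon>}|\<nu>. x\<^sup>2)))) > ereal (1 / 4)
        \<longrightarrow> abs_cont_rv M X) \<and>
     (enn2ereal supp_len *
        Liminf at_infinity (\<lambda>z :: real.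
          ereal (- Re (levy_exponent \<sigma>2 \<nu> \<gamma> z) / ln (1 + \<bar>z\<bar>))) > ereal (1 / 2)
        \<longrightarrow> abs_cont_rv M X) \<and>
     ((\<exists>\<nu>ac \<nu>sing. lebesgue_decomposition \<nu> \<nu>ac \<nu>sing \<and>
          supp_len * emeasure \<nu>ac UNIV = \<infinity>)
        \<longrightarrow> abs_cont_rv M X) \<and>
     ((\<forall>B\<in>sets borel. B \<subseteq> UNIV - {0} \<longrightarrow> emeasure lborel B = 0 \<longrightarrow>
          emeasure lborel {s \<in> {0..}. f s \<in> B} = 0) \<and>
        supp_len * emeasure \<nu> UNIV = \<infinity>
        \<longrightarrow> abs_cont_rv M X) \<and>
     ((\<exists>b>0. abs_cont_rv M (\<eta> b) \<and>
          (\<exists>a\<ge>0. \<exists>c. c \<noteq> 0 \<and> (\<forall>s\<in>{a<..<a + b}. f s = c)))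
        \<longrightarrow> abs_cont_rv M X)"
proof -
  note levy = assms(2) and trip = assms(3)
  define f0 where "f0 s = (if s \<in> {0..} then f s else 0)" for s
  have f0: "f0 \<in> borel_measurable borel"
    using assms(4) unfolding f0_def by (subst (asm) measurable_restrict_space_iff[where c=0]) auto
  have f0_eq: "f0 s = f s" if "0 \<le> s" for s using that by (simp add: f0_def)
  have X: "has_improper_levy_integral M \<eta> f0 X"
    by (rule has_improper_levy_integral_cong[THEN iffD2, OF f0_eq assms(5)])
  have supp: "emeasure lborel {s \<in> {0..}. f0 s \<noteq> 0} = supp_len"
  proof -
    have "{s \<in> {0..}. f0 s \<noteq> 0} = {s \<in> {0..}. f s \<noteq> 0}" by (auto simp: f0_def)
    then show ?thesis by (simp only: supp_len_def)
  qed
  interpret levy_integral M \<eta> \<sigma>2 \<nu> \<gamma> f0 X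
    using trip f0 X by (intro levy_integral.intro levy levy_integral_axioms.intro)
  have log: "abs_cont_rv M X"
    if "0 < a" "ennreal a < supp_len" "0 < \<kappa>" "1 / 2 < a * \<kappa>" "0 \<le> R"
      and "\<And>z. R \<le> \<bar>z\<bar> \<Longrightarrow> \<kappa> * ln (1 + \<bar>z\<bar>) \<le> - Re (levy_exponent \<sigma>2 \<nu> \<gamma> z)" for a \<kappa> R
    by (rule abs_cont_rv_log_growth[OF that(1) that(2)[folded supp] that(3-6)])
  show ?thesis
  proof (intro conjI impI)
    assume gt: "enn2ereal supp_len *
        Liminf (at_right 0) (\<lambda>\<epsilon>. ereal (inverse (\<epsilon>\<^sup>2) * inverse \<bar>ln \<epsilon>\<bar> *
          (\<sigma>2 + (LINT x:{-\<epsilon>..\<epsilon>}|\<nu>. x\<^sup>2)))) > ereal (1 / 4)"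
    obtain a k where ak: "0 < a" "ennreal a < supp_len" "0 < k" "1 / 4 < a * k"
      and k: "ereal k < Liminf (at_right 0) (\<lambda>\<epsilon>. ereal (inverse (\<epsilon>\<^sup>2) * inverse \<bar>ln \<epsilon>\<bar> *
          (\<sigma>2 + (LINT x:{-\<epsilon>..\<epsilon>}|\<nu>. x\<^sup>2))))"
      by (rule ereal_product_gt_witnesses[OF assms(6) _ gt]) auto
    have "\<forall>\<^sub>F \<epsilon> in at_right 0. k < inverse (\<epsilon>\<^sup>2) * inverse \<bar>ln \<epsilon>\<bar> * (\<sigma>2 + (LINT x:{-\<epsilon>..\<epsilon>}|\<nu>. x\<^sup>2))"
      using less_LiminfD[OF k] by simp
    from log_growth_if_second_moment[OF \<nu> \<sigma>2 ak(1,3,4) this, of \<gamma>] log[OF ak(1,2)]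
    show "abs_cont_rv M X" by blast
  next
    assume gt: "enn2ereal supp_len *
        Liminf at_infinity (\<lambda>z :: real.
          ereal (- Re (levy_exponent \<sigma>2 \<nu> \<gamma> z) / ln (1 + \<bar>z\<bar>))) > ereal (1 / 2)"
    obtain a k where ak: "0 < a" "ennreal a < supp_len" "0 < k" "1 / 2 < a * k"
      and k: "ereal k < Liminf at_infinity (\<lambda>z :: real. ereal (- Re (levy_exponent \<sigma>2 \<nu> \<gamma> z) / ln (1 + \<bar>z\<bar>)))"
      by (rule ereal_product_gt_witnesses[OF assms(6) _ gt]) auto
    from log_growth_if_Liminf[OF k] log[OF ak] show "abs_cont_rv M X" by blast
  next
    assume "\<exists>\<nu>ac \<nu>sing. lebesgue_decomposition \<nu> \<nu>ac \<nu>sing \<and> supp_len * emeasure \<nu>ac UNIV = \<infinity>"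
    then show "abs_cont_rv M X"
      using abs_cont_rv_ac_part[unfolded supp] by blast
  next
    assume spread: "(\<forall>B\<in>sets borel. B \<subseteq> UNIV - {0} \<longrightarrow> emeasure lborel B = 0 \<longrightarrow>
          emeasure lborel {s \<in> {0..}. f s \<in> B} = 0) \<and>
        supp_len * emeasure \<nu> UNIV = \<infinity>"
    show "abs_cont_rv M X"
    proof (rule abs_cont_rv_spreading_integrand)
      show "emeasure lborel {s \<in> {0..}. f0 s \<noteq> 0} * emeasure \<nu> UNIV = \<infinity>"
        unfolding supp using spread by blast
      fix B :: "real set" assume B: "B \<in> sets borel" "B \<subseteq> UNIV - {0}" "emeasure lborel B = 0"
      have "{s \<in> {0..}. f0 s \<in> B} = {s \<in> {0..}. f s \<in> B}" by (auto simp: f0_def)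
      then show "emeasure lborel {s \<in> {0..}. f0 s \<in> B} = 0"
        using spread B by simp
    qed
  next
    assume "\<exists>b>0. abs_cont_rv M (\<eta> b) \<and> (\<exists>a\<ge>0. \<exists>c. c \<noteq> 0 \<and> (\<forall>s\<in>{a<..<a + b}. f s = c))"
    then obtain b a c where b: "0 < b" "abs_cont_rv M (\<eta> b)" "0 \<le> a" "c \<noteq> 0"
      and const: "\<And>s. s \<in> {a<..<a + b} \<Longrightarrow> f s = c" by blast
    show "abs_cont_rv M X"
      by (rule abs_cont_rv_constant_piece[OF b]) (use b(3) const in \<open>auto simp: f0_def\<close>)
  qed
qed

end
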